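(* There exists a nonempty $C^1$-open subset $\mathcal{U}$ of the space of $C^1$ local diffeomorphisms of $\mathbb{T}^2$ such that every $f\in\mathcal{U}$ is derived from Anosov, but $f$ is not topologically semi-conjugate to any Anosov map $g:\mathbb{T}^2\to\mathbb{T}^2$. Indeed, for every linear Anosov map $A:\mathbb{T}^2\to\mathbb{T}^2$ there exists such a (nonempty, $C^1$-open) subset $\mathcal{U}$ contained in the homotopy class of $A$.
   Context: $\mathbb{T}^2=\mathbb{R}^2/\mathbb{Z}^2$. A local diffeomorphism $f:M\to M$ of a closed Riemannian manifold is called an Anosov local diffeomorphism if there is a continuous $Df$-invariant subbundle $E^s_f\subset TM$ such that $Df$ uniformly contracts $E^s_f$ and uniformly expands the quotient bundle $TM/E^s_f$. Throughout, "Anosov map" means a non-invertible Anosov local diffeomorphism which is neither an Anosov diffeomorphism nor an expanding map. A linear Anosov map of $\mathbb{T}^2$ is an Anosov map induced by an integer matrix $A$ (so $|\det A|\ge 2$, and $A$ has one eigenvalue of modulus $<1$ and one of modulus $>1$). A local diffeomorphism of $\mathbb{T}^2$ is derived from Anosov if it is homotopic to a linear Anosov map. For local diffeomorphisms $f,g:\mathbb{T}^2\to\mathbb{T}^2$, $f$ is topologically semi-conjugate to $g$ if there is a continuous surjection $h:\mathbb{T}^2\to\mathbb{T}^2$ homotopic to the identity with $h\circ f=g\circ h$. *)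

theory Defs
  imports "HOL-Analysis.Analysis"
begin

definition torus_rel :: "real^2 \<Rightarrow> real^2 \<Rightarrow> bool" where
  "torus_rel x y \<longleftrightarrow> (\<forall>i. x $ i - y $ i \<in> \<int>)"

lemma equivp_torus_rel: "equivp torus_rel"
proof (rule equivpI)
  show "reflp torus_rel" by (auto simp: reflp_def torus_rel_def)
  show "symp torus_rel"
    unfolding symp_def torus_rel_def by (metis Ints_minus minus_diff_eq)
  show "transp torus_rel"
    unfolding transp_def torus_rel_def by (metis Ints_add diff_add_cancel add_diff_eq)
qed

quotient_type torus = "real^2" / torus_rel
  by (rule equivp_torus_rel)

abbreviation torus_proj :: "real^2 \<Rightarrow> torus" where
  "torus_proj \<equiv> abs_torus"

abbreviation torus_fibre :: "torus \<Rightarrow> (real^2) set" where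
  "torus_fibre p \<equiv> torus_proj -` {p}"

lemma torus_proj_eq_iff: "torus_proj x = torus_proj y \<longleftrightarrow> (\<forall>i. x $ i - y $ i \<in> \<int>)"
  by (simp add: torus.abs_eq_iff torus_rel_def)

lemma torus_proj_surj: "\<exists>x. torus_proj x = p"
  by (metis Quotient3_abs_rep Quotient3_torus)

lemma torus_fibre_nonempty: "torus_fibre p \<noteq> {}"
  using torus_proj_surj[of p] by auto

lemma closed_torus_fibre: "closed (torus_fibre p)"
proof -
  obtain x where x: "torus_proj x = p" using torus_proj_surj by blast
  have "torus_fibre p = (\<Inter>i. (\<lambda>y. y $ i - x $ i) -` \<int>)"
    by (auto simp: x[symmetric] torus_proj_eq_iff)
  moreover have "closed ((\<lambda>y::real^2. y $ i - x $ i) -` \<int>)" for i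
    by (intro closed_vimage closed_Ints continuous_intros)
  ultimately show ?thesis by auto
qed

lemma torus_setdist_eq_infdist:
  assumes "torus_proj x = p"
  shows "setdist (torus_fibre p) (torus_fibre q) = infdist x (torus_fibre q)"
proof (rule antisym)
  show "setdist (torus_fibre p) (torus_fibre q) \<le> infdist x (torus_fibre q)"
    using assms by (metis infdist_eq_setdist setdist_subset_left empty_not_insert
        insert_subset empty_subsetI vimage_singleton_eq)
  show "infdist x (torus_fibre q) \<le> setdist (torus_fibre p) (torus_fibre q)"
  proof (rule le_setdistI)
    fix y z assume "y \<in> torus_fibre p" "z \<in> torus_fibre q"
    then have "torus_proj (z - y + x) = q"
      using assms by (auto simp: torus_proj_eq_iff)
    then have "infdist x (torus_fibre q) \<le> dist x (z - y + x)"
      by (intro infdist_le) auto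
    then show "infdist x (torus_fibre q) \<le> dist y z"
      by (simp add: dist_norm norm_minus_commute)
  qed (use torus_fibre_nonempty in auto)
qed

instantiation torus :: metric_space
begin

definition dist_torus :: "torus \<Rightarrow> torus \<Rightarrow> real" where
  "dist_torus p q = setdist (torus_fibre p) (torus_fibre q)"

definition uniformity_torus :: "(torus \<times> torus) filter" where
  "uniformity_torus = (INF e\<in>{0<..}. principal {(p, q). dist p q < e})"

definition open_torus :: "torus set \<Rightarrow> bool" where
  "open_torus U \<longleftrightarrow> (\<forall>p\<in>U. eventually (\<lambda>(p', q). p' = p \<longrightarrow> q \<in> U) uniformity)"

instance
proof
  fix p q r :: torus
  obtain x where x: "torus_proj x = p" using torus_proj_surj by blast
  show "dist p q = 0 \<longleftrightarrow> p = q"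
    using in_closed_iff_infdist_zero[OF closed_torus_fibre torus_fibre_nonempty, of x q] x
    by (auto simp: dist_torus_def torus_setdist_eq_infdist[OF x])
  have tri: "dist p q \<le> dist p r + dist r q" for p q r :: torus
  proof -
    obtain x where x: "torus_proj x = p" using torus_proj_surj by blast
    have "infdist x (torus_fibre q) - dist r q \<le> infdist x (torus_fibre r)"
      unfolding infdist_def[of x "torus_fibre r"] if_not_P[OF torus_fibre_nonempty]
    proof (rule cINF_greatest[OF torus_fibre_nonempty])
      fix y assume "y \<in> torus_fibre r"
      then have y: "torus_proj y = r" by auto
      show "infdist x (torus_fibre q) - dist r q \<le> dist x y"
        using infdist_triangle[of x "torus_fibre q" y]
        by (simp add: dist_torus_def torus_setdist_eq_infdist[OF y])
    qed
    then show ?thesis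
      by (simp add: dist_torus_def[of p] torus_setdist_eq_infdist[OF x])
  qed
  have "dist q r = dist r q" by (simp add: dist_torus_def setdist_sym)
  then show "dist p q \<le> dist p r + dist q r" using tri[of p q r] by simp
qed (simp_all add: uniformity_torus_def open_torus_def)

end

text \<open>The flat metric induces the quotient topology.\<close>

lemma open_torus_iff_quotient: "open U \<longleftrightarrow> open (torus_proj -` U)"
proof
  assume U: "open U"
  have d: "dist (torus_proj x) (torus_proj y) \<le> dist x y" for x y
    unfolding dist_torus_def by (rule setdist_le_dist) auto
  have "continuous_on UNIV torus_proj"
    unfolding continuous_on_iff using d by (meson le_less_trans)
  with U show "open (torus_proj -` U)" by (simp add: open_vimage)
next
  assume U: "open (torus_proj -` U)"
  show "open U"
    unfolding open_dist
  proof
    fix p assume "p \<in> U"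
    obtain x where x: "torus_proj x = p" using torus_proj_surj by blast
    with U \<open>p \<in> U\<close> obtain e where e: "e > 0" "\<And>y. dist y x < e \<Longrightarrow> torus_proj y \<in> U"
      unfolding open_dist by (metis vimageI2 vimageD)
    have "q \<in> U" if "dist q p < e" for q
    proof -
      have "infdist x (torus_fibre q) < e"
        using that by (simp add: dist_commute dist_torus_def torus_setdist_eq_infdist[OF x])
      then obtain y where "y \<in> torus_fibre q" "dist x y < e"
        by (metis infdist_def if_not_P torus_fibre_nonempty cINF_less_iff bdd_below_image_dist)
      then show ?thesis using e by (auto simp: dist_commute)
    qed
    then show "\<exists>e>0. \<forall>q. dist q p < e \<longrightarrow> q \<in> U" using e by blast
  qed
qed

text \<open>
  The tangent bundle is trivialised by translations, so that the differential of a map at any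
  point is an endomorphism of the plane. It is read off from a local lift; no regularity of
  the lift away from the point \<open>x\<close> is required.
\<close>

definition torus_has_derivative ::
    "(torus \<Rightarrow> torus) \<Rightarrow> ((real^2) \<Rightarrow>\<^sub>L (real^2)) \<Rightarrow> torus \<Rightarrow> bool" where
  "torus_has_derivative f D p \<longleftrightarrow>
     (\<exists>x F. torus_proj x = p \<and> (\<forall>\<^sub>F y in nhds x. torus_proj (F y) = f (torus_proj y)) \<and>
        (F has_derivative blinfun_apply D) (at x))"

definition torus_deriv :: "(torus \<Rightarrow> torus) \<Rightarrow> torus \<Rightarrow> ((real^2) \<Rightarrow>\<^sub>L (real^2))" where
  "torus_deriv f p = (THE D. torus_has_derivative f D p)"

lemma torus_has_derivative_unique:
  assumes "torus_has_derivative f D p" "torus_has_derivative f D' p"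
  shows "D = D'"
proof -
  obtain x F where F: "torus_proj x = p" "\<forall>\<^sub>F y in nhds x. torus_proj (F y) = f (torus_proj y)"
      "(F has_derivative blinfun_apply D) (at x)"
    using assms(1) unfolding torus_has_derivative_def by blast
  obtain x' G where G: "torus_proj x' = p"
      "\<forall>\<^sub>F y in nhds x'. torus_proj (G y) = f (torus_proj y)"
      "(G has_derivative blinfun_apply D') (at x')"
    using assms(2) unfolding torus_has_derivative_def by blast
  define t where "t = x' - x"
  have t: "torus_proj (y + t) = torus_proj y" for y
    using F(1) G(1) by (auto simp: t_def torus_proj_eq_iff)
  define H where "H y = G (y + t) - F y" for y
  have G': "((\<lambda>y. G (y + t)) has_derivative blinfun_apply D') (at x)"
  proof -
    have "((\<lambda>y. y + t) has_derivative (\<lambda>v. v)) (at x)"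
      by (auto intro!: derivative_eq_intros)
    moreover have "(G has_derivative blinfun_apply D') (at (x + t))"
      using G(3) by (simp add: t_def)
    ultimately show ?thesis by (rule has_derivative_compose)
  qed
  then have H': "(H has_derivative (\<lambda>v. D' v - D v)) (at x)"
    unfolding H_def by (intro has_derivative_diff F(3))
  have "filterlim (\<lambda>y. y + t) (nhds x') (nhds x)"
    using tendsto_add[OF filterlim_ident[of "nhds x"] tendsto_const[of t]]
    by (simp add: t_def)
  then have "\<forall>\<^sub>F y in nhds x. torus_proj (G (y + t)) = f (torus_proj y)"
    using filterlim_iff G(2) t by (smt (verit, best) eventually_mono)
  with F(2) have int: "\<forall>\<^sub>F y in nhds x. \<forall>i. H y $ i \<in> \<int>"
    by eventually_elim (simp add: H_def torus_proj_eq_iff[symmetric])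
  have Hx: "H x $ i \<in> \<int>" for i using eventually_nhds_x_imp_x[OF int] by simp
  have "(H \<longlongrightarrow> H x) (nhds x)"
    using has_derivative_continuous[OF H'] by (simp add: continuous_within tendsto_at_iff_tendsto_nhds)
  then have "\<forall>\<^sub>F y in nhds x. dist (H y) (H x) < 1"
    by (rule tendstoD) simp
  with int have ev: "\<forall>\<^sub>F y in nhds x. H y = H x"
  proof eventually_elim
    case (elim y)
    have "\<bar>H y $ i - H x $ i\<bar> < 1" for i
      using elim(2) component_le_norm_cart[of "H y - H x" i] by (simp add: dist_norm)
    then show ?case using elim(1) Hx by (simp add: vec_eq_iff Ints_eq_abs_less1)
  qed
  have "((\<lambda>_. H x) has_derivative (\<lambda>v. D' v - D v)) (at x)"
    using ev by (intro has_derivative_transform_eventually[OF H'])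
      (auto simp: eventually_at_filter elim: eventually_mono)
  then have "(\<lambda>v. D' v - D v) = (\<lambda>v. 0)"
    by (rule has_derivative_unique) (rule has_derivative_const)
  then show ?thesis by (intro blinfun_eqI) (metis eq_iff_diff_eq_0)
qed

definition torus_C1_on :: "torus set \<Rightarrow> (torus \<Rightarrow> torus) \<Rightarrow> bool" where
  "torus_C1_on U f \<longleftrightarrow>
     (\<forall>p\<in>U. \<exists>D. torus_has_derivative f D p) \<and> continuous_on U (torus_deriv f)"

definition torus_local_diffeo :: "(torus \<Rightarrow> torus) \<Rightarrow> bool" where
  "torus_local_diffeo f \<longleftrightarrow>
     (\<forall>p. \<exists>U. open U \<and> p \<in> U \<and> open (f ` U) \<and> inj_on f U \<and>
        torus_C1_on U f \<and> torus_C1_on (f ` U) (inv_into U f))"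

text \<open>
  The torus being compact, the \<open>C\<^sup>1\<close> topology is that of uniform convergence of the maps and
  of their differentials.
\<close>

definition C1_local_diffeo_topology :: "(torus \<Rightarrow> torus) topology" where
  "C1_local_diffeo_topology = topology (\<lambda>\<U>.
     \<U> \<subseteq> Collect torus_local_diffeo \<and>
     (\<forall>f\<in>\<U>. \<exists>\<epsilon>>0. \<forall>g. torus_local_diffeo g \<and>
        (\<forall>p. dist (f p) (g p) < \<epsilon> \<and> norm (torus_deriv f p - torus_deriv g p) < \<epsilon>)
        \<longrightarrow> g \<in> \<U>))"

lemma openin_C1_local_diffeo_topology:
  "openin C1_local_diffeo_topology \<U> \<longleftrightarrow>
     \<U> \<subseteq> Collect torus_local_diffeo \<and>
     (\<forall>f\<in>\<U>. \<exists>\<epsilon>>0. \<forall>g. torus_local_diffeo g \<and>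
        (\<forall>p. dist (f p) (g p) < \<epsilon> \<and> norm (torus_deriv f p - torus_deriv g p) < \<epsilon>)
        \<longrightarrow> g \<in> \<U>)"
proof -
  let ?near = "\<lambda>f \<epsilon> g. torus_local_diffeo g \<and>
        (\<forall>p. dist (f p) (g p) < \<epsilon> \<and> norm (torus_deriv f p - torus_deriv g p) < \<epsilon>)"
  have "istopology (\<lambda>\<U>. \<U> \<subseteq> Collect torus_local_diffeo \<and>
     (\<forall>f\<in>\<U>. \<exists>\<epsilon>>0. \<forall>g. ?near f \<epsilon> g \<longrightarrow> g \<in> \<U>))"
    unfolding istopology_def
  proof (intro conjI allI impI ballI)
    fix S T f
    assume S: "S \<subseteq> Collect torus_local_diffeo \<and> (\<forall>f\<in>S. \<exists>\<epsilon>>0. \<forall>g. ?near f \<epsilon> g \<longrightarrow> g \<in> S)"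
      and T: "T \<subseteq> Collect torus_local_diffeo \<and> (\<forall>f\<in>T. \<exists>\<epsilon>>0. \<forall>g. ?near f \<epsilon> g \<longrightarrow> g \<in> T)"
    show "S \<inter> T \<subseteq> Collect torus_local_diffeo" using S by blast
    assume "f \<in> S \<inter> T"
    then obtain d e where "d > 0" "\<And>g. ?near f d g \<Longrightarrow> g \<in> S" "e > 0" "\<And>g. ?near f e g \<Longrightarrow> g \<in> T"
      using S T by (metis (no_types, lifting) IntE)
    then have "min d e > 0 \<and> (\<forall>g. ?near f (min d e) g \<longrightarrow> g \<in> S \<inter> T)" by simp
    then show "\<exists>\<epsilon>>0. \<forall>g. ?near f \<epsilon> g \<longrightarrow> g \<in> S \<inter> T" by blast
  next
    fix K f
    assume K: "\<forall>S\<in>K. S \<subseteq> Collect torus_local_diffeo \<and>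
        (\<forall>f\<in>S. \<exists>\<epsilon>>0. \<forall>g. ?near f \<epsilon> g \<longrightarrow> g \<in> S)"
    show "\<Union>K \<subseteq> Collect torus_local_diffeo" using K by blast
    assume "f \<in> \<Union>K"
    then obtain S where "S \<in> K" "f \<in> S" by blast
    then show "\<exists>\<epsilon>>0. \<forall>g. ?near f \<epsilon> g \<longrightarrow> g \<in> \<Union>K" using K by (metis (no_types, lifting) UnionI)
  qed
  then show ?thesis
    unfolding C1_local_diffeo_topology_def by (simp add: topology_inverse')
qed

definition continuous_subbundle :: "(torus \<Rightarrow> (real^2) set) \<Rightarrow> bool" where
  "continuous_subbundle E \<longleftrightarrow>
     (\<exists>k::nat. \<forall>p. \<exists>U s. open U \<and> p \<in> U \<and> (\<forall>i<k. continuous_on U (s i)) \<and>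
        (\<forall>q\<in>U. inj_on (\<lambda>i. s i q) {..<k} \<and> independent ((\<lambda>i. s i q) ` {..<k}) \<and>
           E q = span ((\<lambda>i. s i q) ` {..<k})))"

text \<open>
  The quotient norm of the class of \<open>v\<close> modulo \<open>E p\<close> is the distance of \<open>v\<close> to \<open>E p\<close>.
\<close>

definition anosov_local_diffeo :: "(torus \<Rightarrow> torus) \<Rightarrow> bool" where
  "anosov_local_diffeo f \<longleftrightarrow> torus_local_diffeo f \<and>
     (\<exists>E. continuous_subbundle E \<and> (\<forall>p. torus_deriv f p ` E p = E (f p)) \<and>
        (\<exists>C>0. \<exists>\<mu>. 0 < \<mu> \<and> \<mu> < 1 \<and>
           (\<forall>n p. \<forall>v\<in>E p. norm (torus_deriv (f ^^ n) p v) \<le> C * \<mu> ^ n * norm v) \<and>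
           (\<forall>n p v. infdist v (E p) \<le>
              C * \<mu> ^ n * infdist (torus_deriv (f ^^ n) p v) (E ((f ^^ n) p)))))"

definition expanding_map :: "(torus \<Rightarrow> torus) \<Rightarrow> bool" where
  "expanding_map f \<longleftrightarrow> torus_local_diffeo f \<and>
     (\<exists>C>0. \<exists>\<mu>. 0 < \<mu> \<and> \<mu> < 1 \<and>
        (\<forall>n p v. norm v \<le> C * \<mu> ^ n * norm (torus_deriv (f ^^ n) p v)))"

text \<open>Anosov diffeomorphisms are excluded by non-invertibility.\<close>

definition anosov_map :: "(torus \<Rightarrow> torus) \<Rightarrow> bool" where
  "anosov_map f \<longleftrightarrow> anosov_local_diffeo f \<and> \<not> bij f \<and> \<not> expanding_map f"

lift_definition torus_linear :: "int^2^2 \<Rightarrow> torus \<Rightarrow> torus" is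
  "\<lambda>A x. map_matrix of_int A *v x"
proof -
  fix A :: "int^2^2" and x y :: "real^2"
  let ?A = "map_matrix of_int A :: real^2^2"
  assume "torus_rel x y"
  then show "torus_rel (?A *v x) (?A *v y)"
    by (auto simp: torus_rel_def matrix_vector_mult_def sum_subtractf[symmetric]
        right_diff_distrib[symmetric] intro!: Ints_sum Ints_mult)
qed

definition linear_anosov :: "int^2^2 \<Rightarrow> bool" where
  "linear_anosov A \<longleftrightarrow> anosov_map (torus_linear A)"

abbreviation torus_homotopic :: "(torus \<Rightarrow> torus) \<Rightarrow> (torus \<Rightarrow> torus) \<Rightarrow> bool" where
  "torus_homotopic \<equiv> homotopic_with_canon (\<lambda>_. True) UNIV UNIV"

definition derived_from_anosov :: "(torus \<Rightarrow> torus) \<Rightarrow> bool" where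
  "derived_from_anosov f \<longleftrightarrow> torus_local_diffeo f \<and>
     (\<exists>A. linear_anosov A \<and> torus_homotopic f (torus_linear A))"

definition semi_conjugate :: "(torus \<Rightarrow> torus) \<Rightarrow> (torus \<Rightarrow> torus) \<Rightarrow> bool" where
  "semi_conjugate f g \<longleftrightarrow>
     (\<exists>h. continuous_on UNIV h \<and> surj h \<and> torus_homotopic h id \<and> h \<circ> f = g \<circ> h)"

end

theory Submission
  imports Defs
begin

text \<open>
  Let \<open>A\<close> be a linear Anosov map, with a stable eigenvalue \<open>ls\<close> and an unstable eigenvalue \<open>lu\<close>.
  The open set consists of the \<open>C\<^sup>1\<close>-small perturbations of a map \<open>f0\<close> whose lift adds to \<open>A x\<close> a
  small periodic bump along the stable direction. The bump depends on one coordinate \<open>x $ i\<close> only; its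
  slope is so large at the integers that the fixed point \<open>0\<close> also repels along the stable direction,
  while away from the integers it is almost flat. Suppose that \<open>h \<circ> f = g \<circ> h\<close> with \<open>g\<close> Anosov and \<open>h\<close>
  homotopic to the identity. Two facts about \<open>h\<close> contradict each other.

  \<^emph>\<open>\<open>h\<close> collapses an arc.\<close> The points whose unstable coordinate stays bounded under the lift \<open>F\<close> of
  \<open>f\<close> form an invariant graph over the stable axis. The bump makes the dynamics on this graph have
  two bounded regions that attract, one on each side of \<open>0\<close>, with a repelling region between them. Hence
  a short arc between the repelling region and an attracting one has iterates that remain short in
  the future and in the past.
  Their images under \<open>h\<close> are orbits of \<open>g\<close> that stay close for all time, so they coincide because
  Anosov maps are expansive (\<open>anosov_expansive\<close>, \<open>increasing_map_not_expansive\<close>,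
  \<open>semiconjugacy_collapses_arc\<close>).

  \<^emph>\<open>\<open>h\<close> collapses no nontrivial connected set.\<close> Let \<open>D\<close> be a connected subset of the plane whose
  projection \<open>h\<close> maps to a point. The lift of \<open>h\<close> lies at bounded distance from the identity, so the
  diameter of \<open>D\<close> is bounded by a constant. Moreover \<open>F D\<close> and all translates \<open>D + m\<close> by integer
  vectors are collapsed, and so is \<open>F\<^sup>-\<^sup>1 D\<close>, because \<open>g\<close> is locally injective. Here the
  non-invertibility of \<open>A\<close> enters: \<open>A w\<close> is integral for some \<open>w\<close> whose coordinate \<open>w $ i\<close> is not,
  so \<open>F\<^sup>-\<^sup>1 D\<close> and \<open>F\<^sup>-\<^sup>1 (D + A w)\<close> cannot both meet the steep part of the bump if \<open>D\<close> is small;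
  and collapsed sets are small because the bump has small height. One may therefore always pull
  back along a branch near which \<open>F\<close> contracts the stable direction, and push forward to expand the
  unstable one. Collapsed sets of positive size would then give larger and larger ones, against the
  bound on their diameter (\<open>preimage_branch_avoids_bump\<close>, \<open>invariant_pairs_trivial\<close>,
  \<open>no_semiconjugacy\<close>). A diffeomorphism offers no such choice, and there the classical semiconjugacy
  does collapse the arc.

  All this is used of \<open>f\<close> only through a lift of the form \<open>F0 + v\<close>, where \<open>F0\<close> lifts \<open>f0\<close> and \<open>v\<close> is
  periodic, small, and Lipschitz with a small constant. Every map that is \<open>C\<^sup>1\<close>-close to \<open>f0\<close> has
  such a lift (\<open>C1_close_map_lift\<close>), so the argument applies on a whole \<open>C\<^sup>1\<close>-neighbourhood.
\<close>

section \<open>The integer lattice and the projection onto the torus\<close>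

definition int_lattice :: "(real^2) set" where
  "int_lattice = {m. \<forall>i. m $ i \<in> \<int>}"

lemma torus_proj_eq_iff_lattice: "torus_proj x = torus_proj y \<longleftrightarrow> x - y \<in> int_lattice"
  by (simp add: torus_proj_eq_iff int_lattice_def)

lemma lattice_zero [simp]: "0 \<in> int_lattice"
  and lattice_diff: "a \<in> int_lattice \<Longrightarrow> b \<in> int_lattice \<Longrightarrow> a - b \<in> int_lattice"
  by (auto simp: int_lattice_def)

lemma torus_proj_add_lattice: "m \<in> int_lattice \<Longrightarrow> torus_proj (x + m) = torus_proj x"
  by (simp add: torus_proj_eq_iff_lattice)

lemma lattice_norm_less_1:
  assumes "m \<in> int_lattice" "norm m < 1"
  shows "m = 0"
proof -
  have "m $ i = 0" for i
  proof -
    have "\<bar>m $ i\<bar> < 1" using component_le_norm_cart[of m i] assms(2) by linarith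
    moreover have "m $ i \<in> \<int>" using assms by (auto simp: int_lattice_def)
    ultimately show ?thesis by (simp add: Ints_nonzero_abs_less1)
  qed
  then show ?thesis by (simp add: vec_eq_iff)
qed

lemma dist_torus_proj_le: "dist (torus_proj x) (torus_proj y) \<le> dist x y"
  unfolding dist_torus_def by (rule setdist_le_dist) auto

lemma torus_lift_near:
  assumes "dist (torus_proj x) q < r"
  obtains y where "torus_proj y = q" "dist x y < r"
proof -
  have "infdist x (torus_fibre q) < r"
    using assms by (simp add: dist_torus_def torus_setdist_eq_infdist[of x])
  then obtain y where "y \<in> torus_fibre q" "dist x y < r"
    by (metis infdist_def if_not_P torus_fibre_nonempty cINF_less_iff bdd_below_image_dist)
  then show ?thesis using that by auto
qed

lemma continuous_on_torus_proj: "continuous_on S torus_proj"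
  unfolding continuous_on_iff using dist_torus_proj_le by (meson le_less_trans)

lemma torus_proj_inj_near:
  assumes "torus_proj x = torus_proj y" "dist x y < 1"
  shows "x = y"
  using lattice_norm_less_1[of "x - y"] assms by (simp add: torus_proj_eq_iff_lattice dist_norm)

text \<open>
  A strictly closer representative of \<open>torus_proj y\<close> would differ from \<open>y\<close> by an integer vector of
  norm less than 1.
\<close>

lemma torus_proj_isometry_near:
  assumes "dist x y < 1/2"
  shows "dist (torus_proj x) (torus_proj y) = dist x y"
proof (rule antisym[OF dist_torus_proj_le], rule ccontr)
  assume "\<not> dist x y \<le> dist (torus_proj x) (torus_proj y)"
  then obtain z where z: "torus_proj z = torus_proj y" "dist x z < dist x y"
    using torus_lift_near[of x "torus_proj y" "dist x y"] by auto
  have "dist z y < 1" using z(2) assms dist_triangle3[of z y x] by linarith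
  then show False using torus_proj_inj_near[OF z(1)] z(2) by auto
qed

lemma compact_torus: "compact (UNIV :: torus set)"
proof -
  have "p \<in> torus_proj ` cbox 0 1" for p :: torus
  proof -
    obtain x where x: "torus_proj x = p" using torus_proj_surj by blast
    have "torus_proj (\<chi> i. frac (x $ i)) = torus_proj x"
      by (simp add: torus_proj_eq_iff frac_def)
    moreover have "(\<chi> i. frac (x $ i)) \<in> cbox 0 (1::real^2)"
      by (auto simp: cbox_def Basis_vec_def inner_axis frac_lt_1 less_imp_le)
    ultimately show ?thesis using x by (metis imageI)
  qed
  then have "UNIV = torus_proj ` cbox 0 1" by blast
  moreover have "compact (torus_proj ` cbox 0 (1::real^2))"
    by (intro compact_continuous_image continuous_on_torus_proj compact_cbox)
  ultimately show ?thesis by simp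
qed

text \<open>
  The projection is open, so that a map on the torus is continuous as soon as its pull-back to the
  plane is. The parameter \<open>t\<close> makes the criterion applicable to homotopies.
\<close>

lemma continuous_on_torus_descend:
  fixes k :: "'a::metric_space \<times> torus \<Rightarrow> 'b::metric_space"
  assumes "continuous_on (S \<times> UNIV) (\<lambda>(t, x). k (t, torus_proj x))"
  shows "continuous_on (S \<times> UNIV) k"
  unfolding continuous_on_iff
proof clarify
  fix t :: 'a and p :: torus and e :: real
  assume t: "t \<in> S" "p \<in> UNIV" and e: "0 < e"
  obtain x where x: "torus_proj x = p" using torus_proj_surj by blast
  obtain d where d: "d > 0" "\<And>t' x'. t' \<in> S \<Longrightarrow> dist (t', x') (t, x) < d \<Longrightarrow>
      dist (k (t', torus_proj x')) (k (t, torus_proj x)) < e"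
    using assms e t(1) unfolding continuous_on_iff by (fastforce simp: split_beta)
  show "\<exists>d>0. \<forall>x'\<in>S \<times> UNIV. dist x' (t, p) < d \<longrightarrow> dist (k x') (k (t, p)) < e"
  proof (intro exI[of _ "d/2"] conjI ballI impI)
    fix z :: "'a \<times> torus" assume z: "z \<in> S \<times> UNIV" "dist z (t, p) < d/2"
    obtain t' q where zq: "z = (t', q)" by (cases z)
    have "dist t' t < d/2" using dist_fst_le[of z "(t,p)"] z(2) zq by simp
    moreover have "dist q p < d/2" using dist_snd_le[of z "(t,p)"] z(2) zq by simp
    then obtain x' where x': "torus_proj x' = q" "dist x x' < d/2"
      using torus_lift_near[of x q "d/2"] x by (auto simp: dist_commute)
    have "dist (t', x') (t, x) \<le> dist t' t + dist x' x"
      unfolding dist_Pair_Pair by (rule sqrt_sum_squares_le_sum) auto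
    ultimately have "dist (t', x') (t, x) < d" using x'(2) by (simp add: dist_commute)
    then show "dist (k z) (k (t, p)) < e" using d(2)[of t' x'] x' x zq z(1) by auto
  qed (use d in auto)
qed

lemma continuous_on_torus_descend_single:
  fixes f :: "torus \<Rightarrow> 'b::metric_space"
  assumes "continuous_on UNIV (\<lambda>x. f (torus_proj x))"
  shows "continuous_on UNIV f"
proof -
  have "continuous_on (UNIV \<times> UNIV) (\<lambda>(t::real, x). (\<lambda>(t::real, p). f p) (t, torus_proj x))"
    using continuous_on_compose2[OF assms continuous_on_snd[OF continuous_on_id]]
    by (simp add: split_beta)
  from continuous_on_torus_descend[OF this]
  have "continuous_on (UNIV \<times> UNIV) (\<lambda>(t::real, p). f p)" .
  from continuous_on_compose2[OF this, of UNIV "\<lambda>p. (0, p)"]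
  show ?thesis by (simp add: continuous_on_Pair)
qed

text \<open>
  This is how lifts are compared: two lifts of the same map differ by a lattice-valued map, and the
  lattice is discrete.
\<close>

lemma lattice_valued_constant:
  fixes f :: "'a::topological_space \<Rightarrow> real^2"
  assumes S: "connected S" and c: "continuous_on S f" and i: "\<And>x. x \<in> S \<Longrightarrow> f x \<in> int_lattice"
    and xy: "x \<in> S" "y \<in> S"
  shows "f x = f y"
proof -
  have "f x $ k = f y $ k" for k
  proof -
    have "(\<lambda>x. f x $ k) constant_on S"
    proof (rule continuous_discrete_range_constant[OF S])
      show "continuous_on S (\<lambda>x. f x $ k)" using c by (intro continuous_intros)
      show "\<exists>e>0. \<forall>y. y \<in> S \<and> f y $ k \<noteq> f x $ k \<longrightarrow> e \<le> norm (f y $ k - f x $ k)"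
        if "x \<in> S" for x
      proof (intro exI[of _ 1] conjI allI impI)
        fix y assume y: "y \<in> S \<and> f y $ k \<noteq> f x $ k"
        then have "f y $ k - f x $ k \<in> \<int>" using i that by (auto simp: int_lattice_def)
        then show "1 \<le> norm (f y $ k - f x $ k)" using y Ints_nonzero_abs_ge1 by force
      qed simp
    qed
    then show ?thesis using xy unfolding constant_on_def by metis
  qed
  then show ?thesis by (simp add: vec_eq_iff)
qed

lemma torus_proj_homeomorphism_ball:
  "\<exists>s. homeomorphism (ball y (1/4)) (ball (torus_proj y) (1/4)) torus_proj s"
proof -
  have i: "dist (torus_proj a) (torus_proj b) = dist a b" if "a \<in> ball y (1/4)" "b \<in> ball y (1/4)" for a b
    using that dist_triangle3[of a b y] by (intro torus_proj_isometry_near) auto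
  have inj: "inj_on torus_proj (ball y (1/4))"
    by (rule inj_onI) (use i in fastforce)
  have img: "torus_proj ` ball y (1/4) = ball (torus_proj y) (1/4)"
  proof (intro equalityI subsetI)
    fix q assume "q \<in> ball (torus_proj y) (1/4)"
    then have "dist (torus_proj y) q < 1/4" by simp
    then obtain z where "torus_proj z = q" "dist y z < 1/4" by (rule torus_lift_near)
    then show "q \<in> torus_proj ` ball y (1/4)" by force
  next
    fix q assume "q \<in> torus_proj ` ball y (1/4)"
    then obtain z where "q = torus_proj z" "dist y z < 1/4" by auto
    then show "q \<in> ball (torus_proj y) (1/4)" using dist_torus_proj_le[of y z] by simp
  qed
  have "continuous_on (torus_proj ` ball y (1/4)) (inv_into (ball y (1/4)) torus_proj)"
    unfolding continuous_on_iff
  proof clarify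
    fix a and e :: real assume a: "a \<in> ball y (1/4)" and e: "e > 0"
    show "\<exists>d>0. \<forall>x'\<in>torus_proj ` ball y (1/4). dist x' (torus_proj a) < d \<longrightarrow>
       dist (inv_into (ball y (1/4)) torus_proj x') (inv_into (ball y (1/4)) torus_proj (torus_proj a)) < e"
      using a e i by (intro exI[of _ e]) (auto simp: inv_into_f_f[OF inj] simp del: mem_ball)
  qed
  then have "homeomorphism (ball y (1/4)) (torus_proj ` ball y (1/4)) torus_proj
      (inv_into (ball y (1/4)) torus_proj)"
    by (intro homeomorphismI continuous_on_torus_proj)
      (auto simp: inv_into_f_f[OF inj] f_inv_into_f simp del: mem_ball)
  then show ?thesis unfolding img by blast
qed

section \<open>Lifting maps and homotopies to the plane\<close>

text \<open>
  The torus as a product of two unit circles inside a normed space, which makes the plane a covering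
  space of a subset of \<open>complex \<times> complex\<close>.
\<close>

definition torus_embed :: "torus \<Rightarrow> complex \<times> complex" where
  "torus_embed p = (cis (2 * pi * rep_torus p $ 1), cis (2 * pi * rep_torus p $ 2))"

lemma torus_proj_rep: "torus_proj (rep_torus p) = p"
  by (metis Quotient3_abs_rep Quotient3_torus)

lemma cis_2pi_eq_iff: "cis (2 * pi * s) = cis (2 * pi * t) \<longleftrightarrow> s - t \<in> \<int>"
proof -
  have "cis (2 * pi * s) = cis (2 * pi * t) \<longleftrightarrow>
      sin (2 * pi * s) = sin (2 * pi * t) \<and> cos (2 * pi * s) = cos (2 * pi * t)"
    by (auto simp: complex_eq_iff)
  also have "\<dots> \<longleftrightarrow> (\<exists>n::int. 2 * pi * s = 2 * pi * t + 2 * pi * n)"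
    by (rule sin_cos_eq_iff)
  also have "\<dots> \<longleftrightarrow> (\<exists>n::int. s = t + n)"
  proof -
    have "(2 * pi * s = 2 * pi * t + 2 * pi * n) \<longleftrightarrow> (2 * pi) * s = (2 * pi) * (t + n)" for n :: int
      by (simp add: algebra_simps)
    then show ?thesis by simp
  qed
  also have "\<dots> \<longleftrightarrow> s - t \<in> \<int>" unfolding Ints_def by (auto simp: algebra_simps)
  finally show ?thesis .
qed

lemma torus_embed_proj: "torus_embed (torus_proj x) = (cis (2 * pi * x $ 1), cis (2 * pi * x $ 2))"
proof -
  have "\<forall>i. rep_torus (torus_proj x) $ i - x $ i \<in> \<int>"
    using torus_proj_rep[of "torus_proj x"] torus_proj_eq_iff by blast
  then show ?thesis by (simp add: torus_embed_def cis_2pi_eq_iff)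
qed

lemma torus_embed_homeomorphism: "\<exists>r. homeomorphism UNIV (range torus_embed) torus_embed r"
proof (rule homeomorphism_compact[OF compact_torus])
  show "continuous_on UNIV torus_embed"
    by (rule continuous_on_torus_descend_single)
      (auto simp: torus_embed_proj cis_conv_exp intro!: continuous_intros)
  show "inj torus_embed"
  proof (rule injI)
    fix p q assume pq: "torus_embed p = torus_embed q"
    obtain x y where "torus_proj x = p" "torus_proj y = q" using torus_proj_surj by meson
    then show "p = q" using pq
      by (auto simp: torus_embed_proj cis_2pi_eq_iff torus_proj_eq_iff forall_2)
  qed
qed auto

text \<open>
  Discs of radius \<open>1/4\<close> are evenly covered: the discs of that radius around the points of a fibre are
  pairwise disjoint, and the projection is isometric on each.
\<close>

lemma covering_space_torus_embed:
  "covering_space UNIV (\<lambda>x. torus_embed (torus_proj x)) (range torus_embed)"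
proof -
  obtain r where r: "homeomorphism UNIV (range torus_embed) torus_embed r"
    using torus_embed_homeomorphism by blast
  have ce: "continuous_on UNIV torus_embed" using r by (simp add: homeomorphism_def)
  have rinv: "r (torus_embed p) = p" for p using r by (simp add: homeomorphism_def)
  show ?thesis
  proof
    show "continuous_on UNIV (\<lambda>x. torus_embed (torus_proj x))"
      by (rule continuous_on_compose2[OF ce continuous_on_torus_proj]) auto
    show "range (\<lambda>x. torus_embed (torus_proj x)) = range torus_embed"
    proof -
      have "range torus_proj = UNIV" using torus_proj_surj by (metis surjI)
      then show ?thesis by (metis image_image)
    qed
    fix z assume "z \<in> range torus_embed"
    then obtain p where p: "z = torus_embed p" by auto
    let ?T = "torus_embed ` ball p (1/4)"
    let ?v = "(\<lambda>y. ball y (1/4)) ` torus_fibre p"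
    have pre: "torus_embed (torus_proj x) \<in> ?T \<longleftrightarrow> torus_proj x \<in> ball p (1/4)" for x
      using rinv by (metis image_iff)
    show "\<exists>T. z \<in> T \<and> openin (top_of_set (range torus_embed)) T \<and>
       (\<exists>v. \<Union>v = UNIV \<inter> (\<lambda>x. torus_embed (torus_proj x)) -` T \<and>
       (\<forall>u\<in>v. openin (top_of_set UNIV) u) \<and> pairwise disjnt v \<and>
       (\<forall>u\<in>v. \<exists>q. homeomorphism u T (\<lambda>x. torus_embed (torus_proj x)) q))"
    proof (intro exI[of _ ?T] exI[of _ ?v] conjI)
      show "z \<in> ?T" using p by auto
      show "openin (top_of_set (range torus_embed)) ?T"
        by (rule homeomorphism_imp_open_map[OF r]) auto
      show "\<Union>?v = UNIV \<inter> (\<lambda>x. torus_embed (torus_proj x)) -` ?T"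
      proof -
        have "x \<in> \<Union>?v \<longleftrightarrow> torus_proj x \<in> ball p (1/4)" for x
        proof
          assume "x \<in> \<Union>?v"
          then obtain y where "torus_proj y = p" "dist y x < 1/4" by auto
          then show "torus_proj x \<in> ball p (1/4)" using dist_torus_proj_le[of y x] by auto
        next
          assume "torus_proj x \<in> ball p (1/4)"
          then obtain y where "torus_proj y = p" "dist x y < 1/4"
            using torus_lift_near[of x p "1/4"] by (auto simp: dist_commute)
          then show "x \<in> \<Union>?v" by (auto simp: dist_commute)
        qed
        then show ?thesis using pre by blast
      qed
      show "\<forall>u\<in>?v. openin (top_of_set UNIV) u" by auto
      show "pairwise disjnt ?v"
      proof (rule pairwiseI, rule ccontr, clarify)
        fix a b assume ab: "p = torus_proj a" "torus_proj b = torus_proj a"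
          "ball a (1/4) \<noteq> ball b (1/4)" "\<not> disjnt (ball a (1/4)) (ball b (1/4))"
        then obtain x where "dist a x < 1/4" "dist b x < 1/4" by (auto simp: disjnt_def)
        then have "dist b a < 1" using dist_triangle2[of b a x] by linarith
        then show False using torus_proj_inj_near[OF ab(2)] ab(3) by simp
      qed
      show "\<forall>u\<in>?v. \<exists>q. homeomorphism u ?T (\<lambda>x. torus_embed (torus_proj x)) q"
      proof clarify
        fix y assume y: "p = torus_proj y"
        obtain s where s: "homeomorphism (ball y (1/4)) (ball p (1/4)) torus_proj s"
          using torus_proj_homeomorphism_ball y by blast
        have "homeomorphism (ball p (1/4)) ?T torus_embed r"
          using homeomorphism_of_subsets[OF r] by auto
        from homeomorphism_compose[OF s this]
        show "\<exists>q. homeomorphism (ball y (1/4)) (torus_embed ` ball (torus_proj y) (1/4))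
              (\<lambda>x. torus_embed (torus_proj x)) q"
          using y by (auto simp: o_def)
      qed
    qed
  qed
qed

lemma torus_lift_exists:
  fixes f :: "'a::real_normed_vector \<Rightarrow> torus"
  assumes "continuous_on UNIV f"
  obtains F :: "'a \<Rightarrow> real^2" where "continuous_on UNIV F" "\<And>x. torus_proj (F x) = f x"
proof -
  obtain r where r: "homeomorphism UNIV (range torus_embed) torus_embed r"
    using torus_embed_homeomorphism by blast
  then have ce: "continuous_on UNIV torus_embed" by (simp add: homeomorphism_def)
  have sc: "simply_connected (UNIV::'a set)"
    by (simp add: convex_imp_simply_connected)
  have lp: "locally path_connected (UNIV::'a set)"
    by (simp add: convex_imp_locally_path_connected)
  have "continuous_on UNIV (\<lambda>x. torus_embed (f x))"
    by (rule continuous_on_compose2[OF ce assms]) auto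
  moreover have "(\<lambda>x. torus_embed (f x)) \<in> UNIV \<rightarrow> range torus_embed" by simp
  ultimately obtain F where F: "continuous_on UNIV F"
      "\<And>x. torus_embed (torus_proj (F x)) = torus_embed (f x)"
    by (rule covering_space_lift[OF covering_space_torus_embed sc lp]) simp
  have "torus_proj (F x) = f x" for x
    using arg_cong[OF F(2)[of x], of r] r by (simp add: homeomorphism_apply1[OF r])
  then show thesis using that F(1) by blast
qed

text \<open>
  The lift starts at the identity, which commutes with integer translations; the defect of
  commutation is lattice-valued, hence constant along the homotopy.
\<close>

lemma torus_homotopy_lift:
  assumes "torus_homotopic id h"
  obtains H :: "real^2 \<Rightarrow> real^2" where "continuous_on UNIV H" "\<And>x. torus_proj (H x) = h (torus_proj x)"
    "\<And>x m. m \<in> int_lattice \<Longrightarrow> H (x + m) = H x + m"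
proof -
  obtain r where r: "homeomorphism UNIV (range torus_embed) torus_embed r"
    using torus_embed_homeomorphism by blast
  then have ce: "continuous_on UNIV torus_embed" by (simp add: homeomorphism_def)
  obtain k where k: "continuous_on ({0..1::real} \<times> UNIV) k" "\<And>p. k (0, p) = p" "\<And>p. k (1, p) = h p"
    using assms unfolding homotopic_with_def
    by (auto simp: prod_topology_subtopology euclidean_product_topology)
  let ?h = "\<lambda>(t, x). torus_embed (k (t, torus_proj x))"
  have "continuous_on ({0..1::real} \<times> UNIV) ?h"
    unfolding split_beta
    by (rule continuous_on_compose2[OF ce], rule continuous_on_compose2[OF k(1)])
      (auto intro!: continuous_intros continuous_on_compose2[OF continuous_on_torus_proj])
  moreover have "?h \<in> {0..1::real} \<times> UNIV \<rightarrow> range torus_embed" by auto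
  moreover have "?h (0, y) = torus_embed (torus_proj (id y))" for y by (simp add: k(2))
  ultimately obtain K where K: "continuous_on ({0..1::real} \<times> UNIV) K" "\<And>y. K (0, y) = id y"
     "\<And>z. z \<in> {0..1} \<times> UNIV \<Longrightarrow> ?h z = torus_embed (torus_proj (K z))"
    by (rule covering_space_lift_homotopy[OF covering_space_torus_embed]) auto
  have Kp: "torus_proj (K (t, x)) = k (t, torus_proj x)" if "t \<in> {0..1}" for t x
    using arg_cong[OF K(3)[of "(t, x)"], of r] that by (simp add: homeomorphism_apply1[OF r])
  show thesis
  proof (rule that[of "\<lambda>x. K (1, x)"])
    show "continuous_on UNIV (\<lambda>x. K (1, x))"
      by (rule continuous_on_compose2[OF K(1)])
        (auto intro!: continuous_on_Pair continuous_on_id continuous_on_const)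
    show "torus_proj (K (1, x)) = h (torus_proj x)" for x using Kp[of 1 x] k(3) by simp
    fix x m :: "real^2" assume m: "m \<in> int_lattice"
    have "K (1, x + m) - K (1, x) - m = K (0, x + m) - K (0, x) - m"
    proof (rule lattice_valued_constant[of "{0..1::real}" "\<lambda>t. K (t, x + m) - K (t, x) - m"])
      show "continuous_on {0..1} (\<lambda>t. K (t, x + m) - K (t, x) - m)"
        by (intro continuous_on_diff continuous_on_const continuous_on_compose2[OF K(1)])
          (auto intro!: continuous_on_Pair continuous_on_id continuous_on_const)
      show "K (t, x + m) - K (t, x) - m \<in> int_lattice" if "t \<in> {0..1}" for t
      proof -
        have "torus_proj (K (t, x + m)) = torus_proj (K (t, x))"
          using Kp[OF that] torus_proj_add_lattice[OF m] by simp
        then show ?thesis using lattice_diff m torus_proj_eq_iff_lattice by blast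
      qed
    qed auto
    then show "K (1, x + m) = K (1, x) + m" using K(2) by (simp add: algebra_simps)
  qed
qed

lemma lattice_round: "\<exists>m\<in>int_lattice. x - m \<in> cbox 0 (1::real^2)"
proof (intro bexI)
  show "x - (\<chi> i. of_int \<lfloor>x $ i\<rfloor>) \<in> cbox 0 1"
  proof -
    have "0 \<le> x $ i - of_int \<lfloor>x $ i\<rfloor> \<and> x $ i - of_int \<lfloor>x $ i\<rfloor> \<le> 1" for i by linarith
    then show ?thesis by (simp add: mem_box_cart)
  qed
  show "(\<chi> i. of_int \<lfloor>x $ i\<rfloor>) \<in> int_lattice" by (simp add: int_lattice_def)
qed

lemma periodic_bounded:
  fixes v :: "real^2 \<Rightarrow> 'b::real_normed_vector"
  assumes "continuous_on UNIV v" "\<And>x m. m \<in> int_lattice \<Longrightarrow> v (x + m) = v x"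
  obtains B where "\<And>x. norm (v x) \<le> B"
proof -
  have "compact (v ` cbox 0 1)"
    using compact_continuous_image[OF continuous_on_subset[OF assms(1) subset_UNIV] compact_cbox] .
  then have "bounded (v ` cbox 0 1)" by (rule compact_imp_bounded)
  then obtain B where B: "\<forall>y\<in>v ` cbox 0 1. norm y \<le> B" unfolding bounded_iff ..
  have "norm (v x) \<le> B" for x
  proof -
    obtain m where m: "m \<in> int_lattice" "x - m \<in> cbox 0 1" using lattice_round by blast
    then have "v x = v (x - m)" using assms(2)[of m "x - m"] by simp
    then show ?thesis using m(2) B by simp
  qed
  then show ?thesis using that by blast
qed

section \<open>Differentials and local diffeomorphisms\<close>

lemma lattice_valued_eventually_constant:
  assumes "isCont H x" "\<forall>\<^sub>F y in nhds x. H y \<in> int_lattice"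
  shows "\<forall>\<^sub>F y in nhds x. H y = H x"
proof -
  have Hx: "H x \<in> int_lattice" using eventually_nhds_x_imp_x[OF assms(2)] .
  have "(H \<longlongrightarrow> H x) (nhds x)"
    using assms(1) by (simp add: continuous_within tendsto_at_iff_tendsto_nhds)
  then have "\<forall>\<^sub>F y in nhds x. dist (H y) (H x) < 1"
    by (rule tendstoD) simp
  with assms(2) show ?thesis
    by eventually_elim
      (use lattice_norm_less_1 lattice_diff Hx in \<open>fastforce simp: dist_norm\<close>)
qed

text \<open>
  The differential of a torus map is witnessed by some local lift near some point of the fibre. Any
  other continuous lift agrees with it locally up to integer translations in source and target.
\<close>

lemma lift_has_derivative:
  assumes F: "\<And>y. torus_proj (F y) = f (torus_proj y)" "isCont F x"
    and D: "torus_has_derivative f D (torus_proj x)"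
  shows "(F has_derivative blinfun_apply D) (at x)"
proof -
  obtain x' G where G: "torus_proj x' = torus_proj x"
      "\<forall>\<^sub>F y in nhds x'. torus_proj (G y) = f (torus_proj y)"
      "(G has_derivative blinfun_apply D) (at x')"
    using D unfolding torus_has_derivative_def by blast
  define t where "t = x' - x"
  have tl: "t \<in> int_lattice" using G(1) by (simp add: t_def torus_proj_eq_iff_lattice)
  have G': "((\<lambda>y. G (y + t)) has_derivative blinfun_apply D) (at x)"
  proof -
    have "((\<lambda>y. y + t) has_derivative (\<lambda>v. v)) (at x)"
      by (auto intro!: derivative_eq_intros)
    moreover have "(G has_derivative blinfun_apply D) (at (x + t))"
      using G(3) by (simp add: t_def)
    ultimately show ?thesis by (rule has_derivative_compose)
  qed
  have "filterlim (\<lambda>y. y + t) (nhds x') (nhds x)"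
    using tendsto_add[OF filterlim_ident[of "nhds x"] tendsto_const[of t]]
    by (simp add: t_def)
  then have "\<forall>\<^sub>F y in nhds x. torus_proj (G (y + t)) = f (torus_proj (y + t))"
    using G(2) unfolding filterlim_iff by (elim allE impE)
  then have "\<forall>\<^sub>F y in nhds x. F y - G (y + t) \<in> int_lattice"
    by eventually_elim (simp add: F(1) torus_proj_add_lattice[OF tl] flip: torus_proj_eq_iff_lattice)
  moreover have "isCont (\<lambda>y. F y - G (y + t)) x"
    using F(2) has_derivative_continuous[OF G'] by (intro continuous_intros) auto
  ultimately have ev: "\<forall>\<^sub>F y in nhds x. F y - G (y + t) = F x - G (x + t)"
    by (intro lattice_valued_eventually_constant)
  have "((\<lambda>y. G (y + t) + (F x - G (x + t))) has_derivative blinfun_apply D) (at x)"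
    using has_derivative_add[OF G' has_derivative_const[of "F x - G (x + t)"]] by simp
  then show ?thesis
    by (rule has_derivative_transform_eventually)
      (use ev in \<open>auto simp: eventually_at_filter algebra_simps elim: eventually_mono\<close>)
qed

lemma torus_has_derivativeI:
  assumes "\<And>y. torus_proj (F y) = f (torus_proj y)" "(F has_derivative blinfun_apply D) (at x)"
  shows "torus_has_derivative f D (torus_proj x)"
  unfolding torus_has_derivative_def using assms by (intro exI[of _ x] exI[of _ F] conjI) simp_all

lemma torus_deriv_eqI: "torus_has_derivative f D p \<Longrightarrow> torus_deriv f p = D"
  unfolding torus_deriv_def by (rule the_equality) (auto intro: torus_has_derivative_unique)

lemma local_diffeo_has_derivative:
  assumes "torus_local_diffeo f"
  shows "torus_has_derivative f (torus_deriv f p) p"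
proof -
  obtain U where "p \<in> U" "torus_C1_on U f"
    using assms unfolding torus_local_diffeo_def by blast
  then obtain D where D: "torus_has_derivative f D p"
    unfolding torus_C1_on_def by blast
  then show ?thesis by (simp only: torus_deriv_eqI[OF D])
qed

lemma local_diffeo_continuous_deriv:
  assumes "torus_local_diffeo f"
  shows "continuous_on UNIV (torus_deriv f)"
proof -
  have "isCont (torus_deriv f) p" for p
  proof -
    obtain U where "open U" "p \<in> U" "torus_C1_on U f"
      using assms unfolding torus_local_diffeo_def by blast
    then show ?thesis unfolding torus_C1_on_def by (simp add: continuous_on_eq_continuous_at)
  qed
  then show ?thesis by (simp add: continuous_at_imp_continuous_on)
qed

lemma local_diffeo_locally_inj:
  assumes "torus_local_diffeo f"
  obtains U where "open U" "p \<in> U" "inj_on f U"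
  using assms unfolding torus_local_diffeo_def by blast

lemma torus_differentiable_continuous:
  assumes "torus_has_derivative f D p"
  shows "isCont f p"
  unfolding continuous_at_eps_delta
proof clarify
  fix e :: real assume e: "0 < e"
  obtain x F where F: "torus_proj x = p" "\<forall>\<^sub>F y in nhds x. torus_proj (F y) = f (torus_proj y)"
      "(F has_derivative blinfun_apply D) (at x)"
    using assms unfolding torus_has_derivative_def by blast
  have "(F \<longlongrightarrow> F x) (nhds x)"
    using has_derivative_continuous[OF F(3)]
    by (simp add: continuous_within tendsto_at_iff_tendsto_nhds)
  then have "\<forall>\<^sub>F y in nhds x. dist (F y) (F x) < e"
    using e by (rule tendstoD)
  with F(2) have "\<forall>\<^sub>F y in nhds x. dist (f (torus_proj y)) (f p) < e"
  proof eventually_elim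
    case (elim y)
    then show ?case
      using eventually_nhds_x_imp_x[OF F(2)] F(1) dist_torus_proj_le[of "F y" "F x"] by simp
  qed
  then obtain d where d: "d > 0" "\<And>y. dist y x < d \<Longrightarrow> dist (f (torus_proj y)) (f p) < e"
    unfolding eventually_nhds_metric by blast
  show "\<exists>d>0. \<forall>q. dist q p < d \<longrightarrow> dist (f q) (f p) < e"
  proof (intro exI[of _ d] conjI allI impI d(1))
    fix q assume "dist q p < d"
    then obtain y where "torus_proj y = q" "dist x y < d"
      using torus_lift_near[of x q d] F(1) by (auto simp: dist_commute)
    then show "dist (f q) (f p) < e" using d(2) by (auto simp: dist_commute)
  qed
qed

lemma local_diffeo_continuous:
  assumes "torus_local_diffeo f"
  shows "continuous_on UNIV f"
  by (intro continuous_at_imp_continuous_on ballI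
      torus_differentiable_continuous[OF local_diffeo_has_derivative[OF assms]])

lemma local_diffeo_lift:
  assumes "torus_local_diffeo g"
  obtains G where "\<And>x. torus_proj (G x) = g (torus_proj x)" "continuous_on UNIV G"
    "\<And>x. (G has_derivative blinfun_apply (torus_deriv g (torus_proj x))) (at x)"
proof -
  have "continuous_on UNIV (\<lambda>x. g (torus_proj x))"
    by (rule continuous_on_compose2[OF local_diffeo_continuous[OF assms] continuous_on_torus_proj]) auto
  then obtain G where G: "continuous_on UNIV G" "\<And>x. torus_proj (G x) = g (torus_proj x)"
    by (rule torus_lift_exists) (rule that)
  have "(G has_derivative blinfun_apply (torus_deriv g (torus_proj x))) (at x)" for x
  proof (rule lift_has_derivative[where f = g and F = G])
    show "torus_proj (G y) = g (torus_proj y)" for y by (rule G(2))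
    show "isCont G x" using G(1) by (simp add: continuous_on_eq_continuous_at)
    show "torus_has_derivative g (torus_deriv g (torus_proj x)) (torus_proj x)"
      by (rule local_diffeo_has_derivative[OF assms])
  qed
  then show thesis by (rule that[OF G(2,1)])
qed

lemma funpow_lift:
  assumes "\<And>x. torus_proj (G x) = g (torus_proj x)"
  shows "torus_proj ((G ^^ n) x) = (g ^^ n) (torus_proj x)"
proof (induction n)
  case (Suc n)
  then show ?case using assms[of "(G ^^ n) x"] by simp
qed simp

lemma funpow_lift_derivative:
  assumes g: "torus_local_diffeo g" and G: "\<And>x. torus_proj (G x) = g (torus_proj x)"
    "\<And>x. (G has_derivative blinfun_apply (torus_deriv g (torus_proj x))) (at x)"
  shows "(\<forall>x. ((G ^^ n) has_derivative blinfun_apply (torus_deriv (g ^^ n) (torus_proj x))) (at x)) \<and>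
    continuous_on UNIV (torus_deriv (g ^^ n))"
proof (induction n)
  case 0
  have "torus_has_derivative (g ^^ 0) id_blinfun (torus_proj x)" for x
    by (rule torus_has_derivativeI[of id]) (auto simp: id_def)
  then have "torus_deriv (g ^^ 0) p = id_blinfun" for p
    using torus_deriv_eqI torus_proj_surj by metis
  then have "torus_deriv (g ^^ 0) = (\<lambda>p. id_blinfun)" by blast
  then show ?case by (simp add: id_def)
next
  case (Suc n)
  let ?D = "\<lambda>p. torus_deriv g ((g ^^ n) p) o\<^sub>L torus_deriv (g ^^ n) p"
  have d: "((G ^^ Suc n) has_derivative blinfun_apply (?D (torus_proj x))) (at x)" for x
    using has_derivative_compose[of "G ^^ n" _ x UNIV G] Suc G(2)[of "(G ^^ n) x"]
    by (auto simp: funpow_lift[of G g, OF G(1)] blinfun_compose.rep_eq o_def)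
  have "torus_has_derivative (g ^^ Suc n) (?D (torus_proj x)) (torus_proj x)" for x
    by (rule torus_has_derivativeI[OF funpow_lift[of G g, OF G(1)] d])
  then have eq: "torus_deriv (g ^^ Suc n) p = ?D p" for p
    using torus_deriv_eqI torus_proj_surj by metis
  have cg: "continuous_on UNIV (g ^^ n)" for n
  proof (induction n)
    case (Suc n)
    show ?case
      using continuous_on_compose2[OF local_diffeo_continuous[OF g] Suc.IH] by (simp add: o_def)
  qed (simp add: id_def)
  have "continuous_on UNIV ?D"
    using Suc continuous_on_compose2[OF local_diffeo_continuous_deriv[OF g] cg]
    by (intro continuous_intros) auto
  then show ?case using d eq by (metis (no_types, lifting) continuous_on_cong)
qed

lemma open_torus_proj_image:
  assumes "open S"
  shows "open (torus_proj ` S)"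
proof -
  have "torus_proj -` (torus_proj ` S) = (\<Union>m\<in>int_lattice. (\<lambda>x. x + m) ` S)"
  proof (intro equalityI subsetI)
    fix x assume "x \<in> torus_proj -` (torus_proj ` S)"
    then obtain y where "y \<in> S" "torus_proj x = torus_proj y" by auto
    then show "x \<in> (\<Union>m\<in>int_lattice. (\<lambda>x. x + m) ` S)"
      by (auto simp: torus_proj_eq_iff_lattice intro!: bexI[of _ "x - y"] image_eqI[of _ _ y])
  qed (auto simp: torus_proj_add_lattice)
  moreover have "open ((\<lambda>x. x + m) ` S)" for m
    using open_translation[OF assms, of m] by (simp add: add.commute)
  ultimately show ?thesis unfolding open_torus_iff_quotient by auto
qed

text \<open>
  Continuity follows from the resolvent identity \<open>E x - E y = E x (D y - D x) E y\<close>. The factor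
  \<open>norm (E x)\<close> is absorbed by \<open>2 * norm (E y)\<close> once \<open>D y - D x\<close> is small.
\<close>

lemma continuous_on_blinfun_left_inverse:
  fixes D E :: "'a::metric_space \<Rightarrow> ('b::real_normed_vector \<Rightarrow>\<^sub>L 'b)"
  assumes D: "continuous_on UNIV D"
    and E: "\<And>x. E x o\<^sub>L D x = id_blinfun" "\<And>x. D x o\<^sub>L E x = id_blinfun"
  shows "continuous_on UNIV E"
proof -
  have diff: "E x - E y = E x o\<^sub>L (D y - D x) o\<^sub>L E y" for x y
  proof (rule blinfun_eqI)
    fix v
    have "E x (D x w) = w" "D y (E y w) = w" for w
      using E by (metis blinfun_apply_blinfun_compose blinfun_apply_id_blinfun id_apply)+
    then show "blinfun_apply (E x - E y) v = blinfun_apply (E x o\<^sub>L (D y - D x) o\<^sub>L E y) v"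
      by (simp add: blinfun.diff_left blinfun.diff_right)
  qed
  have nb: "norm (E x - E y) \<le> norm (E x) * norm (D y - D x) * norm (E y)" for x y
    unfolding diff by (intro order_trans[OF norm_blinfun_compose] mult_right_mono norm_blinfun_compose) auto
  show ?thesis
    unfolding continuous_on_eq_continuous_at[OF open_UNIV]
  proof
    fix y
    have Dt: "((\<lambda>x. norm (D y - D x)) \<longlongrightarrow> 0) (at y)"
    proof -
      have "(D \<longlongrightarrow> D y) (at y)" using D by (simp add: continuous_on_def)
      then have "((\<lambda>x. norm (D y - D x)) \<longlongrightarrow> norm (D y - D y)) (at y)"
        by (intro tendsto_norm tendsto_diff tendsto_const)
      then show ?thesis by simp
    qed
    have "((\<lambda>x. norm (D y - D x) * norm (E y)) \<longlongrightarrow> 0 * norm (E y)) (at y)"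
      by (intro tendsto_intros Dt)
    then have ev: "\<forall>\<^sub>F x in at y. norm (D y - D x) * norm (E y) < 1/2"
      by (rule order_tendstoD) simp
    have "\<forall>\<^sub>F x in at y. norm (E x - E y) \<le> (2 * norm (E y) * norm (E y)) * norm (D y - D x)"
      using ev
    proof eventually_elim
      case (elim x)
      have "norm (E x) \<le> norm (E x - E y) + norm (E y)"
        using norm_triangle_sub[of "E x" "E y"] by (simp add: add.commute)
      also have "norm (E x - E y) \<le> norm (E x) * (norm (D y - D x) * norm (E y))"
        using nb[of x y] by (simp add: mult_ac)
      also have "\<dots> \<le> norm (E x) * (1/2)"
        using elim by (intro mult_left_mono) auto
      finally have "norm (E x) \<le> 2 * norm (E y)" by simp
      then have "norm (E x) * (norm (D y - D x) * norm (E y)) \<le> 2 * norm (E y) * (norm (D y - D x) * norm (E y))"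
        by (intro mult_right_mono) auto
      then show ?case using nb[of x y] by (simp add: mult_ac)
    qed
    then have "((\<lambda>x. norm (E x - E y)) \<longlongrightarrow> 0) (at y)"
    proof (rule tendsto_sandwich[OF always_eventually[OF allI[OF norm_ge_zero]] _ tendsto_const])
      have "((\<lambda>x. (2 * norm (E y) * norm (E y)) * norm (D y - D x)) \<longlongrightarrow> (2 * norm (E y) * norm (E y)) * 0) (at y)"
        by (intro tendsto_mult tendsto_const Dt)
      then show "((\<lambda>x. (2 * norm (E y) * norm (E y)) * norm (D y - D x)) \<longlongrightarrow> 0) (at y)" by simp
    qed
    then show "isCont E y"
      unfolding isCont_def by (rule LIM_zero_cancel[OF tendsto_norm_zero_cancel])
  qed
qed

text \<open>
  The inverse function theorem inverts the lift \<open>F\<close> near \<open>x\<close>. On a ball so small that neither it nor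
  its image meets two points of the same fibre, the local inverse descends to the torus.
\<close>

lemma torus_local_diffeoI:
  assumes F: "\<And>x. torus_proj (F x) = f (torus_proj x)"
    and dF: "\<And>x. (F has_derivative blinfun_apply (D x)) (at x)"
    and D: "continuous_on UNIV D"
    and E: "\<And>x. E x o\<^sub>L D x = id_blinfun" "\<And>x. D x o\<^sub>L E x = id_blinfun"
  shows "torus_local_diffeo f"
  unfolding torus_local_diffeo_def
proof
  fix p
  have Ec: "continuous_on UNIV E" by (rule continuous_on_blinfun_left_inverse[OF D E])
  have invD: "inv (blinfun_apply (D x)) = blinfun_apply (E x)" for x
  proof (rule inv_unique_comp)
    show "blinfun_apply (D x) \<circ> blinfun_apply (E x) = id" "blinfun_apply (E x) \<circ> blinfun_apply (D x) = id"
      by (simp_all only: E flip: blinfun_compose.rep_eq) (simp_all add: id_def)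
  qed
  have tD: "torus_has_derivative f (D x) (torus_proj x)" for x
    by (rule torus_has_derivativeI[OF F dF])
  have Dc: "continuous_on UNIV (torus_deriv f)"
    by (rule continuous_on_torus_descend_single) (simp add: torus_deriv_eqI[OF tD] D)
  have Fc: "continuous_on UNIV F"
    by (intro continuous_at_imp_continuous_on ballI has_derivative_continuous[OF dF])
  obtain x where x: "torus_proj x = p" using torus_proj_surj by blast
  obtain U' V g g' where U': "open U'" "U' \<subseteq> UNIV" "x \<in> U'" "open V" "F x \<in> V" "homeomorphism U' V F g"
    and g': "\<And>y. y \<in> V \<Longrightarrow> (g has_derivative (g' y)) (at y)"
      "\<And>y. y \<in> V \<Longrightarrow> g' y = inv (blinfun_apply (D (g y)))"
      "\<And>y. y \<in> V \<Longrightarrow> bij (blinfun_apply (D (g y)))"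
    by (rule inverse_function_theorem[OF open_UNIV dF D UNIV_I E(1)]) (rule that)
  have "open (U' \<inter> F -` ball (F x) (1/4))" by (intro open_Int U'(1) open_vimage[OF open_ball Fc])
  moreover have "x \<in> U' \<inter> F -` ball (F x) (1/4)" using U'(3) by simp
  ultimately obtain r0 where r0: "r0 > 0" "ball x r0 \<subseteq> U' \<inter> F -` ball (F x) (1/4)"
    by (rule openE)
  \<comment> \<open>Radius \<open>1/4\<close> makes \<open>torus_proj\<close> injective on the ball and on its image.\<close>
  define r where "r = min r0 (1/4)"
  let ?B = "ball x r"
  have r: "r > 0" "r \<le> 1/4" "?B \<subseteq> U'" "F ` ?B \<subseteq> ball (F x) (1/4)"
  proof -
    show "r > 0" "r \<le> 1/4" using r0(1) by (auto simp: r_def)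
    have "?B \<subseteq> ball x r0" by (rule subset_ball) (simp add: r_def)
    then have "?B \<subseteq> U' \<inter> F -` ball (F x) (1/4)" using r0(2) by (rule order_trans)
    then show "?B \<subseteq> U'" "F ` ?B \<subseteq> ball (F x) (1/4)" by (simp_all add: image_subset_iff_subset_vimage)
  qed
  let ?U = "torus_proj ` ?B"
  have gF: "g (F a) = a" if "a \<in> U'" for a using homeomorphism_apply1[OF U'(6) that] .
  have FB: "open (F ` ?B)"
  proof -
    have "openin (top_of_set U') ?B" using r(3) U'(1) by (simp add: openin_open_eq)
    from homeomorphism_imp_open_map[OF U'(6) this] show ?thesis
      using U'(4) by (rule openin_open_trans)
  qed
  have fU: "f ` ?U = torus_proj ` F ` ?B" by (simp add: image_image F)
  have inj: "inj_on f ?U"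
  proof (rule inj_onI)
    fix p' q' assume "p' \<in> ?U" "q' \<in> ?U" and fpq: "f p' = f q'"
    then obtain a b where ab: "a \<in> ?B" "b \<in> ?B" "p' = torus_proj a" "q' = torus_proj b" by fast
    have "dist (F a) (F b) < 1"
    proof -
      have "F a \<in> ball (F x) (1/4)" "F b \<in> ball (F x) (1/4)"
        using subsetD[OF r(4) imageI[OF ab(1)]] subsetD[OF r(4) imageI[OF ab(2)]] .
      then have "dist (F x) (F a) < 1/4" "dist (F x) (F b) < 1/4" by simp_all
      then show ?thesis using dist_triangle3[of "F a" "F b" "F x"] by linarith
    qed
    then have "F a = F b" using fpq ab(3,4) torus_proj_inj_near[of "F a" "F b"] by (simp add: F)
    then have "g (F a) = g (F b)" by simp
    then have "a = b" using gF[OF subsetD[OF r(3) ab(1)]] gF[OF subsetD[OF r(3) ab(2)]] by simp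
    then show "p' = q'" using ab by simp
  qed
  have k: "inv_into ?U f (torus_proj y) = torus_proj (g y)" if "y \<in> F ` ?B" for y
  proof -
    obtain b where b: "b \<in> ?B" "y = F b" using \<open>y \<in> F ` ?B\<close> by fast
    then have "inv_into ?U f (f (torus_proj b)) = torus_proj b"
      by (intro inv_into_f_f inj imageI)
    then show ?thesis using b(2) gF[OF subsetD[OF r(3) b(1)]] by (simp add: F)
  qed
  have FBV: "F ` ?B \<subseteq> V" using image_mono[OF r(3), of F] homeomorphism_image1[OF U'(6)] by simp
  have dk: "torus_has_derivative (inv_into ?U f) (E (g y)) (torus_proj y)" if y: "y \<in> F ` ?B" for y
    unfolding torus_has_derivative_def
  proof (intro exI[of _ y] exI[of _ g] conjI refl)
    show "\<forall>\<^sub>F y in nhds y. torus_proj (g y) = inv_into ?U f (torus_proj y)"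
      unfolding eventually_nhds using FB y k by (intro exI[of _ "F ` ?B"]) (simp add: Ball_def)
    show "(g has_derivative blinfun_apply (E (g y))) (at y)"
      using g'(1)[of y] g'(2)[of y] subsetD[OF FBV y] by (simp add: invD)
  qed
  have ck: "continuous_on (f ` ?U) (torus_deriv (inv_into ?U f))"
  proof -
    obtain s where s: "homeomorphism (ball (F x) (1/4)) (ball (torus_proj (F x)) (1/4)) torus_proj s"
      using torus_proj_homeomorphism_ball by blast
    have sP: "s (torus_proj y) = y" if "y \<in> F ` ?B" for y
      using homeomorphism_apply1[OF s] that r(4) by blast
    have 1: "torus_proj ` F ` ?B \<subseteq> ball (torus_proj (F x)) (1/4)"
      using image_mono[OF r(4), of torus_proj] homeomorphism_image1[OF s] by simp
    have sc: "continuous_on (torus_proj ` F ` ?B) s"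
      by (rule continuous_on_subset[OF homeomorphism_cont2[OF s] 1])
    have gc: "continuous_on (F ` ?B) g"
      by (rule continuous_on_subset[OF homeomorphism_cont2[OF U'(6)] FBV])
    have "continuous_on (torus_proj ` F ` ?B) (\<lambda>q. E (g (s q)))"
      by (rule continuous_on_compose2[OF Ec], rule continuous_on_compose2[OF gc sc])
        (auto simp: sP simp del: mem_ball)
    moreover have "E (g (s q)) = torus_deriv (inv_into ?U f) q" if q: "q \<in> torus_proj ` F ` ?B" for q
    proof -
      obtain y where y: "y \<in> F ` ?B" "q = torus_proj y" using q by blast
      then show ?thesis using torus_deriv_eqI[OF dk[OF y(1)]] sP[OF y(1)] by simp
    qed
    ultimately have "continuous_on (torus_proj ` F ` ?B) (torus_deriv (inv_into ?U f))"
      by (rule continuous_on_eq)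
    then show ?thesis by (simp only: fU)
  qed
  show "\<exists>U. open U \<and> p \<in> U \<and> open (f ` U) \<and> inj_on f U \<and> torus_C1_on U f \<and>
      torus_C1_on (f ` U) (inv_into U f)"
  proof (intro exI[of _ ?U] conjI)
    show "open ?U" by (rule open_torus_proj_image) auto
    show "p \<in> ?U" using x r(1) by auto
    show "open (f ` ?U)" unfolding fU by (rule open_torus_proj_image[OF FB])
    show "inj_on f ?U" by (rule inj)
    show "torus_C1_on ?U f" unfolding torus_C1_on_def
      using tD continuous_on_subset[OF Dc subset_UNIV] by blast
    show "torus_C1_on (f ` ?U) (inv_into ?U f)" unfolding torus_C1_on_def
    proof
      show "continuous_on (f ` ?U) (torus_deriv (inv_into ?U f))" by (rule ck)
      show "\<forall>p\<in>f ` ?U. \<exists>D. torus_has_derivative (inv_into ?U f) D p"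
        unfolding fU using dk by fast
    qed
  qed
qed

section \<open>Anosov maps are expansive\<close>

lemma continuous_subbundle_subspace:
  assumes "continuous_subbundle E"
  shows "subspace (E p)"
proof -
  obtain K U s where "p \<in> U" "\<forall>q\<in>U. E q = span ((\<lambda>i. s i q) ` {..<K::nat})"
    using assms unfolding continuous_subbundle_def by metis
  then show ?thesis using subspace_span by metis
qed

lemma geometric_below:
  fixes C \<mu> \<epsilon> :: real
  assumes "0 < \<mu>" "\<mu> < 1" "0 < \<epsilon>"
  obtains n where "C * \<mu> ^ n < \<epsilon>"
proof -
  have "(\<lambda>n. C * \<mu> ^ n) \<longlonglongrightarrow> C * 0" using assms by (intro tendsto_intros LIMSEQ_power_zero) auto
  then have "\<forall>\<^sub>F n in sequentially. C * \<mu> ^ n < \<epsilon>" using assms(3) by (intro order_tendstoD(2)) auto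
  then show thesis using that unfolding eventually_sequentially by blast
qed

text \<open>
  Expansivity of \<open>g ^^ k\<close> for a non-invertible \<open>g\<close>: what has to be the diagonal is a relation between
  nearby points that can be followed forwards and, along suitable preimages, backwards.

  Pass to an iterate \<open>g ^^ N\<close>, with \<open>k\<close> dividing \<open>N\<close>, that contracts the stable bundle by a factor
  \<open>1/4\<close> and expands the quotient by a factor \<open>4\<close>. Let \<open>V\<close> be the supremum of the displacements
  between related points and \<open>Q\<close> that of their distances to the stable bundle. Linearising the iterate
  with an error \<open>\<epsilon> * V\<close> and following displacements forwards gives \<open>4 * Q \<le> Q + \<epsilon> * V\<close>, so that
  displacements are almost stable; following them backwards then gives
  \<open>V \<le> V / 4 + (L + 1/4) * Q + \<epsilon> * V\<close>. Together these force \<open>V = 0\<close>. Taking suprema over the whole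
  relation avoids cone fields, which matters because unstable directions of a non-invertible map depend
  on the choice of a past.
\<close>

lemma anosov_expansive:
  assumes g: "anosov_local_diffeo g" and k: "0 < k"
  shows "\<exists>\<delta>>0. \<forall>R. (\<forall>(p, q)\<in>R. dist p q < \<delta> \<and> ((g ^^ k) p, (g ^^ k) q) \<in> R \<and>
      (\<exists>(p', q')\<in>R. (g ^^ k) p' = p \<and> (g ^^ k) q' = q)) \<longrightarrow> (\<forall>(p, q)\<in>R. p = q)"
proof -
  obtain E C \<mu> where ld: "torus_local_diffeo g" and E: "continuous_subbundle E"
    and C: "C > 0" "0 < \<mu>" "\<mu> < 1"
    and con: "\<And>n p v. v \<in> E p \<Longrightarrow> norm (torus_deriv (g ^^ n) p v) \<le> C * \<mu> ^ n * norm v"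
    and ex: "\<And>n p v. infdist v (E p) \<le>
              C * \<mu> ^ n * infdist (torus_deriv (g ^^ n) p v) (E ((g ^^ n) p))"
    using g unfolding anosov_local_diffeo_def by metis
  have subE: "subspace (E p)" for p by (rule continuous_subbundle_subspace[OF E])
  obtain n0 where n0: "C * \<mu> ^ n0 < 1/4" by (rule geometric_below[OF C(2,3), of "1/4"]) simp
  define N where "N = k * Suc n0"
  have "1 * Suc n0 \<le> k * Suc n0" using k by (intro mult_le_mono1) simp
  then have "\<mu> ^ N \<le> \<mu> ^ n0" unfolding N_def using C by (intro power_decreasing) auto
  then have "C * \<mu> ^ N \<le> C * \<mu> ^ n0" using C(1) by (intro mult_left_mono) auto
  with n0 have CN: "C * \<mu> ^ N \<le> 1/4" by linarith
  obtain G where G: "\<And>x. torus_proj (G x) = g (torus_proj x)" "continuous_on UNIV G"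
    "\<And>x. (G has_derivative blinfun_apply (torus_deriv g (torus_proj x))) (at x)"
    by (rule local_diffeo_lift[OF ld]) (rule that)
  define GN where "GN = G ^^ N"
  define DN where "DN = torus_deriv (g ^^ N)"
  have cDN: "continuous_on UNIV DN"
    using funpow_lift_derivative[OF ld G(1,3), of N] by (simp add: DN_def)
  have dGN: "(GN has_derivative blinfun_apply (DN (torus_proj x))) (at x)" for x
    using funpow_lift_derivative[OF ld G(1,3), of N] by (simp add: GN_def DN_def)
  have GNp: "torus_proj (GN x) = (g ^^ N) (torus_proj x)" for x
    unfolding GN_def by (rule funpow_lift[of G g, OF G(1)])
  have "bounded (range DN)"
    by (intro compact_imp_bounded compact_continuous_image cDN compact_torus)
  then obtain L0 where L0: "\<And>p. norm (DN p) \<le> L0" unfolding bounded_iff by auto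
  define L where "L = max L0 1"
  have L: "norm (DN p) \<le> L" "L \<ge> 1" for p using L0[of p] by (auto simp: L_def)
  have LV: "norm (DN p v) \<le> L * norm v" for p v
    using norm_blinfun[of "DN p" v] L(1)[of p] by (meson mult_right_mono norm_ge_zero order_trans)
  \<comment> \<open>Chosen so that \<open>(L + 1/4) * \<epsilon> / 3 + \<epsilon>\<close> is less than \<open>3/4\<close>.\<close>
  define \<epsilon> where "\<epsilon> = 1 / (4 * (L + 2))"
  have \<epsilon>: "\<epsilon> > 0" "\<epsilon> \<le> 1/8" "(L + 2) * \<epsilon> = 1/4" using L(2) by (auto simp: \<epsilon>_def field_simps)
  obtain d where d: "d > 0" "\<And>p q. dist p q < d \<Longrightarrow> dist (DN p) (DN q) < \<epsilon>"
    using compact_uniformly_continuous[OF cDN compact_torus] \<epsilon>(1)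
    unfolding uniformly_continuous_on_def by (metis UNIV_I dist_commute)
  \<comment> \<open>With this bound displacements stay at most \<open>1/4\<close> under the lift of the iterate, so the points of the
    torus determine them.\<close>
  define \<delta> where "\<delta> = min d (1 / (4 * (L + 1)))"
  have \<delta>: "\<delta> > 0" "\<delta> \<le> d" "\<delta> \<le> 1/4" "(L + 1) * \<delta> \<le> 1/4"
  proof -
    show "\<delta> > 0" "\<delta> \<le> d" using d(1) L(2) by (auto simp: \<delta>_def)
    have "\<delta> \<le> 1 / (4 * (L + 1))" by (simp add: \<delta>_def)
    then show L\<delta>: "(L + 1) * \<delta> \<le> 1/4" using L(2) by (simp add: field_simps)
    have "1 * \<delta> \<le> (L + 1) * \<delta>" using \<open>\<delta> > 0\<close> L(2) by (intro mult_right_mono) auto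
    then show "\<delta> \<le> 1/4" using L\<delta> by simp
  qed
  have lin: "norm (GN (X + v) - GN X - DN (torus_proj X) v) \<le> \<epsilon> * norm v" if v: "norm v < \<delta>" for X v
  proof -
    have "norm (GN (X + v) - GN X - blinfun_apply (DN (torus_proj X)) ((X + v) - X)) \<le> norm ((X + v) - X) * \<epsilon>"
    proof (rule differentiable_bound_linearization[where S = "ball X \<delta>" and
          f' = "\<lambda>x. blinfun_apply (DN (torus_proj x))"])
      fix t :: real assume t: "t \<in> {0..1}"
      have "\<bar>t\<bar> * norm v \<le> 1 * norm v" using t by (intro mult_right_mono) auto
      then show "X + t *\<^sub>R (X + v - X) \<in> ball X \<delta>" using v by (simp add: dist_norm)
    next
      fix x assume x: "x \<in> ball X \<delta>"
      have "dist (torus_proj x) (torus_proj X) < d"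
        using x \<delta>(2) dist_torus_proj_le[of x X] by (simp add: dist_commute)
      then have "norm (DN (torus_proj x) - DN (torus_proj X)) \<le> \<epsilon>"
        using d(2) by (auto simp: dist_norm less_imp_le)
      moreover have "blinfun_apply (DN (torus_proj x)) - blinfun_apply (DN (torus_proj X)) =
          blinfun_apply (DN (torus_proj x) - DN (torus_proj X))"
        by (auto simp: blinfun.diff_left)
      ultimately show "onorm (blinfun_apply (DN (torus_proj x)) - blinfun_apply (DN (torus_proj X))) \<le> \<epsilon>"
        by (simp add: norm_blinfun.rep_eq)
    next
      show "(GN has_derivative blinfun_apply (DN (torus_proj x))) (at x within ball X \<delta>)" for x
        by (rule has_derivative_at_withinI[OF dGN])
      show "X \<in> ball X \<delta>" using \<delta>(1) by simp
    qed
    then show ?thesis by (simp add: mult.commute)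
  qed
  have lin': "norm (GN (X + v) - GN X) \<le> 1/4" if "norm v < \<delta>" for X v
  proof -
    have "norm (GN (X + v) - GN X) \<le> norm (DN (torus_proj X) v) + \<epsilon> * norm v"
      using norm_triangle_sub[of "GN (X + v) - GN X" "DN (torus_proj X) v"] lin[OF that, of X] by simp
    also have "\<dots> \<le> (L + \<epsilon>) * norm v" using LV by (simp add: algebra_simps)
    also have "\<dots> \<le> (L + 1) * \<delta>" using \<epsilon> L that by (intro mult_mono) auto
    finally show ?thesis using \<delta>(4) by simp
  qed
  show ?thesis
  proof (intro exI[of _ \<delta>] conjI \<delta>(1) allI impI ballI, clarify)
    fix R p q
    assume R: "\<forall>(p, q)\<in>R. dist p q < \<delta> \<and> ((g ^^ k) p, (g ^^ k) q) \<in> R \<and>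
      (\<exists>(p', q')\<in>R. (g ^^ k) p' = p \<and> (g ^^ k) q' = q)" and pq: "(p, q) \<in> R"
    have Rd: "dist p q < \<delta>" and Rf: "((g ^^ k) p, (g ^^ k) q) \<in> R"
      and Rb: "\<exists>p' q'. (p', q') \<in> R \<and> (g ^^ k) p' = p \<and> (g ^^ k) q' = q"
      if "(p, q) \<in> R" for p q using bspec[OF R that] by auto
    have gk: "(g ^^ (k * Suc n)) x = (g ^^ k) ((g ^^ (k * n)) x)" for n x
      by (simp add: funpow_add)
    have Rfn: "((g ^^ (k * n)) p, (g ^^ (k * n)) q) \<in> R" if "(p, q) \<in> R" for n p q
      by (induction n) (use that Rf gk in auto)
    have Rbn: "\<exists>p' q'. (p', q') \<in> R \<and> (g ^^ (k * n)) p' = p \<and> (g ^^ (k * n)) q' = q"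
      if "(p, q) \<in> R" for n p q
      using that
    proof (induction n arbitrary: p q)
      case (Suc n)
      then obtain p' q' where "(p', q') \<in> R" "(g ^^ k) p' = p" "(g ^^ k) q' = q" using Rb by blast
      then show ?case using Suc.IH[of p' q'] gk by metis
    qed auto
    \<comment> \<open>The related pairs, recorded in the plane as a point and a short displacement.\<close>
    define \<V> where "\<V> = {(X, v). (torus_proj X, torus_proj (X + v)) \<in> R \<and> norm v < \<delta>}"
    have fwd: "(GN X, GN (X + v) - GN X) \<in> \<V>" if "(X, v) \<in> \<V>" for X v
    proof -
      have v: "norm v < \<delta>" using that by (simp add: \<V>_def)
      have r: "(torus_proj (GN X), torus_proj (GN (X + v))) \<in> R"
        using that Rfn by (simp add: \<V>_def GNp N_def del: mult_Suc_right)
      obtain Y where Y: "torus_proj Y = torus_proj (GN (X + v))" "dist (GN X) Y < \<delta>"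
        using torus_lift_near[OF Rd[OF r]] by blast
      have "dist Y (GN (X + v)) < 1"
        using Y(2) lin'[OF v, of X] \<delta>(3) dist_triangle3[of Y "GN (X + v)" "GN X"]
        by (simp add: dist_norm norm_minus_commute)
      then have "Y = GN (X + v)" using torus_proj_inj_near[OF Y(1)] by simp
      then show ?thesis using Y(2) r by (simp add: \<V>_def dist_norm norm_minus_commute)
    qed
    have bwd: "\<exists>X' v'. (X', v') \<in> \<V> \<and> v = GN (X' + v') - GN X'" if "(X, v) \<in> \<V>" for X v
    proof -
      have "(torus_proj X, torus_proj (X + v)) \<in> R" and v: "norm v < \<delta>" using that by (auto simp: \<V>_def)
      then obtain p' q' where p': "(p', q') \<in> R" "(g ^^ N) p' = torus_proj X"
          "(g ^^ N) q' = torus_proj (X + v)"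
        using Rbn[of _ _ "Suc n0"] unfolding N_def by metis
      obtain X' where X': "torus_proj X' = p'" using torus_proj_surj by blast
      obtain Y' where Y': "torus_proj Y' = q'" "dist X' Y' < \<delta>"
        using torus_lift_near[of X' q' \<delta>] Rd[OF p'(1)] X' by auto
      have m: "(X', Y' - X') \<in> \<V>"
        using Y' X' p'(1) by (simp add: \<V>_def dist_norm norm_minus_commute)
      let ?w = "GN (X' + (Y' - X')) - GN X'"
      have "torus_proj (GN X') = torus_proj X" "torus_proj (GN Y') = torus_proj (X + v)"
        using p' X' Y' by (auto simp: GNp)
      then have "GN X' - X \<in> int_lattice" "GN Y' - (X + v) \<in> int_lattice"
        by (auto simp: torus_proj_eq_iff_lattice)
      from lattice_diff[OF this(2,1)] have "?w - v \<in> int_lattice" by (simp add: algebra_simps)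
      moreover have "norm (?w - v) < 1"
        using norm_triangle_ineq4[of ?w v] v \<delta>(3) lin'[of "Y' - X'" X'] Y'(2)
        by (simp add: dist_norm norm_minus_commute)
      ultimately have "?w - v = 0" by (rule lattice_norm_less_1)
      then show ?thesis using m by (intro exI[of _ X'] exI[of _ "Y' - X'"]) simp
    qed
    have E0: "infdist v (E p) \<le> norm v" for v p
      using infdist_le[of 0 "E p" v] subspace_0[OF subE] by simp
    define V where "V = (SUP z\<in>\<V>. norm (snd z))"
    define Q where "Q = (SUP z\<in>\<V>. infdist (snd z) (E (torus_proj (fst z))))"
    have bV: "bdd_above ((\<lambda>z. norm (snd z)) ` \<V>)"
      by (rule bdd_aboveI[of _ \<delta>]) (auto simp: \<V>_def)
    have bQ: "bdd_above ((\<lambda>z. infdist (snd z) (E (torus_proj (fst z)))) ` \<V>)"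
      by (rule bdd_aboveI[of _ \<delta>]) (auto simp: \<V>_def intro!: order_trans[OF E0 less_imp_le])
    have leV: "norm v \<le> V" if "(X, v) \<in> \<V>" for X v
      unfolding V_def using cSUP_upper[OF that bV] by simp
    have leQ: "infdist v (E (torus_proj X)) \<le> Q" if "(X, v) \<in> \<V>" for X v
      unfolding Q_def using cSUP_upper[OF that bQ] by simp
    obtain X where X: "torus_proj X = p" using torus_proj_surj by blast
    obtain Y where Y: "torus_proj Y = q" "dist X Y < \<delta>"
      using torus_lift_near[of X q \<delta>] Rd[OF pq] X by auto
    have XY: "(X, Y - X) \<in> \<V>"
      using X Y pq by (simp add: \<V>_def dist_norm norm_minus_commute)
    then have ne: "\<V> \<noteq> {}" by blast
    have q4: "4 * infdist v (E (torus_proj X)) \<le> Q + \<epsilon> * V" if z: "(X, v) \<in> \<V>" for X v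
    proof -
      have v: "norm v < \<delta>" using z by (simp add: \<V>_def)
      let ?w = "GN (X + v) - GN X" and ?E' = "E ((g ^^ N) (torus_proj X))"
      have "infdist v (E (torus_proj X)) \<le> 1/4 * infdist (DN (torus_proj X) v) ?E'"
        using ex[of v "torus_proj X" N] mult_right_mono[OF CN infdist_nonneg] unfolding DN_def
        by (meson order_trans)
      moreover have "infdist (DN (torus_proj X) v) ?E' \<le> infdist ?w ?E' + dist (DN (torus_proj X) v) ?w"
        by (rule infdist_triangle)
      moreover have "infdist ?w ?E' \<le> Q" using leQ[OF fwd[OF z]] by (simp add: GNp)
      moreover have "dist (DN (torus_proj X) v) ?w \<le> \<epsilon> * V"
      proof -
        have "dist (DN (torus_proj X) v) ?w \<le> \<epsilon> * norm v"
          using lin[OF v, of X] by (simp add: dist_norm norm_minus_commute)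
        also have "\<dots> \<le> \<epsilon> * V" using leV[OF z] \<epsilon>(1) by (intro mult_left_mono) auto
        finally show ?thesis .
      qed
      ultimately show ?thesis by simp
    qed
    have "infdist (snd z) (E (torus_proj (fst z))) \<le> (Q + \<epsilon> * V) / 4" if "z \<in> \<V>" for z
      using q4[of "fst z" "snd z"] that by simp
    then have "Q \<le> (Q + \<epsilon> * V) / 4"
      by (subst (1) Q_def) (rule cSUP_least[OF ne])
    then have Q3: "3 * Q \<le> \<epsilon> * V" by simp
    have v1: "norm v \<le> V / 4 + (L + 1/4) * Q + \<epsilon> * V" if z: "(X, v) \<in> \<V>" for X v
    proof -
      obtain X' v' where z': "(X', v') \<in> \<V>" and vv: "v = GN (X' + v') - GN X'" using bwd[OF z] by blast
      have v': "norm v' < \<delta>" using z' by (simp add: \<V>_def)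
      let ?D = "DN (torus_proj X')" and ?q = "infdist v' (E (torus_proj X'))"
      obtain e where e: "e \<in> E (torus_proj X')" "?q = dist v' e"
        using infdist_attains_inf[OF closed_subspace[OF subE]] subspace_0[OF subE] by (metis empty_iff)
      have "norm v \<le> norm (?D v') + \<epsilon> * norm v'"
        using norm_triangle_sub[of v "?D v'"] lin[OF v', of X'] vv by simp
      moreover have "norm (?D v') \<le> norm (?D e) + norm (?D (v' - e))"
        using norm_triangle_ineq[of "?D e" "?D (v' - e)"] by (simp flip: blinfun.add_right)
      moreover have "norm (?D e) \<le> 1/4 * norm e"
        using con[OF e(1), of N] mult_right_mono[OF CN norm_ge_zero[of e]] unfolding DN_def by simp
      moreover have "norm e \<le> norm v' + ?q"
        using norm_triangle_sub[of e v'] e(2) by (simp add: dist_norm norm_minus_commute)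
      moreover have "norm (?D (v' - e)) \<le> L * ?q" using LV e(2) by (simp add: dist_norm)
      ultimately have "norm v \<le> 1/4 * norm v' + (L + 1/4) * ?q + \<epsilon> * norm v'"
        by (simp add: algebra_simps)
      moreover have "(L + 1/4) * ?q \<le> (L + 1/4) * Q" using leQ[OF z'] L(2) by (intro mult_left_mono) auto
      moreover have "\<epsilon> * norm v' \<le> \<epsilon> * V" using leV[OF z'] \<epsilon>(1) by (intro mult_left_mono) auto
      ultimately show ?thesis using leV[OF z'] by simp
    qed
    have "norm (snd z) \<le> V / 4 + (L + 1/4) * Q + \<epsilon> * V" if "z \<in> \<V>" for z
      using v1[of "fst z" "snd z"] that by simp
    then have V1: "V \<le> V / 4 + (L + 1/4) * Q + \<epsilon> * V"
      by (subst (1) V_def) (rule cSUP_least[OF ne])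
    have V2: "(L + 1/4) * Q \<le> (L + 1/4) * (\<epsilon> * V / 3)"
      using Q3 L(2) by (intro mult_left_mono) auto
    have V0: "0 \<le> V" using order_trans[OF norm_ge_zero leV[OF XY]] .
    have "(L + 1/4) * (\<epsilon> * V) \<le> (L + 2) * (\<epsilon> * V)"
      using \<epsilon>(1) V0 by (intro mult_right_mono) auto
    moreover have "(L + 2) * (\<epsilon> * V) = V / 4" by (simp only: mult.assoc[symmetric] \<epsilon>(3))
    ultimately have "(L + 1/4) * (\<epsilon> * V) / 3 \<le> V / 12" by linarith
    then have "(L + 1/4) * (\<epsilon> * V / 3) \<le> V / 12" by simp
    moreover have "\<epsilon> * V \<le> 1/8 * V" using \<epsilon>(2) V0 by (intro mult_right_mono) auto
    ultimately have "V \<le> 0" using V0 V1 V2 by linarith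
    then have "norm (Y - X) \<le> 0" using leV[OF XY] by linarith
    then have "Y = X" by simp
    then show "p = q" using X Y by simp
  qed
qed

section \<open>Increasing maps of the line are not expansive\<close>

text \<open>
  Beyond some \<open>N\<close> the images of the whole interval from \<open>a\<close> to \<open>t0\<close> are short; the finitely many earlier
  images are made short by shrinking the interval.
\<close>

lemma monotone_orbits_stay_close:
  fixes \<theta> :: "real \<Rightarrow> real"
  assumes mono: "strict_mono \<theta>" and cont: "continuous_on UNIV \<theta>" and t0: "a < t0"
    and lim: "(\<lambda>n. (\<theta> ^^ n) t0 - (\<theta> ^^ n) a) \<longlonglongrightarrow> 0" and \<delta>: "\<delta> > 0"
  obtains t where "a < t" "t \<le> t0"
    "\<And>n x. a \<le> x \<Longrightarrow> x \<le> t \<Longrightarrow> \<bar>(\<theta> ^^ n) x - (\<theta> ^^ n) a\<bar> < \<delta>"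
proof -
  have mn: "strict_mono (\<theta> ^^ n)" for n
  proof (rule strict_monoI)
    show "(\<theta> ^^ n) x < (\<theta> ^^ n) y" if "x < y" for x y
      by (induction n) (simp_all add: that strict_mono_less[OF mono])
  qed
  have cn: "continuous_on UNIV (\<theta> ^^ n)" for n
  proof (induction n)
    case (Suc n)
    show ?case using continuous_on_compose2[OF cont Suc.IH] by (simp add: o_def)
  qed (simp add: id_def)
  have "\<forall>\<^sub>F n in sequentially. (\<theta> ^^ n) t0 - (\<theta> ^^ n) a < \<delta>"
    using lim \<delta> by (rule order_tendstoD)
  then obtain N where N: "\<And>n. n \<ge> N \<Longrightarrow> (\<theta> ^^ n) t0 - (\<theta> ^^ n) a < \<delta>"
    unfolding eventually_sequentially by blast
  have "\<exists>t. a < t \<and> t \<le> t0 \<and> (\<forall>n<M. (\<theta> ^^ n) t - (\<theta> ^^ n) a < \<delta>)" for M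
  proof (induction M)
    case 0
    show ?case using t0 by (intro exI[of _ t0]) simp
  next
    case (Suc M)
    then obtain t where t: "a < t" "t \<le> t0" "\<And>n. n < M \<Longrightarrow> (\<theta> ^^ n) t - (\<theta> ^^ n) a < \<delta>" by blast
    obtain d where d: "d > 0" "\<And>x. dist x a < d \<Longrightarrow> dist ((\<theta> ^^ M) x) ((\<theta> ^^ M) a) < \<delta>"
      using cn[of M, unfolded continuous_on_iff, rule_format, OF UNIV_I \<delta>, of a] by (simp only: UNIV_I simp_thms Ball_def) blast
    define t' where "t' = min t (a + d/2)"
    have t': "a < t'" "t' \<le> t" "dist t' a < d" using t d by (auto simp: t'_def dist_real_def)
    have "(\<theta> ^^ n) t' - (\<theta> ^^ n) a < \<delta>" if "n < Suc M" for n
    proof (cases "n = M")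
      case True
      then show ?thesis using d(2)[OF t'(3)] by (simp add: dist_real_def)
    next
      case False
      then have "(\<theta> ^^ n) t - (\<theta> ^^ n) a < \<delta>" using t(3) that by simp
      moreover have "(\<theta> ^^ n) t' \<le> (\<theta> ^^ n) t" using mn t'(2) by (simp add: strict_mono_less_eq)
      ultimately show ?thesis by simp
    qed
    then show ?case using t' t(2) by (intro exI[of _ t'] conjI allI impI) simp_all
  qed
  then obtain t where t: "a < t" "t \<le> t0" "\<And>n. n < N \<Longrightarrow> (\<theta> ^^ n) t - (\<theta> ^^ n) a < \<delta>" by blast
  show thesis
  proof (rule that[OF t(1,2)])
    fix n x assume x: "a \<le> x" "x \<le> t"
    have "(\<theta> ^^ n) a \<le> (\<theta> ^^ n) x" "(\<theta> ^^ n) x \<le> (\<theta> ^^ n) t" "(\<theta> ^^ n) t \<le> (\<theta> ^^ n) t0"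
      using x t(2) by (simp_all add: strict_mono_less_eq[OF mn])
    moreover have "(\<theta> ^^ n) t - (\<theta> ^^ n) a < \<delta> \<or> (\<theta> ^^ n) t0 - (\<theta> ^^ n) a < \<delta>"
      using t(3)[of n] N[of n] by linarith
    ultimately show "\<bar>(\<theta> ^^ n) x - (\<theta> ^^ n) a\<bar> < \<delta>" by linarith
  qed
qed

text \<open>
  The forward orbit of \<open>a\<close> increases and is bounded by \<open>b\<close>, and the backward orbit of \<open>\<Psi> a\<close> decreases
  and is bounded by \<open>c\<close>. Both converge, so the iterates of the interval from \<open>a\<close> to \<open>\<Psi> a\<close> shrink in
  both time directions. The conclusion has the form in which expansivity is contradicted: a
  relation between points at distance less than \<open>\<delta>\<close> which is invariant forwards and backwards and
  contains all pairs from an arc.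
\<close>

lemma increasing_map_not_expansive:
  fixes \<Psi> :: "real \<Rightarrow> real"
  assumes mono: "strict_mono \<Psi>" and surj: "surj \<Psi>"
    and c: "c < a" "\<Psi> c < c" and a: "a < \<Psi> a" and b: "a < b" "\<Psi> b < b" and \<delta>: "\<delta> > 0"
  obtains t S where "a < t" "\<And>x y. x \<in> {a..t} \<Longrightarrow> y \<in> {a..t} \<Longrightarrow> (x, y) \<in> S"
    "\<And>x y. (x, y) \<in> S \<Longrightarrow> \<bar>x - y\<bar> < \<delta>"
    "\<And>x y. (x, y) \<in> S \<Longrightarrow> (\<Psi> x, \<Psi> y) \<in> S"
    "\<And>x y. (x, y) \<in> S \<Longrightarrow> \<exists>x' y'. (x', y') \<in> S \<and> \<Psi> x' = x \<and> \<Psi> y' = y"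
proof -
  define \<Phi> where "\<Phi> = inv \<Psi>"
  have \<Psi>\<Phi> [simp]: "\<Psi> (\<Phi> x) = x" for x using surj by (simp add: \<Phi>_def surj_f_inv_f)
  have inj: "inj \<Psi>" using mono by (rule strict_mono_imp_inj_on)
  have \<Phi>\<Psi> [simp]: "\<Phi> (\<Psi> x) = x" for x by (simp add: \<Phi>_def inv_f_f[OF inj])
  have lt: "\<Psi> x < \<Psi> y \<longleftrightarrow> x < y" for x y by (rule strict_mono_less[OF mono])
  have mono': "strict_mono \<Phi>"
  proof (rule strict_monoI)
    show "\<Phi> x < \<Phi> y" if "x < y" for x y using lt[of "\<Phi> x" "\<Phi> y"] that by simp
  qed
  have surj': "surj \<Phi>" by (rule surjI[of _ \<Psi>]) simp
  have cont: "continuous_on UNIV \<Psi>"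
    by (rule continuous_onI_mono) (auto simp: surj strict_mono_less_eq[OF mono])
  have cont': "continuous_on UNIV \<Phi>"
    by (rule continuous_onI_mono) (auto simp: surj' strict_mono_less_eq[OF mono'])
  have lim: "(\<lambda>n. (\<Psi> ^^ n) (\<Psi> a) - (\<Psi> ^^ n) a) \<longlonglongrightarrow> 0"
  proof -
    have le: "(\<Psi> ^^ n) a < (\<Psi> ^^ Suc n) a \<and> (\<Psi> ^^ n) a < b" for n
    proof (induction n)
      case (Suc n)
      then have "\<Psi> ((\<Psi> ^^ n) a) < \<Psi> b" by (simp add: lt)
      then have "\<Psi> ((\<Psi> ^^ n) a) < b" using b(2) by linarith
      then show ?case using Suc by (simp add: lt)
    qed (use a b in auto)
    have "convergent (\<lambda>n. (\<Psi> ^^ n) a)"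
    proof (rule Bseq_monoseq_convergent)
      have inc: "incseq (\<lambda>n. (\<Psi> ^^ n) a)" using le by (intro incseq_SucI less_imp_le) auto
      then show "monoseq (\<lambda>n. (\<Psi> ^^ n) a)" by (simp add: monoseq_iff)
      show "Bseq (\<lambda>n. (\<Psi> ^^ n) a)"
      proof (rule BseqI'[where K = "\<bar>a\<bar> + \<bar>b\<bar>"])
        fix n
        have "a \<le> (\<Psi> ^^ n) a" using incseqD[OF inc, of 0 n] by simp
        moreover have "(\<Psi> ^^ n) a < b" using le by blast
        ultimately show "norm ((\<Psi> ^^ n) a) \<le> \<bar>a\<bar> + \<bar>b\<bar>" unfolding real_norm_def by linarith
      qed
    qed
    then obtain l where l: "(\<lambda>n. (\<Psi> ^^ n) a) \<longlonglongrightarrow> l" unfolding convergent_def by blast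
    have "(\<lambda>n. (\<Psi> ^^ Suc n) a - (\<Psi> ^^ n) a) \<longlonglongrightarrow> l - l"
      by (intro tendsto_diff LIMSEQ_Suc l)
    then show ?thesis by (simp add: funpow_swap1)
  qed
  have lim': "(\<lambda>n. (\<Phi> ^^ n) (\<Psi> a) - (\<Phi> ^^ n) a) \<longlonglongrightarrow> 0"
  proof -
    have e: "(\<Phi> ^^ Suc n) (\<Psi> a) = (\<Phi> ^^ n) a" for n by (simp add: funpow_swap1)
    have le: "(\<Phi> ^^ Suc n) (\<Psi> a) < (\<Phi> ^^ n) (\<Psi> a) \<and> c < (\<Phi> ^^ n) (\<Psi> a)" for n
    proof (induction n)
      case (Suc n)
      have "\<Psi> c < (\<Phi> ^^ n) (\<Psi> a)" using Suc c(2) by simp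
      then have "\<Phi> (\<Psi> c) < \<Phi> ((\<Phi> ^^ n) (\<Psi> a))" using mono' by (simp only: strict_mono_less)
      then show ?case using Suc mono' by (simp add: strict_mono_less)
    qed (use a c in auto)
    have "convergent (\<lambda>n. (\<Phi> ^^ n) (\<Psi> a))"
    proof (rule Bseq_monoseq_convergent)
      have dec: "decseq (\<lambda>n. (\<Phi> ^^ n) (\<Psi> a))" using le by (intro decseq_SucI less_imp_le) auto
      then show "monoseq (\<lambda>n. (\<Phi> ^^ n) (\<Psi> a))" by (simp add: monoseq_iff)
      show "Bseq (\<lambda>n. (\<Phi> ^^ n) (\<Psi> a))"
      proof (rule BseqI'[where K = "\<bar>\<Psi> a\<bar> + \<bar>c\<bar>"])
        fix n
        have "(\<Phi> ^^ n) (\<Psi> a) \<le> \<Psi> a" using decseqD[OF dec, of 0 n] by simp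
        moreover have "c < (\<Phi> ^^ n) (\<Psi> a)" using le by blast
        ultimately show "norm ((\<Phi> ^^ n) (\<Psi> a)) \<le> \<bar>\<Psi> a\<bar> + \<bar>c\<bar>" unfolding real_norm_def by linarith
      qed
    qed
    then obtain l where l: "(\<lambda>n. (\<Phi> ^^ n) (\<Psi> a)) \<longlonglongrightarrow> l" unfolding convergent_def by blast
    have "(\<lambda>n. (\<Phi> ^^ n) (\<Psi> a) - (\<Phi> ^^ Suc n) (\<Psi> a)) \<longlonglongrightarrow> l - l"
      by (intro tendsto_diff l LIMSEQ_Suc)
    then show ?thesis by (simp only: e diff_self)
  qed
  have "\<delta>/2 > 0" using \<delta> by simp
  obtain t1 where t1: "a < t1" "t1 \<le> \<Psi> a"
    "\<And>n x. a \<le> x \<Longrightarrow> x \<le> t1 \<Longrightarrow> \<bar>(\<Psi> ^^ n) x - (\<Psi> ^^ n) a\<bar> < \<delta>/2"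
    by (rule monotone_orbits_stay_close[OF mono cont a lim \<open>\<delta>/2 > 0\<close>]) (rule that)
  obtain t2 where t2: "a < t2" "t2 \<le> \<Psi> a"
    "\<And>n x. a \<le> x \<Longrightarrow> x \<le> t2 \<Longrightarrow> \<bar>(\<Phi> ^^ n) x - (\<Phi> ^^ n) a\<bar> < \<delta>/2"
    by (rule monotone_orbits_stay_close[OF mono' cont' a lim' \<open>\<delta>/2 > 0\<close>]) (rule that)
  define t where "t = min t1 t2"
  define S where "S = {(x, y). \<exists>n. \<exists>x0\<in>{a..t}. \<exists>y0\<in>{a..t}.
      x = (\<Psi> ^^ n) x0 \<and> y = (\<Psi> ^^ n) y0 \<or> x = (\<Phi> ^^ n) x0 \<and> y = (\<Phi> ^^ n) y0}"
  have SI1: "((\<Psi> ^^ n) x0, (\<Psi> ^^ n) y0) \<in> S" if "x0 \<in> {a..t}" "y0 \<in> {a..t}" for n x0 y0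
    using that unfolding S_def by blast
  have SI2: "((\<Phi> ^^ n) x0, (\<Phi> ^^ n) y0) \<in> S" if "x0 \<in> {a..t}" "y0 \<in> {a..t}" for n x0 y0
    using that unfolding S_def by blast
  have SE: P if "(x, y) \<in> S"
    "\<And>n x0 y0. \<lbrakk>x0 \<in> {a..t}; y0 \<in> {a..t}; x = (\<Psi> ^^ n) x0; y = (\<Psi> ^^ n) y0\<rbrakk> \<Longrightarrow> P"
    "\<And>n x0 y0. \<lbrakk>x0 \<in> {a..t}; y0 \<in> {a..t}; x = (\<Phi> ^^ n) x0; y = (\<Phi> ^^ n) y0\<rbrakk> \<Longrightarrow> P" for x y P
    using that unfolding S_def by blast
  show thesis
  proof (rule that)
    show "a < t" using t1 t2 by (simp add: t_def)
    show "(x, y) \<in> S" if "x \<in> {a..t}" "y \<in> {a..t}" for x y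
      using SI1[OF that, of 0] by simp
    show "\<bar>x - y\<bar> < \<delta>" if "(x, y) \<in> S" for x y
      using that
    proof (rule SE)
      fix n x0 y0 assume *: "x0 \<in> {a..t}" "y0 \<in> {a..t}" "x = (\<Psi> ^^ n) x0" "y = (\<Psi> ^^ n) y0"
      have "\<bar>(\<Psi> ^^ n) x0 - (\<Psi> ^^ n) a\<bar> < \<delta>/2" "\<bar>(\<Psi> ^^ n) y0 - (\<Psi> ^^ n) a\<bar> < \<delta>/2"
        by (rule t1(3); use * in \<open>simp add: t_def\<close>)+
      then show ?thesis unfolding *(3,4) by linarith
    next
      fix n x0 y0 assume *: "x0 \<in> {a..t}" "y0 \<in> {a..t}" "x = (\<Phi> ^^ n) x0" "y = (\<Phi> ^^ n) y0"
      have "\<bar>(\<Phi> ^^ n) x0 - (\<Phi> ^^ n) a\<bar> < \<delta>/2" "\<bar>(\<Phi> ^^ n) y0 - (\<Phi> ^^ n) a\<bar> < \<delta>/2"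
        by (rule t2(3); use * in \<open>simp add: t_def\<close>)+
      then show ?thesis unfolding *(3,4) by linarith
    qed
    show "(\<Psi> x, \<Psi> y) \<in> S" if "(x, y) \<in> S" for x y
      using that
    proof (rule SE)
      fix n x0 y0 assume *: "x0 \<in> {a..t}" "y0 \<in> {a..t}" "x = (\<Psi> ^^ n) x0" "y = (\<Psi> ^^ n) y0"
      then show ?thesis using SI1[OF *(1,2), of "Suc n"] by simp
    next
      fix n x0 y0 assume *: "x0 \<in> {a..t}" "y0 \<in> {a..t}" "x = (\<Phi> ^^ n) x0" "y = (\<Phi> ^^ n) y0"
      then show ?thesis using SI2[OF *(1,2)] SI1[OF *(1,2), of 1] by (cases n) auto
    qed
    show "\<exists>x' y'. (x', y') \<in> S \<and> \<Psi> x' = x \<and> \<Psi> y' = y" if "(x, y) \<in> S" for x y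
    proof -
      have "(\<Phi> x, \<Phi> y) \<in> S"
        using that
      proof (rule SE)
        fix n x0 y0 assume *: "x0 \<in> {a..t}" "y0 \<in> {a..t}" "x = (\<Psi> ^^ n) x0" "y = (\<Psi> ^^ n) y0"
        then show ?thesis using SI1[OF *(1,2)] SI2[OF *(1,2), of 1] by (cases n) auto
      next
        fix n x0 y0 assume *: "x0 \<in> {a..t}" "y0 \<in> {a..t}" "x = (\<Phi> ^^ n) x0" "y = (\<Phi> ^^ n) y0"
        then show ?thesis using SI2[OF *(1,2), of "Suc n"] by simp
      qed
      then show ?thesis by (intro exI[of _ "\<Phi> x"] exI[of _ "\<Phi> y"]) simp
    qed
  qed
qed

section \<open>Saddles perturbed along the stable direction\<close>

text \<open>
  The plane has coordinates \<open>\<sigma>\<close> (stable) and \<open>\<tau>\<close> (unstable), and \<open>F\<close> is the diagonal map with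
  eigenvalues \<open>ls\<close> and \<open>lu\<close>, plus the bump \<open>B\<close> in the stable direction, plus an error with components
  \<open>\<alpha>\<close> and \<open>\<gamma>\<close> that is small together with its Lipschitz constant. The sign in front of \<open>B\<close> lets the
  bump act alike for either sign of \<open>ls\<close>. Its slope is at least \<open>- \<bar>ls\<bar> / 2\<close>, so it never outweighs
  the linear part and \<open>F\<close> remains invertible; its slope may reach 1, but \<open>lu\<close> is large enough for the
  unstable cone to remain invariant. The inequalities at \<open>a\<close> and \<open>b\<close> say that \<open>a\<close> is pushed away
  from \<open>0\<close> and \<open>b\<close> towards \<open>0\<close>, by more than what the errors can undo; as \<open>B\<close> is odd, the same holds
  at \<open>- a\<close> and \<open>- b\<close>.
\<close>

locale perturbed_saddle =
  fixes F :: "real^2 \<Rightarrow> real^2" and es eu :: "real^2" and \<sigma> \<tau> \<alpha> \<gamma> :: "real^2 \<Rightarrow> real"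
    and B :: "real \<Rightarrow> real" and ls lu \<beta> \<eta> a b :: real
  assumes lin: "linear \<sigma>" "linear \<tau>"
    and coords: "\<And>x. \<sigma> x *\<^sub>R es + \<tau> x *\<^sub>R eu = x"
      "\<And>s u. \<sigma> (s *\<^sub>R es + u *\<^sub>R eu) = s" "\<And>s u. \<tau> (s *\<^sub>R es + u *\<^sub>R eu) = u"
    and F\<sigma>: "\<And>x. \<sigma> (F x) = ls * \<sigma> x + sgn ls * B (\<sigma> x + \<beta> * \<tau> x) + \<alpha> x"
    and F\<tau>: "\<And>x. \<tau> (F x) = lu * \<tau> x + \<gamma> x"
    and ls: "0 < \<bar>ls\<bar>" "\<bar>ls\<bar> < 1" and lu: "2 < \<bar>lu\<bar>" and \<beta>: "\<bar>\<beta>\<bar> \<le> 1/2"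
    and \<eta>: "0 < \<eta>" "\<eta> < \<bar>ls\<bar> / 8" "\<bar>ls\<bar> + 1 + \<bar>\<beta>\<bar> + 4 * \<eta> \<le> \<bar>lu\<bar>"
    and \<alpha>: "\<And>x. \<bar>\<alpha> x\<bar> \<le> \<eta>" "\<And>x y. \<bar>\<alpha> x - \<alpha> y\<bar> \<le> \<eta> * (\<bar>\<sigma> x - \<sigma> y\<bar> + \<bar>\<tau> x - \<tau> y\<bar>)"
    and \<gamma>: "\<And>x. \<bar>\<gamma> x\<bar> \<le> \<eta>" "\<And>x y. \<bar>\<gamma> x - \<gamma> y\<bar> \<le> \<eta> * (\<bar>\<sigma> x - \<sigma> y\<bar> + \<bar>\<tau> x - \<tau> y\<bar>)"
    and B_lip: "\<And>x y. \<bar>B x - B y\<bar> \<le> \<bar>x - y\<bar>"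
    and B_slope: "\<And>x y. x \<le> y \<Longrightarrow> B y - B x \<ge> - (\<bar>ls\<bar> / 2) * (y - x)"
    and B_odd: "\<And>x. B (- x) = - B x"
    and ab: "0 < a" "a < b" "a + 2 * \<eta> < \<bar>ls\<bar> * a + B a" "\<bar>ls\<bar> * b + B b + 2 * \<eta> < b"
begin

lemma coords_norm: "norm x \<le> (norm es + norm eu) * (\<bar>\<sigma> x\<bar> + \<bar>\<tau> x\<bar>)"
proof -
  have "norm x \<le> \<bar>\<sigma> x\<bar> * norm es + \<bar>\<tau> x\<bar> * norm eu"
    using norm_triangle_ineq[of "\<sigma> x *\<^sub>R es" "\<tau> x *\<^sub>R eu"] by (simp add: coords)
  also have "\<dots> \<le> (norm es + norm eu) * (\<bar>\<sigma> x\<bar> + \<bar>\<tau> x\<bar>)" by (simp add: algebra_simps)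
  finally show ?thesis .
qed

lemma \<sigma>_diff: "\<sigma> (x - y) = \<sigma> x - \<sigma> y" and \<tau>_diff: "\<tau> (x - y) = \<tau> x - \<tau> y"
  using lin by (simp_all add: linear_diff)

lemma coords_eqI:
  assumes "\<sigma> x = \<sigma> y" "\<tau> x = \<tau> y"
  shows "x = y"
  by (rule trans[OF coords(1)[of x, symmetric] coords(1)[of y, unfolded assms[symmetric]]])

lemma continuous_\<sigma>: "continuous_on S \<sigma>" and continuous_\<tau>: "continuous_on S \<tau>"
  using lin by (simp_all add: linear_continuous_on linear_conv_bounded_linear)

lemma lipschitz_in_coords_continuous:
  fixes f :: "real^2 \<Rightarrow> real"
  assumes "\<And>x y. \<bar>f x - f y\<bar> \<le> \<eta> * (\<bar>\<sigma> x - \<sigma> y\<bar> + \<bar>\<tau> x - \<tau> y\<bar>)"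
  shows "continuous_on S f"
  unfolding continuous_on_def
proof
  fix x assume "x \<in> S"
  have "((\<lambda>y. \<eta> * (\<bar>\<sigma> y - \<sigma> x\<bar> + \<bar>\<tau> y - \<tau> x\<bar>)) \<longlongrightarrow> \<eta> * (\<bar>\<sigma> x - \<sigma> x\<bar> + \<bar>\<tau> x - \<tau> x\<bar>)) (at x within S)"
    using continuous_\<sigma>[of S] continuous_\<tau>[of S] \<open>x \<in> S\<close>
    by (intro tendsto_intros) (simp_all add: continuous_on_def)
  then have "((\<lambda>y. \<eta> * (\<bar>\<sigma> y - \<sigma> x\<bar> + \<bar>\<tau> y - \<tau> x\<bar>)) \<longlongrightarrow> 0) (at x within S)" by simp
  then have "((\<lambda>y. f y - f x) \<longlongrightarrow> 0) (at x within S)"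
    by (rule tendsto_rabs_zero_cancel[OF tendsto_sandwich[OF always_eventually[OF allI[OF abs_ge_zero]]
          always_eventually[OF allI[OF assms]] tendsto_const]])
  then show "(f \<longlongrightarrow> f x) (at x within S)" by (rule LIM_zero_cancel)
qed

lemma B_contracted: "\<bar>(\<bar>ls\<bar> * s + B (s + t)) - (\<bar>ls\<bar> * s' + B (s' + t'))\<bar>
    \<le> (\<bar>ls\<bar> + 1) * \<bar>s - s'\<bar> + \<bar>t - t'\<bar>"
proof -
  have "\<bar>(\<bar>ls\<bar> * s + B (s + t)) - (\<bar>ls\<bar> * s' + B (s' + t'))\<bar>
      \<le> \<bar>\<bar>ls\<bar> * s - \<bar>ls\<bar> * s'\<bar> + \<bar>B (s + t) - B (s' + t')\<bar>"
    by (rule abs_diff_triangle_ineq)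
  also have "\<bar>\<bar>ls\<bar> * s - \<bar>ls\<bar> * s'\<bar> = \<bar>ls\<bar> * \<bar>s - s'\<bar>" by (simp add: abs_mult flip: right_diff_distrib)
  also have "\<bar>B (s + t) - B (s' + t')\<bar> \<le> \<bar>s - s'\<bar> + \<bar>t - t'\<bar>"
    by (rule order_trans[OF B_lip abs_diff_triangle_ineq])
  finally show ?thesis by (simp add: distrib_right)
qed

lemma ls_sgn: "ls = sgn ls * \<bar>ls\<bar>" "\<bar>sgn ls\<bar> = 1" "sgn ls * sgn ls = 1"
  using ls by (auto simp: sgn_mult_abs sgn_if)

lemma abs_sgn_ls_mult: "\<bar>sgn ls * c\<bar> = \<bar>c\<bar>"
  using ls_sgn(2) by (simp only: abs_mult mult_1)

lemma F\<sigma>': "\<sigma> (F x) = sgn ls * (\<bar>ls\<bar> * \<sigma> x + B (\<sigma> x + \<beta> * \<tau> x)) + \<alpha> x"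
  unfolding F\<sigma> using ls_sgn(1) by (simp add: distrib_left)

lemma F\<sigma>_diff_le: "\<bar>\<sigma> (F x) - \<sigma> (F y)\<bar> \<le> (\<bar>ls\<bar> + 1) * \<bar>\<sigma> x - \<sigma> y\<bar> + \<bar>\<beta>\<bar> * \<bar>\<tau> x - \<tau> y\<bar>
    + \<eta> * (\<bar>\<sigma> x - \<sigma> y\<bar> + \<bar>\<tau> x - \<tau> y\<bar>)"
proof -
  let ?k = "\<lambda>x. \<bar>ls\<bar> * \<sigma> x + B (\<sigma> x + \<beta> * \<tau> x)"
  have b: "\<bar>\<beta> * \<tau> x - \<beta> * \<tau> y\<bar> = \<bar>\<beta>\<bar> * \<bar>\<tau> x - \<tau> y\<bar>" by (simp add: abs_mult flip: right_diff_distrib)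
  have "\<bar>\<sigma> (F x) - \<sigma> (F y)\<bar> \<le> \<bar>sgn ls * ?k x - sgn ls * ?k y\<bar> + \<bar>\<alpha> x - \<alpha> y\<bar>"
    unfolding F\<sigma>' by (rule abs_diff_triangle_ineq)
  also have "\<bar>sgn ls * ?k x - sgn ls * ?k y\<bar> = \<bar>?k x - ?k y\<bar>"
    by (simp only: abs_sgn_ls_mult flip: right_diff_distrib)
  also have "\<dots> + \<bar>\<alpha> x - \<alpha> y\<bar> \<le> ((\<bar>ls\<bar> + 1) * \<bar>\<sigma> x - \<sigma> y\<bar> + \<bar>\<beta>\<bar> * \<bar>\<tau> x - \<tau> y\<bar>)
      + \<eta> * (\<bar>\<sigma> x - \<sigma> y\<bar> + \<bar>\<tau> x - \<tau> y\<bar>)"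
    using B_contracted[of "\<sigma> x" "\<beta> * \<tau> x" "\<sigma> y" "\<beta> * \<tau> y"] unfolding b by (rule add_mono[OF _ \<alpha>(2)])
  finally show ?thesis .
qed

lemma F\<tau>_diff_ge: "\<bar>\<tau> (F x) - \<tau> (F y)\<bar> \<ge> \<bar>lu\<bar> * \<bar>\<tau> x - \<tau> y\<bar>
    - \<eta> * (\<bar>\<sigma> x - \<sigma> y\<bar> + \<bar>\<tau> x - \<tau> y\<bar>)"
proof -
  have *: "c - e \<le> \<bar>X + Y - (X' + Y')\<bar>" if "\<bar>X - X'\<bar> = c" "\<bar>Y - Y'\<bar> \<le> e" for X X' Y Y' c e :: real
    using that by linarith
  have "\<bar>lu * \<tau> x - lu * \<tau> y\<bar> = \<bar>lu\<bar> * \<bar>\<tau> x - \<tau> y\<bar>" by (simp add: abs_mult flip: right_diff_distrib)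
  then show ?thesis unfolding F\<tau> by (rule *) (rule \<gamma>(2))
qed

text \<open>
  The slope of the bump is at least \<open>- \<bar>ls\<bar> / 2\<close>, so half of the linear part survives wherever the
  argument of the bump does not decrease.
\<close>

lemma sgn_F\<sigma>_diff:
  assumes t: "0 \<le> (\<sigma> x - \<sigma> y) + \<beta> * (\<tau> x - \<tau> y)"
  shows "sgn ls * (\<sigma> (F x) - \<sigma> (F y)) \<ge> \<bar>ls\<bar> / 2 * (\<sigma> x - \<sigma> y) - \<bar>ls\<bar> / 2 * (\<beta> * (\<tau> x - \<tau> y))
    - \<eta> * (\<bar>\<sigma> x - \<sigma> y\<bar> + \<bar>\<tau> x - \<tau> y\<bar>)"
proof -
  let ?k = "\<lambda>x. \<bar>ls\<bar> * \<sigma> x + B (\<sigma> x + \<beta> * \<tau> x)"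
  let ?D = "B (\<sigma> x + \<beta> * \<tau> x) - B (\<sigma> y + \<beta> * \<tau> y)"
  have "sgn ls * (\<sigma> (F x) - \<sigma> (F y)) = (sgn ls * sgn ls) * (?k x - ?k y) + sgn ls * (\<alpha> x - \<alpha> y)"
    unfolding F\<sigma>' by (simp only: algebra_simps)
  also have "\<dots> = \<bar>ls\<bar> * (\<sigma> x - \<sigma> y) + ?D + sgn ls * (\<alpha> x - \<alpha> y)"
    unfolding ls_sgn(3) by (simp add: right_diff_distrib)
  finally have e: "sgn ls * (\<sigma> (F x) - \<sigma> (F y)) = \<bar>ls\<bar> * (\<sigma> x - \<sigma> y) + ?D + sgn ls * (\<alpha> x - \<alpha> y)" .
  have "?D \<ge> - (\<bar>ls\<bar> / 2) * ((\<sigma> x + \<beta> * \<tau> x) - (\<sigma> y + \<beta> * \<tau> y))"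
    using t by (intro B_slope) (simp add: right_diff_distrib)
  then have D: "?D \<ge> - (\<bar>ls\<bar> / 2) * ((\<sigma> x - \<sigma> y) + \<beta> * (\<tau> x - \<tau> y))"
    by (simp add: algebra_simps)
  have A: "\<bar>sgn ls * (\<alpha> x - \<alpha> y)\<bar> \<le> \<eta> * (\<bar>\<sigma> x - \<sigma> y\<bar> + \<bar>\<tau> x - \<tau> y\<bar>)"
    unfolding abs_sgn_ls_mult by (rule \<alpha>(2))
  have *: "l / 2 * d - l / 2 * bt - E \<le> l * d + D + A" if "D \<ge> - (l / 2) * (d + bt)" "\<bar>A\<bar> \<le> E"
    for l d bt E D A :: real
  proof -
    have "- A \<le> E" using that(2) by linarith
    moreover have "- (l / 2) * (d + bt) = - (l / 2 * d) - l / 2 * bt" "l * d = l / 2 * d + l / 2 * d"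
      by (simp_all add: algebra_simps)
    ultimately show ?thesis using that(1) by linarith
  qed
  show ?thesis unfolding e by (rule *[OF D A])
qed

text \<open>
  The estimate \<open>sgn_F\<sigma>_diff\<close> of the stable gap loses up to \<open>3/2\<close> of the unstable gap; the unstable
  gap of the images, which is about \<open>\<bar>lu\<bar> > 2\<close> times as large, makes up for it.
\<close>

lemma F_lower: "\<bar>\<sigma> (F x) - \<sigma> (F y)\<bar> + \<bar>\<tau> (F x) - \<tau> (F y)\<bar>
    \<ge> \<bar>ls\<bar> / 4 * (\<bar>\<sigma> x - \<sigma> y\<bar> + \<bar>\<tau> x - \<tau> y\<bar>)"
proof -
  have main: "\<bar>\<sigma> (F x) - \<sigma> (F y)\<bar> \<ge> \<bar>ls\<bar> / 2 * \<bar>\<sigma> x - \<sigma> y\<bar> - 3/2 * \<bar>\<tau> x - \<tau> y\<bar>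
      - \<eta> * (\<bar>\<sigma> x - \<sigma> y\<bar> + \<bar>\<tau> x - \<tau> y\<bar>)"
    if t: "0 \<le> (\<sigma> x - \<sigma> y) + \<beta> * (\<tau> x - \<tau> y)" for x y
  proof -
    have *: "l / 2 * p - 3/2 * q - E \<le> S"
      if "l / 2 * d - l / 2 * bt - E \<le> S" "l / 2 * p \<le> l / 2 * (d + q)" "l / 2 * q \<le> 1/2 * q"
        "l / 2 * bt \<le> 1/2 * c" "c \<le> 1/2 * q" "0 \<le> q" for l p q d bt E S c :: real
      using that by (simp add: algebra_simps)
    have b: "\<bar>\<beta> * (\<tau> x - \<tau> y)\<bar> \<le> 1/2 * \<bar>\<tau> x - \<tau> y\<bar>" unfolding abs_mult using \<beta> by (intro mult_right_mono) auto
    have **: "\<bar>d\<bar> \<le> d + q" if "0 \<le> d + c" "\<bar>c\<bar> \<le> 1/2 * q" for c d q :: real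
      using that by linarith
    have s: "\<bar>\<sigma> x - \<sigma> y\<bar> \<le> (\<sigma> x - \<sigma> y) + \<bar>\<tau> x - \<tau> y\<bar>" by (rule **[OF t b])
    show ?thesis
    proof (rule *)
      show "\<bar>ls\<bar> / 2 * (\<sigma> x - \<sigma> y) - \<bar>ls\<bar> / 2 * (\<beta> * (\<tau> x - \<tau> y))
          - \<eta> * (\<bar>\<sigma> x - \<sigma> y\<bar> + \<bar>\<tau> x - \<tau> y\<bar>) \<le> \<bar>\<sigma> (F x) - \<sigma> (F y)\<bar>"
        using order_trans[OF sgn_F\<sigma>_diff[OF t] abs_ge_self] unfolding abs_sgn_ls_mult .
      show "\<bar>ls\<bar> / 2 * \<bar>\<sigma> x - \<sigma> y\<bar> \<le> \<bar>ls\<bar> / 2 * ((\<sigma> x - \<sigma> y) + \<bar>\<tau> x - \<tau> y\<bar>)"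
        using s by (intro mult_left_mono) auto
      show "\<bar>ls\<bar> / 2 * \<bar>\<tau> x - \<tau> y\<bar> \<le> 1/2 * \<bar>\<tau> x - \<tau> y\<bar>" using ls by (intro mult_right_mono) auto
      have "\<bar>ls\<bar> / 2 * (\<beta> * (\<tau> x - \<tau> y)) \<le> \<bar>ls\<bar> / 2 * \<bar>\<beta> * (\<tau> x - \<tau> y)\<bar>" by (intro mult_left_mono) auto
      also have "\<dots> \<le> 1/2 * \<bar>\<beta> * (\<tau> x - \<tau> y)\<bar>" using ls by (intro mult_right_mono) auto
      finally show "\<bar>ls\<bar> / 2 * (\<beta> * (\<tau> x - \<tau> y)) \<le> 1/2 * \<bar>\<beta> * (\<tau> x - \<tau> y)\<bar>" .
    qed (use b in auto)
  qed
  have *: "l / 4 * (p + q) \<le> S + T"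
    if "l / 2 * p - 3/2 * q - e * (p + q) \<le> S" "u * q - e * (p + q) \<le> T" "2 * q \<le> u * q"
      "l / 2 * q \<le> 1/2 * q" "e * (p + q) \<le> l / 8 * (p + q)" for l u p q e S T :: real
    using that by (simp add: algebra_simps)
  show ?thesis
  proof (rule *)
    show "\<bar>ls\<bar> / 2 * \<bar>\<sigma> x - \<sigma> y\<bar> - 3/2 * \<bar>\<tau> x - \<tau> y\<bar>
        - \<eta> * (\<bar>\<sigma> x - \<sigma> y\<bar> + \<bar>\<tau> x - \<tau> y\<bar>) \<le> \<bar>\<sigma> (F x) - \<sigma> (F y)\<bar>"
    proof (cases "0 \<le> (\<sigma> x - \<sigma> y) + \<beta> * (\<tau> x - \<tau> y)")
      case False
      then have "0 \<le> (\<sigma> y - \<sigma> x) + \<beta> * (\<tau> y - \<tau> x)" by (simp add: algebra_simps)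
      from main[OF this] show ?thesis by (simp only: abs_minus_commute)
    qed (rule main)
    show "\<bar>lu\<bar> * \<bar>\<tau> x - \<tau> y\<bar> - \<eta> * (\<bar>\<sigma> x - \<sigma> y\<bar> + \<bar>\<tau> x - \<tau> y\<bar>) \<le> \<bar>\<tau> (F x) - \<tau> (F y)\<bar>"
      by (rule F\<tau>_diff_ge)
    show "2 * \<bar>\<tau> x - \<tau> y\<bar> \<le> \<bar>lu\<bar> * \<bar>\<tau> x - \<tau> y\<bar>" using lu by (intro mult_right_mono) auto
    show "\<bar>ls\<bar> / 2 * \<bar>\<tau> x - \<tau> y\<bar> \<le> 1/2 * \<bar>\<tau> x - \<tau> y\<bar>" using ls by (intro mult_right_mono) auto
    show "\<eta> * (\<bar>\<sigma> x - \<sigma> y\<bar> + \<bar>\<tau> x - \<tau> y\<bar>) \<le> \<bar>ls\<bar> / 8 * (\<bar>\<sigma> x - \<sigma> y\<bar> + \<bar>\<tau> x - \<tau> y\<bar>)"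
      using \<eta> by (intro mult_right_mono) auto
  qed
qed

lemma continuous_F: "continuous_on S F"
proof -
  have cB: "continuous_on UNIV B"
    unfolding continuous_on_iff
  proof (intro ballI allI impI)
    fix x e :: real assume "0 < e"
    then show "\<exists>d>0. \<forall>x'\<in>UNIV. dist x' x < d \<longrightarrow> dist (B x') (B x) < e"
      using le_less_trans[OF B_lip] by (intro exI[of _ e] conjI ballI impI) (simp_all add: dist_real_def)
  qed
  have "continuous_on S (\<lambda>x. \<sigma> (F x))"
    unfolding F\<sigma>
    by (intro continuous_intros continuous_on_compose2[OF cB] continuous_\<sigma> continuous_\<tau>
        lipschitz_in_coords_continuous[OF \<alpha>(2)] subset_UNIV)
  moreover have "continuous_on S (\<lambda>x. \<tau> (F x))"
    unfolding F\<tau> by (intro continuous_intros continuous_\<tau> lipschitz_in_coords_continuous[OF \<gamma>(2)])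
  ultimately have "continuous_on S (\<lambda>x. \<sigma> (F x) *\<^sub>R es + \<tau> (F x) *\<^sub>R eu)"
    by (intro continuous_intros)
  then show ?thesis by (simp add: coords)
qed

lemma F_expands_distances:
  obtains c where "c > 0" "\<And>x y. dist x y \<le> c * dist (F x) (F y)"
proof -
  obtain K where K: "K > 0" "\<And>x. \<bar>\<sigma> x\<bar> \<le> norm x * K" "\<And>x. \<bar>\<tau> x\<bar> \<le> norm x * K"
  proof -
    obtain K1 where "K1 > 0" "\<And>x. norm (\<sigma> x) \<le> norm x * K1"
      using bounded_linear.pos_bounded[of \<sigma>] lin(1) by (auto simp: linear_conv_bounded_linear)
    moreover obtain K2 where "K2 > 0" "\<And>x. norm (\<tau> x) \<le> norm x * K2"
      using bounded_linear.pos_bounded[of \<tau>] lin(2) by (auto simp: linear_conv_bounded_linear)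
    moreover have "norm x * K1 \<le> norm x * (K1 + K2)" "norm x * K2 \<le> norm x * (K1 + K2)" for x :: "real^2"
      using \<open>K1 > 0\<close> \<open>K2 > 0\<close> by (auto intro!: mult_left_mono)
    moreover have "K1 + K2 > 0" using \<open>K1 > 0\<close> \<open>K2 > 0\<close> by simp
    ultimately show thesis
      unfolding real_norm_def by (intro that[of "K1 + K2"]; meson order_trans)
  qed
  let ?E = "norm es + norm eu"
  have "dist x y \<le> (?E * (4 / \<bar>ls\<bar>) * (2 * K) + 1) * dist (F x) (F y)" for x y
  proof -
    have n: "\<bar>ls\<bar> / 4 * (\<bar>\<sigma> x - \<sigma> y\<bar> + \<bar>\<tau> x - \<tau> y\<bar>) \<le> 2 * K * dist (F x) (F y)"
      using F_lower[of x y] K(2)[of "F x - F y"] K(3)[of "F x - F y"]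
      by (simp add: \<sigma>_diff \<tau>_diff dist_norm mult.commute)
    then have n': "\<bar>\<sigma> x - \<sigma> y\<bar> + \<bar>\<tau> x - \<tau> y\<bar> \<le> 4 / \<bar>ls\<bar> * (2 * K * dist (F x) (F y))"
      using ls(1) by (simp add: field_simps)
    have "dist x y \<le> ?E * (\<bar>\<sigma> x - \<sigma> y\<bar> + \<bar>\<tau> x - \<tau> y\<bar>)"
      using coords_norm[of "x - y"] by (simp add: dist_norm \<sigma>_diff \<tau>_diff)
    also have "\<dots> \<le> ?E * (4 / \<bar>ls\<bar> * (2 * K * dist (F x) (F y)))"
      using n' by (intro mult_left_mono) auto
    also have "\<dots> = (?E * (4 / \<bar>ls\<bar>) * (2 * K)) * dist (F x) (F y)" by simp
    also have "\<dots> \<le> (?E * (4 / \<bar>ls\<bar>) * (2 * K) + 1) * dist (F x) (F y)"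
      by (intro mult_right_mono) auto
    finally show ?thesis .
  qed
  moreover have "?E * (4 / \<bar>ls\<bar>) * (2 * K) + 1 > 0"
    using K(1) by (intro add_nonneg_pos mult_nonneg_nonneg) auto
  ultimately show thesis by (intro that)
qed

lemma inj_F: "inj F"
proof (rule injI)
  fix x y assume "F x = F y"
  obtain c where "\<And>x y. dist x y \<le> c * dist (F x) (F y)" by (rule F_expands_distances) (rule that)
  from this[of x y] show "x = y" using \<open>F x = F y\<close> by simp
qed

text \<open>
  The range is open by invariance of domain, and closed because \<open>F\<close> shrinks distances at most by a
  constant factor.
\<close>

lemma surj_F: "surj F"
proof -
  obtain c where c: "c > 0" "\<And>x y. dist x y \<le> c * dist (F x) (F y)" by (rule F_expands_distances) (rule that)
  have "open (range F)"
    by (rule invariance_of_domain[OF continuous_F open_UNIV inj_F])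
  moreover have "closed (range F)"
    unfolding closed_sequential_limits
  proof (intro allI impI, elim conjE)
    fix X l assume X: "\<forall>n. X n \<in> range F" "X \<longlonglongrightarrow> l"
    define Y where "Y n = inv F (X n)" for n
    have FY: "F (Y n) = X n" for n using X(1) by (simp add: Y_def f_inv_into_f)
    have "Cauchy X" using X(2) by (rule LIMSEQ_imp_Cauchy)
    have "Cauchy Y"
    proof (rule metric_CauchyI)
      fix e :: real assume "e > 0"
      then have "e / c > 0" using c(1) by simp
      then obtain M where M: "\<forall>m\<ge>M. \<forall>n\<ge>M. dist (X m) (X n) < e / c"
        using metric_CauchyD[OF \<open>Cauchy X\<close>] by meson
      have "dist (Y m) (Y n) < e" if "m \<ge> M" "n \<ge> M" for m n
      proof -
        have "dist (Y m) (Y n) \<le> c * dist (X m) (X n)" using c(2)[of "Y m" "Y n"] by (simp add: FY)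
        also have "\<dots> < c * (e / c)" using M that c(1) by (intro mult_strict_left_mono) auto
        finally show ?thesis using c(1) by simp
      qed
      then show "\<exists>M. \<forall>m\<ge>M. \<forall>n\<ge>M. dist (Y m) (Y n) < e" by (intro exI[of _ M] allI impI)
    qed
    then obtain y where y: "Y \<longlonglongrightarrow> y" using Cauchy_convergent[of Y] unfolding convergent_def by blast
    have "isCont F y" using continuous_F[of UNIV] by (simp add: continuous_on_eq_continuous_at)
    then have "(\<lambda>n. F (Y n)) \<longlonglongrightarrow> F y" using y by (rule isCont_tendsto_compose)
    then have "l = F y" using LIMSEQ_unique[OF X(2)] by (simp add: FY)
    then show "l \<in> range F" by simp
  qed
  ultimately have "closed (range F) \<and> open (range F)" by simp
  then show ?thesis unfolding clopen by simp
qed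

lemma F_inv [simp]: "F (inv F x) = x" "inv F (F x) = x"
  using surj_F inj_F by (simp_all add: surj_f_inv_f)

lemma continuous_inv_F: "continuous_on S (inv F)"
proof -
  obtain c where c: "c > 0" "\<And>x y. dist x y \<le> c * dist (F x) (F y)" by (rule F_expands_distances) (rule that)
  show ?thesis unfolding continuous_on_iff
  proof (intro ballI allI impI)
    fix x and e :: real assume "x \<in> S" "0 < e"
    show "\<exists>d>0. \<forall>x'\<in>S. dist x' x < d \<longrightarrow> dist (inv F x') (inv F x) < e"
    proof (intro exI[of _ "e / c"] conjI ballI impI)
      show "e / c > 0" using \<open>0 < e\<close> c(1) by simp
      fix x' assume "dist x' x < e / c"
      then have "c * dist x' x < e" using c(1) by (simp add: field_simps)
      then show "dist (inv F x') (inv F x) < e" using c(2)[of "inv F x'" "inv F x"] by simp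
    qed
  qed
qed

text \<open>
  The cone of displacements that are more unstable than stable is invariant, and the unstable component
  grows in it. The stable component may grow by a factor \<open>\<bar>ls\<bar> + 1\<close> under the bump, but the unstable
  one grows faster.
\<close>

lemma cone_step:
  assumes "\<bar>\<sigma> x - \<sigma> y\<bar> \<le> \<bar>\<tau> x - \<tau> y\<bar>"
  shows "\<bar>\<sigma> (F x) - \<sigma> (F y)\<bar> \<le> \<bar>\<tau> (F x) - \<tau> (F y)\<bar>"
    and "(\<bar>lu\<bar> - 2 * \<eta>) * \<bar>\<tau> x - \<tau> y\<bar> \<le> \<bar>\<tau> (F x) - \<tau> (F y)\<bar>"
proof -
  have *: "S \<le> T \<and> (u - 2 * e) * q \<le> T"
    if p: "p \<le> q" "0 \<le> p" and S: "S \<le> (l + 1) * p + b * q + e * (p + q)"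
      and T: "u * q - e * (p + q) \<le> T" and c: "l + 1 + b + 4 * e \<le> u" "0 < e" "0 \<le> l"
    for p q l b e u S T :: real
  proof -
    have "(l + 1) * p \<le> (l + 1) * q" using p c by (intro mult_left_mono) auto
    moreover have "e * (p + q) \<le> e * (2 * q)" using p c by (intro mult_left_mono) auto
    moreover have "(l + 1 + b + 4 * e) * q \<le> u * q" using p c by (intro mult_right_mono) auto
    moreover have "(l + 1 + b + 4 * e) * q = (l + 1) * q + b * q + 4 * (e * q)"
      "e * (2 * q) = 2 * (e * q)" "(u - 2 * e) * q = u * q - 2 * (e * q)"
      by (simp_all add: algebra_simps)
    ultimately show ?thesis using S T by linarith
  qed
  from *[OF assms abs_ge_zero F\<sigma>_diff_le F\<tau>_diff_ge \<eta>(3,1) abs_ge_zero]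
  show "\<bar>\<sigma> (F x) - \<sigma> (F y)\<bar> \<le> \<bar>\<tau> (F x) - \<tau> (F y)\<bar>"
    "(\<bar>lu\<bar> - 2 * \<eta>) * \<bar>\<tau> x - \<tau> y\<bar> \<le> \<bar>\<tau> (F x) - \<tau> (F y)\<bar>" by simp_all
qed

lemma expansion_gt_1: "1 < \<bar>lu\<bar> - 2 * \<eta>"
  using lu \<eta>(2) ls(2) by linarith

lemma cone_iterates:
  assumes "\<bar>\<sigma> x - \<sigma> y\<bar> \<le> \<bar>\<tau> x - \<tau> y\<bar>"
  shows "\<bar>\<sigma> ((F ^^ n) x) - \<sigma> ((F ^^ n) y)\<bar> \<le> \<bar>\<tau> ((F ^^ n) x) - \<tau> ((F ^^ n) y)\<bar> \<and>
    (\<bar>lu\<bar> - 2 * \<eta>) ^ n * \<bar>\<tau> x - \<tau> y\<bar> \<le> \<bar>\<tau> ((F ^^ n) x) - \<tau> ((F ^^ n) y)\<bar>"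
proof (induction n)
  case (Suc n)
  have "(\<bar>lu\<bar> - 2 * \<eta>) * ((\<bar>lu\<bar> - 2 * \<eta>) ^ n * \<bar>\<tau> x - \<tau> y\<bar>)
      \<le> (\<bar>lu\<bar> - 2 * \<eta>) * \<bar>\<tau> ((F ^^ n) x) - \<tau> ((F ^^ n) y)\<bar>"
    using Suc expansion_gt_1 by (intro mult_left_mono) auto
  also have "\<dots> \<le> \<bar>\<tau> (F ((F ^^ n) x)) - \<tau> (F ((F ^^ n) y))\<bar>"
    by (rule cone_step(2)[OF conjunct1[OF Suc]])
  finally show ?case using cone_step(1)[OF conjunct1[OF Suc]] by (simp add: mult.assoc)
qed (use assms in simp)

section \<open>The invariant leaf over the stable axis\<close>

text \<open>
  The limit of \<open>\<tau> (F\<^sup>n x) / lu\<^sup>n\<close>, written as a telescoping series: an unstable coordinate that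
  \<open>F\<close> multiplies by exactly \<open>lu\<close>. Its zero set consists of the points whose unstable coordinate stays
  bounded in the future.
\<close>

definition T :: "real^2 \<Rightarrow> real" where
  "T x = \<tau> x + (\<Sum>n. \<gamma> ((F ^^ n) x) / lu ^ Suc n)"

lemma T_term_bound: "norm (\<gamma> ((F ^^ n) x) / lu ^ Suc n) \<le> \<eta> * (1/2) ^ Suc n"
proof -
  have "(2::real) ^ Suc n \<le> \<bar>lu\<bar> ^ Suc n" using lu by (intro power_mono) auto
  then have "\<bar>\<gamma> ((F ^^ n) x)\<bar> / \<bar>lu\<bar> ^ Suc n \<le> \<eta> / 2 ^ Suc n"
    using \<gamma>(1) \<eta>(1) by (intro frac_le) auto
  then show ?thesis by (simp add: power_abs abs_mult power_one_over field_simps)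
qed

lemma T_majorant: "(\<lambda>n. \<eta> * (1/2) ^ Suc n) sums \<eta>"
  using sums_mult[OF power_half_series, of \<eta>] by simp

lemma T_summable: "summable (\<lambda>n. \<gamma> ((F ^^ n) x) / lu ^ Suc n)"
  by (rule summable_comparison_test'[OF sums_summable[OF T_majorant] T_term_bound])

lemma T_near_\<tau>: "\<bar>T x - \<tau> x\<bar> \<le> \<eta>"
proof -
  have "norm (\<Sum>n. \<gamma> ((F ^^ n) x) / lu ^ Suc n) \<le> (\<Sum>n. \<eta> * (1/2) ^ Suc n)"
    by (rule norm_suminf_le[OF T_term_bound sums_summable[OF T_majorant]])
  also have "\<dots> = \<eta>" by (rule sums_unique[OF T_majorant, symmetric])
  finally show ?thesis by (simp add: T_def)
qed

lemma T_F: "T (F x) = lu * T x"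
proof -
  define f where "f n = \<gamma> ((F ^^ n) x) / lu ^ Suc n" for n
  have "lu \<noteq> 0" using lu by auto
  have sf: "summable f" unfolding f_def by (rule T_summable)
  then have sf': "summable (\<lambda>n. f (Suc n))" by (simp only: summable_Suc_iff)
  have "\<gamma> ((F ^^ n) (F x)) / lu ^ Suc n = lu * f (Suc n)" for n
    using \<open>lu \<noteq> 0\<close> by (simp add: f_def funpow_swap1)
  then have "(\<Sum>n. \<gamma> ((F ^^ n) (F x)) / lu ^ Suc n) = lu * (\<Sum>n. f (Suc n))"
    using suminf_mult[OF sf', of lu] by (simp only:)
  also have "(\<Sum>n. f (Suc n)) = suminf f - f 0" by (rule suminf_split_head[OF sf])
  finally have "T (F x) = lu * \<tau> x + \<gamma> x + lu * (suminf f - f 0)" by (simp add: T_def F\<tau>)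
  moreover have "lu * f 0 = \<gamma> x" using \<open>lu \<noteq> 0\<close> by (simp add: f_def)
  moreover have "T x = \<tau> x + suminf f"
  proof -
    have "f = (\<lambda>n. \<gamma> ((F ^^ n) x) / lu ^ Suc n)" by (rule ext) (rule f_def)
    then show ?thesis by (simp only: T_def)
  qed
  ultimately show ?thesis by (simp add: algebra_simps)
qed

lemma T_funpow: "T ((F ^^ n) x) = lu ^ n * T x"
  by (induction n) (simp_all add: T_F mult.assoc)

lemma continuous_T: "continuous_on UNIV T"
proof -
  have cn: "continuous_on UNIV (F ^^ n)" for n
  proof (induction n)
    case (Suc n)
    show ?case using continuous_on_compose2[OF continuous_F Suc.IH, of UNIV] by (simp add: o_def)
  qed (simp add: id_def)
  have "continuous_on UNIV (\<lambda>x. \<Sum>n. \<gamma> ((F ^^ n) x) / lu ^ Suc n)"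
  proof (rule uniform_limit_theorem)
    show "uniform_limit UNIV (\<lambda>n x. \<Sum>i<n. \<gamma> ((F ^^ i) x) / lu ^ Suc i)
        (\<lambda>x. \<Sum>i. \<gamma> ((F ^^ i) x) / lu ^ Suc i) sequentially"
      by (rule Weierstrass_m_test[OF T_term_bound sums_summable[OF T_majorant]])
    have "continuous_on UNIV (\<lambda>x. \<gamma> ((F ^^ i) x))" for i
      by (rule continuous_on_compose2[OF lipschitz_in_coords_continuous[OF \<gamma>(2), of UNIV] cn]) simp
    then show "\<forall>\<^sub>F n in sequentially. continuous_on UNIV (\<lambda>x. \<Sum>i<n. \<gamma> ((F ^^ i) x) / lu ^ Suc i)"
      using lu by (intro always_eventually allI continuous_on_sum continuous_on_divide continuous_on_const) auto
  qed simp
  from continuous_on_add[OF continuous_\<tau> this] show ?thesis by (simp only: T_def[abs_def])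
qed

text \<open>
  A displacement in the unstable cone grows exponentially, whereas \<open>T\<close>, and hence up to \<open>2 * \<eta>\<close> also
  \<open>\<tau>\<close>, agrees along the two orbits.
\<close>

lemma T_separates_cone:
  assumes T: "T x = T y" and c: "\<bar>\<sigma> x - \<sigma> y\<bar> \<le> \<bar>\<tau> x - \<tau> y\<bar>"
  shows "x = y"
proof -
  have bd: "(\<bar>lu\<bar> - 2 * \<eta>) ^ n * \<bar>\<tau> x - \<tau> y\<bar> \<le> 2 * \<eta>" for n
  proof -
    have "T ((F ^^ n) x) = T ((F ^^ n) y)" by (simp only: T_funpow T)
    then have "\<bar>\<tau> ((F ^^ n) x) - \<tau> ((F ^^ n) y)\<bar> \<le> 2 * \<eta>"
      using T_near_\<tau>[of "(F ^^ n) x"] T_near_\<tau>[of "(F ^^ n) y"] by linarith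
    then show ?thesis using cone_iterates[OF c, of n] by linarith
  qed
  have "\<tau> x = \<tau> y"
  proof (rule ccontr)
    assume "\<tau> x \<noteq> \<tau> y"
    then have pos: "\<bar>\<tau> x - \<tau> y\<bar> > 0" by simp
    obtain n where "2 * \<eta> / \<bar>\<tau> x - \<tau> y\<bar> < (\<bar>lu\<bar> - 2 * \<eta>) ^ n"
      using real_arch_pow[OF expansion_gt_1] by blast
    then have "2 * \<eta> < (\<bar>lu\<bar> - 2 * \<eta>) ^ n * \<bar>\<tau> x - \<tau> y\<bar>" using pos by (simp add: pos_divide_less_eq)
    then show False using bd[of n] by linarith
  qed
  moreover from this c have "\<sigma> x = \<sigma> y" by simp
  ultimately show ?thesis by (intro coords_eqI)
qed

text \<open>
  The zero set of \<open>T\<close> as a graph over the stable axis; the height is unique by \<open>T_separates_cone\<close>.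
\<close>

definition leaf :: "real \<Rightarrow> real^2" where
  "leaf s = s *\<^sub>R es + (SOME u. T (s *\<^sub>R es + u *\<^sub>R eu) = 0) *\<^sub>R eu"

lemma T_leaf: "T (leaf s) = 0"
proof -
  let ?f = "\<lambda>u. T (s *\<^sub>R es + u *\<^sub>R eu)"
  have "\<bar>?f u - u\<bar> \<le> \<eta>" for u using T_near_\<tau>[of "s *\<^sub>R es + u *\<^sub>R eu"] by (simp add: coords)
  from this[of \<eta>] this[of "- \<eta>"] have e: "?f (- \<eta>) \<le> 0" "0 \<le> ?f \<eta>" by linarith+
  have "continuous_on {- \<eta>..\<eta>} ?f"
    by (intro continuous_on_compose2[OF continuous_T] continuous_intros subset_UNIV)
  then obtain u where "?f u = 0" using IVT'[of ?f "- \<eta>" 0 \<eta>] e \<eta>(1) by auto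
  then have "?f (SOME u. ?f u = 0) = 0" by (rule someI[of "\<lambda>u. ?f u = 0"])
  then show ?thesis by (simp only: leaf_def)
qed

lemma \<sigma>_leaf [simp]: "\<sigma> (leaf s) = s"
  by (simp add: leaf_def coords)

lemma \<tau>_leaf_bound: "\<bar>\<tau> (leaf s)\<bar> \<le> \<eta>"
  using T_near_\<tau>[of "leaf s"] by (simp add: T_leaf)

lemma leaf_unique: "T x = 0 \<Longrightarrow> leaf (\<sigma> x) = x"
  by (rule T_separates_cone) (simp_all add: T_leaf)

lemma leaf_lipschitz: "\<bar>\<tau> (leaf s) - \<tau> (leaf t)\<bar> \<le> \<bar>s - t\<bar>"
proof (rule ccontr)
  assume n: "\<not> ?thesis"
  then have "leaf s = leaf t" by (intro T_separates_cone) (simp_all add: T_leaf)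
  then show False using n by simp
qed

lemma dist_leaf_le: "dist (leaf s) (leaf t) \<le> (norm es + norm eu) * 2 * \<bar>s - t\<bar>"
proof -
  have "dist (leaf s) (leaf t) \<le> (norm es + norm eu) * (\<bar>s - t\<bar> + \<bar>\<tau> (leaf s) - \<tau> (leaf t)\<bar>)"
    using coords_norm[of "leaf s - leaf t"] by (simp add: dist_norm \<sigma>_diff \<tau>_diff)
  also have "\<dots> \<le> (norm es + norm eu) * (\<bar>s - t\<bar> + \<bar>s - t\<bar>)"
    by (intro mult_left_mono add_left_mono leaf_lipschitz) auto
  finally show ?thesis by (simp only: mult_2[symmetric] mult.assoc)
qed

definition \<psi> :: "real \<Rightarrow> real" where "\<psi> s = \<sigma> (F (leaf s))"

lemma F_leaf: "F (leaf s) = leaf (\<psi> s)"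
  unfolding \<psi>_def by (rule leaf_unique[symmetric]) (simp add: T_F T_leaf)

lemma surj_\<psi>: "surj \<psi>"
proof (rule surjI)
  fix s
  let ?x = "inv F (leaf s)"
  have "lu * T ?x = 0" using T_F[of ?x] by (simp add: T_leaf)
  then have "T ?x = 0" using lu by auto
  then show "\<psi> (\<sigma> (inv F (leaf s))) = s" by (simp add: \<psi>_def leaf_unique)
qed

text \<open>
  Since the leaf is 1-Lipschitz and \<open>\<bar>\<beta>\<bar> \<le> 1/2\<close>, the argument of the bump increases along the leaf.
\<close>

lemma sgn_\<psi>_strict_mono:
  assumes "t < s"
  shows "sgn ls * \<psi> t < sgn ls * \<psi> s"
proof -
  let ?d = "s - t" and ?e = "\<tau> (leaf s) - \<tau> (leaf t)"
  have e: "\<bar>?e\<bar> \<le> ?d" using leaf_lipschitz[of s t] assms by simp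
  have b: "\<bar>\<beta> * ?e\<bar> \<le> 1/2 * ?d"
    unfolding abs_mult using \<beta> e by (intro mult_mono) auto
  have *: "0 \<le> d + c" if "\<bar>c\<bar> \<le> 1/2 * d" for c d :: real using that by linarith
  have "0 \<le> \<sigma> (leaf s) - \<sigma> (leaf t) + \<beta> * ?e" unfolding \<sigma>_leaf by (rule *[OF b])
  from sgn_F\<sigma>_diff[OF this]
  have "sgn ls * (\<psi> s - \<psi> t) \<ge> \<bar>ls\<bar> / 2 * ?d - \<bar>ls\<bar> / 2 * (\<beta> * ?e) - \<eta> * (\<bar>?d\<bar> + \<bar>?e\<bar>)"
    by (simp only: \<psi>_def \<sigma>_leaf)
  moreover have "\<bar>ls\<bar> / 2 * (\<beta> * ?e) \<le> \<bar>ls\<bar> / 2 * (1/2 * ?d)"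
    using b by (intro mult_left_mono) auto
  moreover have "\<eta> * (\<bar>?d\<bar> + \<bar>?e\<bar>) \<le> \<eta> * (2 * ?d)"
    using e assms \<eta>(1) by (intro mult_left_mono) auto
  moreover have "\<eta> * (2 * ?d) < \<bar>ls\<bar> / 8 * (2 * ?d)"
    using assms \<eta>(2) by (intro mult_strict_right_mono) auto
  moreover have "\<bar>ls\<bar> / 8 * (2 * ?d) = \<bar>ls\<bar> / 2 * ?d - \<bar>ls\<bar> / 2 * (1/2 * ?d)" by simp
  ultimately have "0 < sgn ls * (\<psi> s - \<psi> t)" by linarith
  then show ?thesis by (simp add: right_diff_distrib)
qed

lemma sgn_\<psi>_near: "\<bar>sgn ls * \<psi> s - (\<bar>ls\<bar> * s + B s)\<bar> \<le> 2 * \<eta>"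
proof -
  let ?t = "\<beta> * \<tau> (leaf s)"
  have "sgn ls * \<psi> s = (sgn ls * sgn ls) * (\<bar>ls\<bar> * s + B (s + ?t)) + sgn ls * \<alpha> (leaf s)"
    unfolding \<psi>_def F\<sigma>' \<sigma>_leaf by (simp only: distrib_left mult.assoc)
  then have "sgn ls * \<psi> s = \<bar>ls\<bar> * s + B (s + ?t) + sgn ls * \<alpha> (leaf s)"
    by (simp only: ls_sgn(3) mult_1)
  moreover have "\<bar>sgn ls * \<alpha> (leaf s)\<bar> \<le> \<eta>" unfolding abs_sgn_ls_mult by (rule \<alpha>(1))
  moreover have "\<bar>B (s + ?t) - B s\<bar> \<le> \<bar>?t\<bar>" using B_lip[of "s + ?t" s] by simp
  moreover have "\<bar>?t\<bar> \<le> 1 * \<eta>" unfolding abs_mult using \<beta> \<tau>_leaf_bound by (intro mult_mono) auto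
  ultimately show ?thesis by linarith
qed

text \<open>
  For negative \<open>ls\<close> the map \<open>\<psi>\<close> reverses the orientation of the leaf, so its square is used. The map
  \<open>sgn ls * \<psi>\<close> pushes \<open>a\<close> and \<open>- a\<close> outwards and \<open>b\<close> and \<open>- b\<close> inwards, whence the square of \<open>\<psi>\<close> does so
  for both signs.
\<close>

lemma \<psi>_twice_properties:
  shows "strict_mono (\<psi> \<circ> \<psi>)" "surj (\<psi> \<circ> \<psi>)" "a < (\<psi> \<circ> \<psi>) a" "(\<psi> \<circ> \<psi>) (- a) < - a" "(\<psi> \<circ> \<psi>) b < b"
proof -
  define \<xi> where "\<xi> s = sgn ls * \<psi> s" for s
  have \<xi>: "\<xi> t < \<xi> s" if "t < s" for s t unfolding \<xi>_def by (rule sgn_\<psi>_strict_mono[OF that])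
  have \<psi>\<xi>: "\<psi> s = sgn ls * \<xi> s" for s using ls_sgn(3) by (simp add: \<xi>_def flip: mult.assoc)
  have near: "\<bar>\<xi> s - (\<bar>ls\<bar> * s + B s)\<bar> \<le> 2 * \<eta>" for s unfolding \<xi>_def by (rule sgn_\<psi>_near)
  have c1: "a < \<xi> a" "\<xi> b < b" using near[of a] near[of b] ab by linarith+
  have c2: "\<xi> (- a) < - a" "- b < \<xi> (- b)"
    using near[of "- a"] near[of "- b"] ab by (simp_all add: B_odd)
  have "sgn ls = 1 \<or> sgn ls = - 1" using ls by (auto simp: sgn_if)
  then consider "\<And>s. (\<psi> \<circ> \<psi>) s = \<xi> (\<xi> s)" | "\<And>s. (\<psi> \<circ> \<psi>) s = - \<xi> (- \<xi> s)"
    by (metis \<psi>\<xi> comp_apply mult_1 mult_minus1)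
  then have "(\<forall>s t. t < s \<longrightarrow> (\<psi> \<circ> \<psi>) t < (\<psi> \<circ> \<psi>) s) \<and> a < (\<psi> \<circ> \<psi>) a \<and> (\<psi> \<circ> \<psi>) (- a) < - a \<and> (\<psi> \<circ> \<psi>) b < b"
  proof cases
    case 1
    have "\<xi> a < \<xi> (\<xi> a)" "\<xi> (\<xi> (- a)) < \<xi> (- a)" "\<xi> (\<xi> b) < \<xi> b" by (intro \<xi> c1 c2)+
    then have "a < \<xi> (\<xi> a)" "\<xi> (\<xi> (- a)) < - a" "\<xi> (\<xi> b) < b" using c1 c2 by linarith+
    moreover have "\<xi> (\<xi> t) < \<xi> (\<xi> s)" if "t < s" for s t by (intro \<xi> that)
    ultimately show ?thesis unfolding 1 by blast
  next
    case 2
    have "\<xi> (- \<xi> a) < \<xi> (- a)" "\<xi> a < \<xi> (- \<xi> (- a))" "\<xi> (- b) < \<xi> (- \<xi> b)"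
      using c1 c2 by (auto intro!: \<xi>)
    then have "a < - \<xi> (- \<xi> a)" "- \<xi> (- \<xi> (- a)) < - a" "- \<xi> (- \<xi> b) < b" using c1 c2 by linarith+
    moreover have "- \<xi> (- \<xi> t) < - \<xi> (- \<xi> s)" if "t < s" for s t using \<xi>[OF that] by (simp add: \<xi>)
    ultimately show ?thesis unfolding 2 by blast
  qed
  then show "strict_mono (\<psi> \<circ> \<psi>)" "a < (\<psi> \<circ> \<psi>) a" "(\<psi> \<circ> \<psi>) (- a) < - a" "(\<psi> \<circ> \<psi>) b < b"
    by (auto intro: strict_monoI)
  show "surj (\<psi> \<circ> \<psi>)" by (intro comp_surj surj_\<psi>)
qed

text \<open>
  The arc of the leaf on which the square of \<open>\<psi>\<close> fails to be expansive is mapped by \<open>h\<close> to points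
  whose orbits under the square of \<open>g\<close> stay close in both time directions.
\<close>

lemma semiconjugacy_collapses_arc:
  assumes lift: "\<And>x. torus_proj (F x) = f (torus_proj x)"
    and g: "anosov_local_diffeo g"
    and h: "continuous_on UNIV h" "\<And>p. h (f p) = g (h p)"
  obtains t where "a < t" "\<And>s. s \<in> {a..t} \<Longrightarrow> h (torus_proj (leaf s)) = h (torus_proj (leaf a))"
proof -
  obtain \<delta> where \<delta>: "\<delta> > 0"
    "\<forall>R. (\<forall>(p, q)\<in>R. dist p q < \<delta> \<and> ((g ^^ 2) p, (g ^^ 2) q) \<in> R \<and>
      (\<exists>(p', q')\<in>R. (g ^^ 2) p' = p \<and> (g ^^ 2) q' = q)) \<longrightarrow> (\<forall>(p, q)\<in>R. p = q)"
    using anosov_expansive[where k = 2, OF g zero_less_numeral] by (elim exE conjE) (rule that)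
  obtain d where d: "d > 0" "\<And>p q. dist p q < d \<Longrightarrow> dist (h p) (h q) < \<delta>"
    using compact_uniformly_continuous[OF h(1) compact_torus] \<delta>(1)
    unfolding uniformly_continuous_on_def by (metis UNIV_I dist_commute)
  let ?M = "(norm es + norm eu) * 2 + 1"
  have M: "?M > 0" by (intro add_nonneg_pos) auto
  then have dM: "d / ?M > 0" using d(1) by simp
  note \<Psi> = \<psi>_twice_properties
  have "- a < a" using ab by simp
  obtain t S where tS: "a < t" "\<And>x y. x \<in> {a..t} \<Longrightarrow> y \<in> {a..t} \<Longrightarrow> (x, y) \<in> S"
    "\<And>x y. (x, y) \<in> S \<Longrightarrow> \<bar>x - y\<bar> < d / ?M"
    "\<And>x y. (x, y) \<in> S \<Longrightarrow> ((\<psi> \<circ> \<psi>) x, (\<psi> \<circ> \<psi>) y) \<in> S"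
    "\<And>x y. (x, y) \<in> S \<Longrightarrow> \<exists>x' y'. (x', y') \<in> S \<and> (\<psi> \<circ> \<psi>) x' = x \<and> (\<psi> \<circ> \<psi>) y' = y"
    by (rule increasing_map_not_expansive[OF \<Psi>(1,2) \<open>- a < a\<close> \<Psi>(4,3) ab(2) \<Psi>(5) dM]) (rule that)
  define k where "k s = h (torus_proj (leaf s))" for s
  have gk: "(g ^^ 2) (k s) = k ((\<psi> \<circ> \<psi>) s)" for s
    by (simp add: k_def numeral_2_eq_2 F_leaf flip: h(2) lift)
  define R where "R = {(k x, k y) | x y. (x, y) \<in> S}"
  show thesis
  proof (rule that[OF tS(1)])
    fix s assume s: "s \<in> {a..t}"
    have "\<forall>(p, q)\<in>R. dist p q < \<delta> \<and> ((g ^^ 2) p, (g ^^ 2) q) \<in> R \<and>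
      (\<exists>(p', q')\<in>R. (g ^^ 2) p' = p \<and> (g ^^ 2) q' = q)"
    proof (intro ballI, clarify, intro conjI)
      fix p q assume pq: "(p, q) \<in> R"
      from pq obtain x y where xy: "(x, y) \<in> S" "p = k x" "q = k y" unfolding R_def by blast
      have "dist (torus_proj (leaf x)) (torus_proj (leaf y)) \<le> dist (leaf x) (leaf y)"
        by (rule dist_torus_proj_le)
      also have "\<dots> \<le> (norm es + norm eu) * 2 * \<bar>x - y\<bar>" by (rule dist_leaf_le)
      also have "\<dots> \<le> ?M * \<bar>x - y\<bar>" by (intro mult_right_mono) auto
      also have "\<dots> < ?M * (d / ?M)" using tS(3)[OF xy(1)] M by (intro mult_strict_left_mono)
      finally have "dist (torus_proj (leaf x)) (torus_proj (leaf y)) < d" using M by simp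
      then show "dist p q < \<delta>" using d(2) by (simp add: xy k_def)
      show "((g ^^ 2) p, (g ^^ 2) q) \<in> R"
        unfolding xy gk R_def using tS(4)[OF xy(1)] by blast
      obtain x' y' where x': "(x', y') \<in> S" "(\<psi> \<circ> \<psi>) x' = x" "(\<psi> \<circ> \<psi>) y' = y" using tS(5)[OF xy(1)] by blast
      have "(k x', k y') \<in> R" using x'(1) unfolding R_def by blast
      moreover have "(g ^^ 2) (k x') = p" "(g ^^ 2) (k y') = q" unfolding gk x' xy by simp_all
      ultimately show "\<exists>(p', q')\<in>R. (g ^^ 2) p' = p \<and> (g ^^ 2) q' = q" by blast
    qed
    then have eq: "\<forall>(p, q)\<in>R. p = q" using \<delta>(2) by (elim allE impE)
    have "(s, a) \<in> S" by (rule tS(2)[OF s]) (use tS(1) in simp)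
    then have "(k s, k a) \<in> R" unfolding R_def by blast
    from bspec[OF eq this] have "k s = k a" by simp
    then show "h (torus_proj (leaf s)) = h (torus_proj (leaf a))" by (simp only: k_def)
  qed
qed

section \<open>Semiconjugacies collapse no connected sets\<close>

definition bump_coord :: "real^2 \<Rightarrow> real" where "bump_coord x = \<sigma> x + \<beta> * \<tau> x"

text \<open>
  Bounds in which the bump counts only through its size, not through its slope. They serve for pairs of
  points that are not yet known to be close.
\<close>

lemma F_coarse_gap_bounds:
  assumes B: "\<And>s. \<bar>B s\<bar> \<le> bmax"
  shows "\<bar>\<sigma> (F x) - \<sigma> (F y)\<bar> \<le> \<bar>ls\<bar> * \<bar>\<sigma> x - \<sigma> y\<bar> + 2 * (bmax + \<eta>)"
    and "\<bar>lu\<bar> * \<bar>\<tau> x - \<tau> y\<bar> \<le> \<bar>\<tau> (F x) - \<tau> (F y)\<bar> + 2 * \<eta>"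
proof -
  have *: "\<bar>P + s + a1 - (P' + s' + a1')\<bar> \<le> c + 2 * (bmax + \<eta>)"
    if P: "\<bar>P - P'\<bar> = c" and "\<bar>s\<bar> \<le> bmax" "\<bar>s'\<bar> \<le> bmax" "\<bar>a1\<bar> \<le> \<eta>" "\<bar>a1'\<bar> \<le> \<eta>"
    for P P' s s' a1 a1' c :: real
  proof -
    have "\<bar>P - P'\<bar> \<le> c" using P by simp
    then show ?thesis using that(2-) unfolding abs_le_iff by argo
  qed
  have "\<bar>ls * \<sigma> x - ls * \<sigma> y\<bar> = \<bar>ls\<bar> * \<bar>\<sigma> x - \<sigma> y\<bar>" by (simp add: abs_mult flip: right_diff_distrib)
  then show "\<bar>\<sigma> (F x) - \<sigma> (F y)\<bar> \<le> \<bar>ls\<bar> * \<bar>\<sigma> x - \<sigma> y\<bar> + 2 * (bmax + \<eta>)"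
    unfolding F\<sigma> by (rule *) (unfold abs_sgn_ls_mult, (rule B \<alpha>(1))+)
  have *: "c \<le> \<bar>P + a1 - (P' + a1')\<bar> + 2 * \<eta>"
    if "\<bar>P - P'\<bar> = c" "\<bar>a1\<bar> \<le> \<eta>" "\<bar>a1'\<bar> \<le> \<eta>" for P P' a1 a1' c
    using that by linarith
  have "\<bar>lu * \<tau> x - lu * \<tau> y\<bar> = \<bar>lu\<bar> * \<bar>\<tau> x - \<tau> y\<bar>" by (simp add: abs_mult flip: right_diff_distrib)
  then show "\<bar>lu\<bar> * \<bar>\<tau> x - \<tau> y\<bar> \<le> \<bar>\<tau> (F x) - \<tau> (F y)\<bar> + 2 * \<eta>"
    unfolding F\<tau> by (rule *) (rule \<gamma>(1))+
qed

text \<open>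
  Let \<open>Ds\<close> and \<open>Du\<close> be the suprema of the stable and unstable gaps in \<open>P\<close>. Regarding a pair as the
  image of its preimage pair, the bump being bounded, shows that \<open>Ds\<close> is at most \<open>\<rho> / 4\<close>;
  regarding it as the preimage of its image bounds \<open>Du\<close> likewise. Now the pairs are so close that two
  related points lie together in the flat part of the bump whenever one of them lies well inside it.
  By \<open>good\<close> every pair is a translate of the image of such a pair, and there \<open>F\<close> contracts the stable
  gap by a factor of about \<open>(1 + \<bar>ls\<bar>) / 2\<close>. So the stable gaps are smaller than \<open>Ds\<close> by a factor
  below 1, unless \<open>Ds = 0\<close>.
\<close>

lemma invariant_pairs_trivial:
  fixes P :: "((real^2) \<times> (real^2)) set"
  assumes bd: "\<And>x y. (x, y) \<in> P \<Longrightarrow> \<bar>\<sigma> x - \<sigma> y\<bar> \<le> M" "\<And>x y. (x, y) \<in> P \<Longrightarrow> \<bar>\<tau> x - \<tau> y\<bar> \<le> M"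
    and fwd: "\<And>x y. (x, y) \<in> P \<Longrightarrow> (F x, F y) \<in> P"
    and bwd: "\<And>x y. (x, y) \<in> P \<Longrightarrow> (inv F x, inv F y) \<in> P"
    and good: "\<And>x y. (x, y) \<in> P \<Longrightarrow> \<exists>m. (inv F (x + m), inv F (y + m)) \<in> P \<and>
        (\<forall>k\<in>\<int>. \<rho> \<le> \<bar>bump_coord (inv F (x + m)) - k\<bar>)"
    and B: "\<And>s. \<bar>B s\<bar> \<le> bmax"
      "\<And>s t. (\<forall>k\<in>\<int>. \<rho> \<le> \<bar>s - k\<bar>) \<Longrightarrow> \<bar>s - t\<bar> \<le> \<rho> / 2 \<Longrightarrow> \<bar>B s - B t\<bar> \<le> (1 - \<bar>ls\<bar>) / 2 * \<bar>s - t\<bar>"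
    and small: "2 * (bmax + \<eta>) \<le> (1 - \<bar>ls\<bar>) * (\<rho> / 4)" "2 * \<eta> \<le> \<rho> / 4" "\<eta> < (1 - \<bar>ls\<bar>) / 8"
    and xy: "(x, y) \<in> P"
  shows "x = y"
proof -
  define Ds where "Ds = (SUP z\<in>P. \<bar>\<sigma> (fst z) - \<sigma> (snd z)\<bar>)"
  define Du where "Du = (SUP z\<in>P. \<bar>\<tau> (fst z) - \<tau> (snd z)\<bar>)"
  have ne: "P \<noteq> {}" using xy by blast
  have bs: "bdd_above ((\<lambda>z. \<bar>\<sigma> (fst z) - \<sigma> (snd z)\<bar>) ` P)"
  proof (rule bdd_aboveI2)
    fix z assume "z \<in> P"
    then show "\<bar>\<sigma> (fst z) - \<sigma> (snd z)\<bar> \<le> M" using bd(1)[of "fst z" "snd z"] by simp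
  qed
  have bu: "bdd_above ((\<lambda>z. \<bar>\<tau> (fst z) - \<tau> (snd z)\<bar>) ` P)"
  proof (rule bdd_aboveI2)
    fix z assume "z \<in> P"
    then show "\<bar>\<tau> (fst z) - \<tau> (snd z)\<bar> \<le> M" using bd(2)[of "fst z" "snd z"] by simp
  qed
  have leDs: "\<bar>\<sigma> x - \<sigma> y\<bar> \<le> Ds" if "(x, y) \<in> P" for x y
    unfolding Ds_def using cSUP_upper[OF that bs] by simp
  have leDu: "\<bar>\<tau> x - \<tau> y\<bar> \<le> Du" if "(x, y) \<in> P" for x y
    unfolding Du_def using cSUP_upper[OF that bu] by simp
  have Ds_least: "Ds \<le> c" if "\<And>x y. (x, y) \<in> P \<Longrightarrow> \<bar>\<sigma> x - \<sigma> y\<bar> \<le> c" for c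
    unfolding Ds_def
  proof (rule cSUP_least[OF ne])
    fix z assume "z \<in> P"
    then show "\<bar>\<sigma> (fst z) - \<sigma> (snd z)\<bar> \<le> c" using that[of "fst z" "snd z"] by simp
  qed
  have Du_least: "Du \<le> c" if "\<And>x y. (x, y) \<in> P \<Longrightarrow> \<bar>\<tau> x - \<tau> y\<bar> \<le> c" for c
    unfolding Du_def
  proof (rule cSUP_least[OF ne])
    fix z assume "z \<in> P"
    then show "\<bar>\<tau> (fst z) - \<tau> (snd z)\<bar> \<le> c" using that[of "fst z" "snd z"] by simp
  qed
  have Ds0: "0 \<le> Ds" by (rule order_trans[OF abs_ge_zero leDs[OF xy]])
  have Du0: "0 \<le> Du" by (rule order_trans[OF abs_ge_zero leDu[OF xy]])
  have lu2: "2 * \<bar>\<tau> x - \<tau> y\<bar> \<le> \<bar>lu\<bar> * \<bar>\<tau> x - \<tau> y\<bar>" for x y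
    using lu by (intro mult_right_mono) auto
  have "Ds \<le> \<bar>ls\<bar> * Ds + 2 * (bmax + \<eta>)"
  proof (rule Ds_least)
    fix x y assume "(x, y) \<in> P"
    from bwd[OF this] have "\<bar>ls\<bar> * \<bar>\<sigma> (inv F x) - \<sigma> (inv F y)\<bar> \<le> \<bar>ls\<bar> * Ds"
      by (intro mult_left_mono leDs) auto
    then show "\<bar>\<sigma> x - \<sigma> y\<bar> \<le> \<bar>ls\<bar> * Ds + 2 * (bmax + \<eta>)"
      using F_coarse_gap_bounds(1)[OF B(1), of "inv F x" "inv F y"] unfolding F_inv by (rule order_trans[rotated, OF add_right_mono])
  qed
  then have "(1 - \<bar>ls\<bar>) * Ds \<le> (1 - \<bar>ls\<bar>) * (\<rho> / 4)" using small(1) by (simp add: algebra_simps)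
  then have Ds1: "Ds \<le> \<rho> / 4" using ls(2) by (simp only: mult_le_cancel_left_pos diff_gt_0_iff_gt)
  have Du1: "Du \<le> \<rho> / 4"
  proof -
    have "Du \<le> (Du + 2 * \<eta>) / 2"
    proof (rule Du_least)
      fix x y assume xy: "(x, y) \<in> P"
      have *: "t \<le> (D + e) / 2" if "u \<le> T + e" "T \<le> D" "2 * t \<le> u" for t u T D e :: real
        using that by argo
      show "\<bar>\<tau> x - \<tau> y\<bar> \<le> (Du + 2 * \<eta>) / 2"
        by (rule *[OF F_coarse_gap_bounds(2)[OF B(1), of x y] leDu[OF fwd[OF xy]] lu2[of x y]])
    qed
    then show ?thesis using small(2) by argo
  qed
  have e\<eta>: "\<eta> * (\<bar>\<sigma> x - \<sigma> y\<bar> + \<bar>\<tau> x - \<tau> y\<bar>) \<le> \<eta> * (Ds + Du)" if "(x, y) \<in> P" for x y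
    using leDs[OF that] leDu[OF that] \<eta>(1) by (intro mult_left_mono add_mono) auto
  \<comment> \<open>The same bounds again, now with the Lipschitz constants of the errors and, for the stable gap, with
    the slope of the bump on its flat part.\<close>
  have Du2: "Du \<le> (Du + \<eta> * (Ds + Du)) / 2"
  proof (rule Du_least)
    fix x y assume xy: "(x, y) \<in> P"
    have *: "t \<le> (D + e') / 2" if "u - e \<le> T" "T \<le> D" "2 * t \<le> u" "e \<le> e'" for t u T D e e' :: real
      using that by argo
    show "\<bar>\<tau> x - \<tau> y\<bar> \<le> (Du + \<eta> * (Ds + Du)) / 2"
      by (rule *[OF F\<tau>_diff_ge[of x y] leDu[OF fwd[OF xy]] lu2[of x y] e\<eta>[OF xy]])
  qed
  have Ds2: "Ds \<le> \<bar>ls\<bar> * Ds + (1 - \<bar>ls\<bar>) / 2 * (Ds + Du / 2) + \<eta> * (Ds + Du)"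
  proof (rule Ds_least)
    fix x y assume xy: "(x, y) \<in> P"
    obtain m where m: "(inv F (x + m), inv F (y + m)) \<in> P"
        "\<forall>k\<in>\<int>. \<rho> \<le> \<bar>bump_coord (inv F (x + m)) - k\<bar>" using good[OF xy] by blast
    define x' y' where "x' = inv F (x + m)" and "y' = inv F (y + m)"
    have P': "(x', y') \<in> P" using m(1) by (simp only: x'_def y'_def)
    have c: "\<bar>bump_coord x' - bump_coord y'\<bar> \<le> Ds + Du / 2"
    proof -
      have "\<bar>\<beta> * \<tau> x' - \<beta> * \<tau> y'\<bar> = \<bar>\<beta>\<bar> * \<bar>\<tau> x' - \<tau> y'\<bar>" by (simp add: abs_mult flip: right_diff_distrib)
      also have "\<dots> \<le> 1/2 * Du" using \<beta> leDu[OF P'] by (intro mult_mono) auto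
      finally have "\<bar>\<beta> * \<tau> x' - \<beta> * \<tau> y'\<bar> \<le> 1/2 * Du" .
      then show ?thesis using leDs[OF P'] unfolding bump_coord_def by linarith
    qed
    have "\<bar>B (bump_coord x') - B (bump_coord y')\<bar> \<le> (1 - \<bar>ls\<bar>) / 2 * \<bar>bump_coord x' - bump_coord y'\<bar>"
    proof (rule B(2))
      show "\<forall>k\<in>\<int>. \<rho> \<le> \<bar>bump_coord x' - k\<bar>" using m(2) by (simp only: x'_def)
      have "Ds + Du / 2 \<le> \<rho> / 2" using Ds1 Du1 small(2) \<eta>(1) by argo
      with c show "\<bar>bump_coord x' - bump_coord y'\<bar> \<le> \<rho> / 2" by (rule order_trans)
    qed
    also have "\<dots> \<le> (1 - \<bar>ls\<bar>) / 2 * (Ds + Du / 2)" using c ls(2) by (intro mult_left_mono) auto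
    finally have Bd: "\<bar>B (bump_coord x') - B (bump_coord y')\<bar> \<le> (1 - \<bar>ls\<bar>) / 2 * (Ds + Du / 2)" .
    have "\<bar>\<sigma> (F x') - \<sigma> (F y')\<bar> \<le> \<bar>ls\<bar> * Ds + (1 - \<bar>ls\<bar>) / 2 * (Ds + Du / 2) + \<eta> * (Ds + Du)"
    proof -
      have *: "\<bar>p + s + e1 - (p' + s' + e1')\<bar> \<le> A1 + A2 + A3"
        if "\<bar>p - p'\<bar> \<le> A1" "\<bar>s - s'\<bar> \<le> A2" "\<bar>e1 - e1'\<bar> \<le> A3" for p p' s s' e1 e1' A1 A2 A3 :: real
        using that by linarith
      have 1: "\<bar>ls * \<sigma> x' - ls * \<sigma> y'\<bar> \<le> \<bar>ls\<bar> * Ds"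
      proof -
        have "\<bar>ls * \<sigma> x' - ls * \<sigma> y'\<bar> = \<bar>ls\<bar> * \<bar>\<sigma> x' - \<sigma> y'\<bar>" by (simp add: abs_mult flip: right_diff_distrib)
        also have "\<dots> \<le> \<bar>ls\<bar> * Ds" by (intro mult_left_mono leDs[OF P']) auto
        finally show ?thesis .
      qed
      have 2: "\<bar>sgn ls * B (bump_coord x') - sgn ls * B (bump_coord y')\<bar> \<le> (1 - \<bar>ls\<bar>) / 2 * (Ds + Du / 2)"
        using Bd by (simp only: abs_sgn_ls_mult flip: right_diff_distrib)
      show ?thesis unfolding F\<sigma> using * [OF 1 2 order_trans[OF \<alpha>(2) e\<eta>[OF P']]] by (simp only: bump_coord_def)
    qed
    moreover have "\<sigma> (F x') - \<sigma> (F y') = \<sigma> x - \<sigma> y"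
      using lin(1) by (simp add: x'_def y'_def linear_add)
    ultimately show "\<bar>\<sigma> x - \<sigma> y\<bar> \<le> \<bar>ls\<bar> * Ds + (1 - \<bar>ls\<bar>) / 2 * (Ds + Du / 2) + \<eta> * (Ds + Du)" by simp
  qed
  have "Du \<le> 2 * \<eta> * Ds"
  proof -
    have "\<eta> * Du \<le> 1/2 * Du" using Du0 \<eta>(2) ls(2) by (intro mult_right_mono) auto
    moreover have "\<eta> * (Ds + Du) = \<eta> * Ds + \<eta> * Du" "2 * \<eta> * Ds = 2 * (\<eta> * Ds)"
      by (simp_all add: distrib_left)
    ultimately show ?thesis using Du2 by argo
  qed
  have "Ds = 0"
  proof (rule ccontr)
    assume "Ds \<noteq> 0"
    then have pos: "Ds > 0" using Ds0 by simp
    have Du3: "Du \<le> 1/2 * Ds"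
    proof -
      have "2 * \<eta> * Ds \<le> 1/2 * Ds" using Ds0 \<eta>(2) ls(2) by (intro mult_right_mono) auto
      then show ?thesis using \<open>Du \<le> 2 * \<eta> * Ds\<close> by linarith
    qed
    have eq: "\<bar>ls\<bar> * Ds + (1 - \<bar>ls\<bar>) / 2 * (Ds + Du / 2) = Ds - 4 * ((1 - \<bar>ls\<bar>) / 8 * Ds) + (1 - \<bar>ls\<bar>) / 2 * (Du / 2)"
      by (simp add: field_simps)
    have *: False if "D \<le> D - 4 * W + Y + Z" "Y \<le> 1/2 * (U / 2)" "Z \<le> 3/2 * E" "E < W" "U \<le> 2 * E" "0 < E"
      for D W Y Z U E :: real using that by argo
    show False
    proof (rule *)
      show "Ds \<le> Ds - 4 * ((1 - \<bar>ls\<bar>) / 8 * Ds) + (1 - \<bar>ls\<bar>) / 2 * (Du / 2) + \<eta> * (Ds + Du)"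
        using Ds2 unfolding eq .
      show "(1 - \<bar>ls\<bar>) / 2 * (Du / 2) \<le> 1/2 * (Du / 2)" using Du0 by (intro mult_right_mono) auto
      have "\<eta> * (Ds + Du) \<le> \<eta> * (3/2 * Ds)" using Du3 \<eta>(1) by (intro mult_left_mono) auto
      then show "\<eta> * (Ds + Du) \<le> 3/2 * (\<eta> * Ds)" by simp
      show "\<eta> * Ds < (1 - \<bar>ls\<bar>) / 8 * Ds" using small(3) pos by (intro mult_strict_right_mono)
      show "Du \<le> 2 * (\<eta> * Ds)" using \<open>Du \<le> 2 * \<eta> * Ds\<close> by simp
      show "0 < \<eta> * Ds" using pos \<eta>(1) by simp
    qed
  qed
  moreover from this have "Du = 0" using \<open>Du \<le> 2 * \<eta> * Ds\<close> Du0 by simp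
  ultimately have "\<sigma> x = \<sigma> y" "\<tau> x = \<tau> y" using leDs[OF xy] leDu[OF xy] by simp_all
  then show "x = y" by (rule coords_eqI)
qed

text \<open>
  The relation \<open>P\<close> of belonging to a common connected set collapsed by \<open>h\<close> satisfies the hypotheses
  of \<open>invariant_pairs_trivial\<close>, but it relates the two ends of the arc from \<open>semiconjugacy_collapses_arc\<close>.
  Connectedness is what makes the relation invariant under \<open>F\<^sup>-\<^sup>1\<close>: on the preimage of a collapsed
  set, \<open>g \<circ> h\<close> is constant, so \<open>h\<close> is locally constant. It also bounds the relation: on a collapsed set
  the lift \<open>H\<close> of \<open>h\<close> takes values in one fibre, hence is constant, and \<open>H\<close> is at bounded distance
  from the identity.
\<close>

lemma no_semiconjugacy:
  assumes lift: "\<And>x. torus_proj (F x) = f (torus_proj x)"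
    and g: "anosov_local_diffeo g"
    and h: "continuous_on UNIV h" "\<And>p. h (f p) = g (h p)" "torus_homotopic id h"
    and B: "\<And>s. \<bar>B s\<bar> \<le> bmax"
      "\<And>s t. (\<forall>k\<in>\<int>. \<rho> \<le> \<bar>s - k\<bar>) \<Longrightarrow> \<bar>s - t\<bar> \<le> \<rho> / 2 \<Longrightarrow> \<bar>B s - B t\<bar> \<le> (1 - \<bar>ls\<bar>) / 2 * \<bar>s - t\<bar>"
    and small: "2 * (bmax + \<eta>) \<le> (1 - \<bar>ls\<bar>) * (\<rho> / 4)" "2 * \<eta> \<le> \<rho> / 4" "\<eta> < (1 - \<bar>ls\<bar>) / 8"
    and avoid: "\<And>x. \<exists>m\<in>int_lattice. \<forall>k\<in>\<int>. \<rho> \<le> \<bar>bump_coord (inv F (x + m)) - k\<bar>"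
  shows False
proof -
  obtain t where t: "a < t" "\<And>s. s \<in> {a..t} \<Longrightarrow> h (torus_proj (leaf s)) = h (torus_proj (leaf a))"
    by (rule semiconjugacy_collapses_arc[OF lift g h(1,2)]) (rule that)
  obtain H where H: "continuous_on UNIV H" "\<And>x. torus_proj (H x) = h (torus_proj x)"
    "\<And>x m. m \<in> int_lattice \<Longrightarrow> H (x + m) = H x + m"
    by (rule torus_homotopy_lift[OF h(3)]) (rule that)
  have "continuous_on UNIV (\<lambda>x. H x - x)" by (intro continuous_on_diff H(1) continuous_on_id)
  moreover have "\<forall>x. \<forall>m\<in>int_lattice. H (x + m) - (x + m) = H x - x" by (simp add: H(3))
  ultimately have "\<exists>M. \<forall>x. norm (H x - x) \<le> M"
    using periodic_bounded[of "\<lambda>x. H x - x"] by metis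
  then obtain M where M: "\<And>x. norm (H x - x) \<le> M" by (elim exE) (rule that, elim allE)
  define collapsed where "collapsed D \<longleftrightarrow> connected D \<and> (\<forall>x\<in>D. \<forall>y\<in>D. h (torus_proj x) = h (torus_proj y))" for D
  define P where "P = {(x, y). \<exists>D. collapsed D \<and> x \<in> D \<and> y \<in> D}"
  have collapsed_conn: "connected D" if "collapsed D" for D using that unfolding collapsed_def by (rule conjunct1)
  have collapsed_eq: "h (torus_proj x) = h (torus_proj y)" if "collapsed D" "x \<in> D" "y \<in> D" for D x y
    using that unfolding collapsed_def by blast
  have PI: "(x, y) \<in> P" if "collapsed D" "x \<in> D" "y \<in> D" for x y D using that unfolding P_def by blast
  have hp: "continuous_on S (\<lambda>x. h (torus_proj x))" for S
    by (rule continuous_on_compose2[OF h(1) continuous_on_torus_proj]) simp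
  have collapsed_F: "collapsed (F ` D)" if "collapsed D" for D
    unfolding collapsed_def
  proof (intro conjI ballI)
    show "connected (F ` D)" by (intro connected_continuous_image continuous_F collapsed_conn[OF that])
    fix u v assume "u \<in> F ` D" "v \<in> F ` D"
    then obtain x y where uv: "u = F x" "v = F y" "x \<in> D" "y \<in> D" by blast
    have "g (h (torus_proj x)) = g (h (torus_proj y))" by (rule arg_cong[OF collapsed_eq[OF that uv(3,4)]])
    then show "h (torus_proj u) = h (torus_proj v)" by (simp only: uv lift h(2))
  qed
  have collapsed_trans: "collapsed ((\<lambda>x. x + m) ` D)" if "collapsed D" "m \<in> int_lattice" for D m
    unfolding collapsed_def
  proof (intro conjI ballI)
    show "connected ((\<lambda>x. x + m) ` D)"
      by (intro connected_continuous_image continuous_on_add continuous_on_id continuous_on_const collapsed_conn[OF that(1)])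
    fix u v assume "u \<in> (\<lambda>x. x + m) ` D" "v \<in> (\<lambda>x. x + m) ` D"
    then obtain x y where uv: "u = x + m" "v = y + m" "x \<in> D" "y \<in> D" by blast
    show "h (torus_proj u) = h (torus_proj v)"
      unfolding uv torus_proj_add_lattice[OF that(2)] by (rule collapsed_eq[OF that(1) uv(3,4)])
  qed
  have ld: "torus_local_diffeo g" using g by (simp add: anosov_local_diffeo_def)
  have collapsed_inv: "collapsed (inv F ` D)" if "collapsed D" for D
    unfolding collapsed_def
  proof (intro conjI ballI)
    show c: "connected (inv F ` D)"
      by (intro connected_continuous_image continuous_inv_F collapsed_conn[OF that])
    fix u v assume uv: "u \<in> inv F ` D" "v \<in> inv F ` D"
    have gh: "g (h (torus_proj x)) = g (h (torus_proj y))" if "x \<in> inv F ` D" "y \<in> inv F ` D" for x y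
    proof -
      obtain x' y' where x': "x = inv F x'" "y = inv F y'" "x' \<in> D" "y' \<in> D" using \<open>x \<in> inv F ` D\<close> \<open>y \<in> inv F ` D\<close> by blast
      have "h (torus_proj (F x)) = h (torus_proj (F y))"
        unfolding x' F_inv by (rule collapsed_eq[OF \<open>collapsed D\<close> x'(3,4)])
      then show ?thesis by (simp only: lift h(2))
    qed
    show "h (torus_proj u) = h (torus_proj v)"
    proof (rule connected_local_const[OF c uv], rule ballI)
      fix x assume x: "x \<in> inv F ` D"
      obtain U where U: "open U" "h (torus_proj x) \<in> U" "inj_on g U"
        by (rule local_diffeo_locally_inj[OF ld]) (rule that)
      have "((\<lambda>x. h (torus_proj x)) \<longlongrightarrow> h (torus_proj x)) (at x within inv F ` D)"
        using hp[of "inv F ` D"] x unfolding continuous_on_def by (rule bspec)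
      then have "\<forall>\<^sub>F y in at x within inv F ` D. h (torus_proj y) \<in> U"
        using U(1,2) by (rule topological_tendstoD)
      moreover have "\<forall>\<^sub>F y in at x within inv F ` D. y \<in> inv F ` D"
        by (simp add: eventually_at_filter)
      ultimately show "\<forall>\<^sub>F y in at x within inv F ` D. h (torus_proj x) = h (torus_proj y)"
      proof eventually_elim
        case (elim y)
        show ?case by (rule inj_onD[OF U(3) gh[OF x elim(2)] U(2) elim(1)])
      qed
    qed
  qed
  have Pd: "norm (x - y) \<le> 2 * M" if xy: "(x, y) \<in> P" for x y
  proof -
    obtain D where D: "collapsed D" "x \<in> D" "y \<in> D" using xy unfolding P_def by blast
    have "H x - H x = H y - H x"
    proof (rule lattice_valued_constant[of D "\<lambda>z. H z - H x"])
      show "connected D" by (rule collapsed_conn[OF D(1)])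
      show "continuous_on D (\<lambda>z. H z - H x)"
        by (intro continuous_on_diff continuous_on_const continuous_on_subset[OF H(1) subset_UNIV])
      fix z assume "z \<in> D"
      then have "torus_proj (H z) = torus_proj (H x)" unfolding H(2) by (intro collapsed_eq[OF D(1) _ D(2)])
      then show "H z - H x \<in> int_lattice" by (simp add: torus_proj_eq_iff_lattice)
    qed (use D in auto)
    then have "x - y = (H y - y) - (H x - x)" by simp
    then have "norm (x - y) \<le> norm (H y - y) + norm (H x - x)" by (simp only: norm_triangle_ineq4)
    then show ?thesis using M[of x] M[of y] by linarith
  qed
  obtain K1 where K1: "K1 > 0" "\<And>x. norm (\<sigma> x) \<le> norm x * K1"
    using bounded_linear.pos_bounded[of \<sigma>] lin(1) by (auto simp: linear_conv_bounded_linear)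
  obtain K2 where K2: "K2 > 0" "\<And>x. norm (\<tau> x) \<le> norm x * K2"
    using bounded_linear.pos_bounded[of \<tau>] lin(2) by (auto simp: linear_conv_bounded_linear)
  have "leaf a = leaf t"
  proof (rule invariant_pairs_trivial[where P = P and M = "2 * M * (K1 + K2)" and \<rho> = \<rho> and bmax = bmax])
    fix x y assume xy: "(x, y) \<in> P"
    have M0: "norm (x - y) * K1 \<le> 2 * M * (K1 + K2)" "norm (x - y) * K2 \<le> 2 * M * (K1 + K2)"
      using Pd[OF xy] K1(1) K2(1) order_trans[OF norm_ge_zero Pd[OF xy]] by (auto intro!: mult_mono)
    show "\<bar>\<sigma> x - \<sigma> y\<bar> \<le> 2 * M * (K1 + K2)"
      using K1(2)[of "x - y"] M0(1) by (simp add: \<sigma>_diff)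
    show "\<bar>\<tau> x - \<tau> y\<bar> \<le> 2 * M * (K1 + K2)"
      using K2(2)[of "x - y"] M0(2) by (simp add: \<tau>_diff)
    obtain D where D: "collapsed D" "x \<in> D" "y \<in> D" using xy unfolding P_def by blast
    show "(F x, F y) \<in> P" by (rule PI[OF collapsed_F[OF D(1)]]) (use D in auto)
    show "(inv F x, inv F y) \<in> P" by (rule PI[OF collapsed_inv[OF D(1)]]) (use D in auto)
    obtain m where m: "m \<in> int_lattice" "\<forall>k\<in>\<int>. \<rho> \<le> \<bar>bump_coord (inv F (x + m)) - k\<bar>" using avoid by blast
    have "(inv F (x + m), inv F (y + m)) \<in> P"
      by (rule PI[OF collapsed_inv[OF collapsed_trans[OF D(1) m(1)]]]) (use D in auto)
    then show "\<exists>m. (inv F (x + m), inv F (y + m)) \<in> P \<and>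
        (\<forall>k\<in>\<int>. \<rho> \<le> \<bar>bump_coord (inv F (x + m)) - k\<bar>)" using m(2) by blast
  next
    show "(leaf a, leaf t) \<in> P"
    proof (rule PI[where D = "leaf ` {a..t}"])
      have "continuous_on {a..t} leaf"
        unfolding continuous_on_iff
      proof (intro ballI allI impI)
        fix s e :: real assume "0 < e"
        let ?c = "(norm es + norm eu) * 2 + 1"
        have c: "?c > 0" by (intro add_nonneg_pos) auto
        show "\<exists>d>0. \<forall>s'\<in>{a..t}. dist s' s < d \<longrightarrow> dist (leaf s') (leaf s) < e"
        proof (intro exI[of _ "e / ?c"] conjI ballI impI)
          show "e / ?c > 0" using \<open>0 < e\<close> c by simp
          fix s' assume "dist s' s < e / ?c"
          have "dist (leaf s') (leaf s) \<le> (norm es + norm eu) * 2 * \<bar>s' - s\<bar>" by (rule dist_leaf_le)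
          also have "\<dots> \<le> ?c * \<bar>s' - s\<bar>" by (intro mult_right_mono) auto
          also have "\<dots> < ?c * (e / ?c)"
            using \<open>dist s' s < e / ?c\<close> c unfolding dist_real_def by (intro mult_strict_left_mono)
          finally show "dist (leaf s') (leaf s) < e" using c by simp
        qed
      qed
      then have "connected (leaf ` {a..t})" by (intro connected_continuous_image) auto
      moreover have "h (torus_proj x) = h (torus_proj y)" if "x \<in> leaf ` {a..t}" "y \<in> leaf ` {a..t}" for x y
      proof -
        obtain s s' where s: "x = leaf s" "y = leaf s'" "s \<in> {a..t}" "s' \<in> {a..t}" using \<open>x \<in> leaf ` {a..t}\<close> \<open>y \<in> leaf ` {a..t}\<close> by blast
        show ?thesis unfolding s(1,2) using t(2)[OF s(3)] t(2)[OF s(4)] by (rule trans[OF _ sym])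
      qed
      ultimately show "collapsed (leaf ` {a..t})" unfolding collapsed_def by blast
    qed (use t(1) in auto)
  qed (fact B small)+
  then have "\<sigma> (leaf a) = \<sigma> (leaf t)" by simp
  then show False using t(1) by simp
qed

end

section \<open>A bump that is steep at the integers only\<close>

text \<open>
  A small function can have slope 1 at the integers if it is steep only very near to them. Take
  \<open>B t = - d / (2 * pi * q) * Arg (1 - q * cis (2 * pi * t))\<close> with \<open>q = 1 - d\<close>, a smoothed
  sawtooth. With \<open>c = cos (2 * pi * t)\<close>, its derivative is \<open>d * (c - q) / (1 - 2 * q * c + q\<^sup>2)\<close>,
  which equals 1 at the integers, is never below \<open>- d\<close>, and tends to 0 with \<open>d\<close> uniformly away
  from the integers. Because of the slope 1 at \<open>0\<close>, the map \<open>l * t + B t\<close> repels from \<open>0\<close> there.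
\<close>

lemma sawtooth_exists:
  fixes l \<rho> b0 :: real
  assumes l: "0 < l" "l < 1" and \<rho>: "0 < \<rho>" "\<rho> < 1" and b0: "0 < b0"
  obtains B B' :: "real \<Rightarrow> real" and a where
    "\<And>x. (B has_real_derivative B' x) (at x)" "continuous_on UNIV B'"
    "\<And>x k. k \<in> \<int> \<Longrightarrow> B (x + k) = B x" "\<And>x. B (- x) = - B x" "\<And>x. \<bar>B x\<bar> \<le> b0"
    "\<And>x. - (l / 2) \<le> B' x" "\<And>x. B' x \<le> 1"
    "\<And>x. (\<forall>k\<in>\<int>. \<rho> / 2 \<le> \<bar>x - k\<bar>) \<Longrightarrow> \<bar>B' x\<bar> \<le> (1 - l) / 2"
    "0 < a" "a < 1" "a < l * a + B a"
proof -
  define \<kappa> where "\<kappa> = 1 - cos (pi * \<rho>)"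
  have "cos (pi * \<rho>) < cos 0" using \<rho> by (intro cos_monotone_0_pi) auto
  then have \<kappa>: "\<kappa> > 0" by (simp add: \<kappa>_def)
  define d where "d = Min {1/2, l / 2, b0, (1 - l) / 2 * \<kappa> / 2}"
  have d: "0 < d" "d \<le> 1/2" "d \<le> l / 2" "d \<le> b0" "2 * d / \<kappa> \<le> (1 - l) / 2"
  proof -
    show "0 < d" unfolding d_def using l b0 \<kappa> by simp
    show "d \<le> 1/2" "d \<le> l / 2" "d \<le> b0" unfolding d_def by simp_all
    have "d \<le> (1 - l) / 2 * \<kappa> / 2" unfolding d_def by simp
    then show "2 * d / \<kappa> \<le> (1 - l) / 2" using \<kappa> by (simp add: field_simps)
  qed
  define q where "q = 1 - d"
  have q: "1/2 \<le> q" "q < 1" "1 - q = d" using d by (auto simp: q_def)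
  \<comment> \<open>The squared modulus of \<open>1 - q * cis (2 * pi * t)\<close>, as a function of \<open>c = cos (2 * pi * t)\<close>.\<close>
  define N where "N c = 1 - 2 * q * c + q^2" for c :: real
  have N_eq: "N c = (1 - q)^2 + 2 * q * (1 - c)" for c by (simp add: N_def power2_eq_square algebra_simps)
  have N_pos: "N c > 0" if "c \<le> 1" for c
    unfolding N_eq using that q by (intro add_pos_nonneg) auto
  define S where "S t = arctan (q * sin (2 * pi * t) / (1 - q * cos (2 * pi * t)))" for t
  define B where "B t = d / (2 * pi * q) * S t" for t
  define B' where "B' t = d * (cos (2 * pi * t) - q) / N (cos (2 * pi * t))" for t
  have den: "1 - q * cos (2 * pi * t) > 0" for t
  proof -
    have "q * cos (2 * pi * t) \<le> q * 1" using q by (intro mult_left_mono) auto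
    then show ?thesis using q(2) by linarith
  qed
  have dS: "(S has_real_derivative 2 * pi * q * (cos (2 * pi * t) - q) / N (cos (2 * pi * t))) (at t)" for t
  proof -
    let ?s = "sin (2 * pi * t)" and ?c = "cos (2 * pi * t)"
    let ?D = "1 - q * ?c"
    have sc: "?s^2 = 1 - ?c^2" by (simp add: sin_squared_eq)
    have D0: "?D \<noteq> 0" using den[of t] by simp
    have ds: "((\<lambda>t. sin (2 * pi * t)) has_real_derivative ?c * (2 * pi)) (at t)"
      and dc: "((\<lambda>t. cos (2 * pi * t)) has_real_derivative - ?s * (2 * pi)) (at t)"
      by (auto intro!: derivative_eq_intros)
    have "((\<lambda>t. q * sin (2 * pi * t) / (1 - q * cos (2 * pi * t))) has_real_derivative
        (q * (?c * (2 * pi)) * ?D - q * ?s * (0 - q * (- ?s * (2 * pi)))) / (?D * ?D)) (at t)"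
      by (rule DERIV_divide[OF DERIV_cmult[OF ds] DERIV_diff[OF DERIV_const DERIV_cmult[OF dc]] D0])
    then have "((\<lambda>t. q * sin (2 * pi * t) / (1 - q * cos (2 * pi * t))) has_real_derivative
        (q * (?c * (2 * pi)) * ?D - q * ?s * (q * (?s * (2 * pi)))) / (?D * ?D)) (at t)"
      by (simp only: mult_minus_left mult_minus_right diff_0 minus_minus)
    from DERIV_chain2[OF DERIV_arctan this]
    have "(S has_real_derivative inverse (1 + (q * ?s / ?D)^2) *
        ((q * (?c * (2 * pi)) * ?D - q * ?s * (q * (?s * (2 * pi)))) / (?D * ?D))) (at t)"
      by (simp only: S_def[abs_def])
    also have "inverse (1 + (q * ?s / ?D)^2) *
        ((q * (?c * (2 * pi)) * ?D - q * ?s * (q * (?s * (2 * pi)))) / (?D * ?D))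
        = 2 * pi * q * (?c - q) / N ?c"
    proof -
      have "1 + (q * ?s / ?D)^2 = N ?c / (?D * ?D)"
      proof -
        have gen: "1 + (y / D)^2 = (D * D + y^2) / (D * D)" if "D \<noteq> 0" for y D :: real
          using that by (simp add: power_divide power2_eq_square add_divide_distrib)
        have "?D * ?D + q^2 * ?s^2 = N ?c" unfolding sc N_def by (simp add: power2_eq_square algebra_simps)
        then show ?thesis unfolding gen[OF D0] by (simp only: power_mult_distrib)
      qed
      moreover have "q * (?c * (2 * pi)) * ?D - q * ?s * (q * (?s * (2 * pi))) = 2 * pi * q * (?c - q)"
      proof -
        have gen: "q * (c * p) * (1 - q * c) - q * s * (q * (s * p)) = p * q * (c - q * (s^2 + c^2))"
          for c s p by (simp add: power2_eq_square algebra_simps)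
        show ?thesis unfolding gen sin_cos_squared_add by simp
      qed
      moreover have "inverse (n / (D * D)) * (k / (D * D)) = k / n" if "D \<noteq> 0" for n k D :: real
        using that by (simp add: divide_simps)
      ultimately show ?thesis using D0 by (simp only:)
    qed
    finally show ?thesis .
  qed
  have dB: "(B has_real_derivative B' t) (at t)" for t
  proof -
    have "(B has_real_derivative d / (2 * pi * q) * (2 * pi * q * (cos (2 * pi * t) - q) / N (cos (2 * pi * t)))) (at t)"
      unfolding B_def[abs_def] by (rule DERIV_cmult[OF dS])
    moreover have "d / (2 * pi * q) * (2 * pi * q * (cos (2 * pi * t) - q) / N (cos (2 * pi * t))) = B' t"
      using q by (simp add: B'_def)
    ultimately show ?thesis by simp
  qed
  have cB: "continuous_on UNIV B'"
    unfolding B'_def N_def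
  proof (intro continuous_intros ballI)
    fix t :: real
    show "1 - 2 * q * cos (2 * pi * t) + q\<^sup>2 \<noteq> 0" using N_pos[of "cos (2 * pi * t)"] by (simp add: N_def)
  qed
  have per: "B (x + k) = B x" if "k \<in> \<int>" for x k
  proof -
    obtain n where n: "k = of_int n" using \<open>k \<in> \<int>\<close> by (rule Ints_cases)
    have "2 * pi * (x + k) = 2 * pi * x + 2 * pi * of_int n" by (simp add: n algebra_simps)
    moreover have "sin (2 * pi * x + 2 * pi * of_int n) = sin (2 * pi * x) \<and>
        cos (2 * pi * x + 2 * pi * of_int n) = cos (2 * pi * x)"
      unfolding sin_cos_eq_iff by blast
    ultimately show ?thesis by (simp add: B_def S_def)
  qed
  have Bb: "\<bar>B x\<bar> \<le> b0" for x
  proof -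
    have "- (pi / 2) < S x" "S x < pi / 2" unfolding S_def by (rule arctan_lbound arctan_ubound)+
    then have Sx: "\<bar>S x\<bar> \<le> pi / 2" by linarith
    have p: "0 \<le> d / (2 * pi * q)" using d(1) q by simp
    have "\<bar>B x\<bar> = d / (2 * pi * q) * \<bar>S x\<bar>" unfolding B_def abs_mult abs_of_nonneg[OF p] ..
    also have "\<dots> \<le> d / (2 * pi * q) * (pi / 2)" by (intro mult_left_mono Sx p)
    also have "\<dots> = d / (4 * q)" by simp
    also have "\<dots> \<le> d / 1" using d(1) q by (intro divide_left_mono) auto
    finally show ?thesis using d(4) by simp
  qed
  have B'u: "B' t \<le> 1" for t
  proof -
    let ?c = "cos (2 * pi * t)"
    have "?c * (1 + q) \<le> 1 * (1 + q)" using q by (intro mult_right_mono) auto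
    moreover have "N ?c - (1 - q) * (?c - q) = 1 * (1 + q) - ?c * (1 + q)"
      by (simp add: N_def power2_eq_square algebra_simps)
    ultimately have "(1 - q) * (?c - q) \<le> N ?c" by linarith
    then show ?thesis unfolding B'_def q(3) pos_divide_le_eq[OF N_pos[OF cos_le_one]] by simp
  qed
  have B'l: "- (l / 2) \<le> B' t" for t
  proof -
    let ?c = "cos (2 * pi * t)"
    have "0 \<le> (1 - ?c) * (q + q^2) + (1 + ?c) * ((1 - q) * (2 - q))"
    proof -
      have "0 \<le> 1 + ?c" "0 \<le> 1 - ?c"
        using cos_ge_minus_one[of "2 * pi * t"] cos_le_one[of "2 * pi * t"] by linarith+
      moreover have "0 \<le> q + q^2" "0 \<le> (1 - q) * (2 - q)" using q by simp_all
      ultimately show ?thesis by (simp only: add_nonneg_nonneg mult_nonneg_nonneg)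
    qed
    also have "\<dots> = 2 * (N ?c + (?c - q))" by (simp add: N_def power2_eq_square algebra_simps)
    finally have "- N ?c \<le> ?c - q" by argo
    then have "d * (- N ?c) \<le> d * (?c - q)" using d(1) by (intro mult_left_mono) auto
    then have "(- d) * N ?c \<le> d * (?c - q)" by (simp only: mult_minus_left mult_minus_right)
    then have "- d \<le> B' t" unfolding B'_def pos_le_divide_eq[OF N_pos[OF cos_le_one]] .
    then show ?thesis using d(3) by simp
  qed
  have flat: "\<bar>B' x\<bar> \<le> (1 - l) / 2" if far: "\<forall>k\<in>\<int>. \<rho> / 2 \<le> \<bar>x - k\<bar>" for x
  proof -
    let ?c = "cos (2 * pi * x)"
    define y where "y = x - of_int (round x)"
    have y: "\<rho> / 2 \<le> \<bar>y\<bar>" "\<bar>y\<bar> \<le> 1/2"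
      using far of_int_round_abs_le[of x] by (auto simp: y_def abs_minus_commute)
    have "2 * pi * x = 2 * pi * y + 2 * pi * of_int (round x)" by (simp add: y_def algebra_simps)
    then have "sin (2 * pi * x) = sin (2 * pi * y) \<and> ?c = cos (2 * pi * y)"
      unfolding sin_cos_eq_iff by blast
    then have "?c = cos (2 * pi * y)" by (rule conjunct2)
    also have "cos (2 * pi * y) = cos (2 * pi * \<bar>y\<bar>)" by (simp add: abs_if)
    also have "cos (2 * pi * \<bar>y\<bar>) \<le> cos (pi * \<rho>)"
    proof (rule cos_monotone_0_pi_le)
      have "pi * \<rho> \<le> pi * (2 * \<bar>y\<bar>)" using y(1) by (intro mult_left_mono) auto
      then show "pi * \<rho> \<le> 2 * pi * \<bar>y\<bar>" by simp
      have "pi * (2 * \<bar>y\<bar>) \<le> pi * 1" using y(2) by (intro mult_left_mono) auto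
      then show "2 * pi * \<bar>y\<bar> \<le> pi" by simp
    qed (use \<rho> in auto)
    finally have c: "\<kappa> \<le> 1 - ?c" by (simp add: \<kappa>_def)
    have "1 * \<kappa> \<le> 2 * q * (1 - ?c)" using c q \<kappa> by (intro mult_mono) auto
    then have Nk: "\<kappa> \<le> N ?c" unfolding N_eq using zero_le_power2[of "1 - q"] by linarith
    have "\<bar>?c - q\<bar> \<le> 2" using q cos_ge_minus_one[of "2 * pi * x"] cos_le_one[of "2 * pi * x"] by linarith
    then have "\<bar>B' x\<bar> \<le> d * 2 / \<kappa>"
      unfolding B'_def abs_divide abs_mult using d(1) \<kappa> Nk by (intro frac_le mult_mono) auto
    then show ?thesis using d(5) by simp
  qed
  have odd: "B (- x) = - B x" for x by (simp add: B_def S_def arctan_minus)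
  have B00: "B 0 = 0" by (simp add: B_def S_def)
  have B'0: "B' 0 = 1"
  proof -
    have "N 1 = d * d" using q(3) by (simp add: N_eq power2_eq_square)
    then show ?thesis using d(1) q(3) by (simp add: B'_def)
  qed
  have "((\<lambda>t. l * t + B t - t) has_real_derivative l * 1 + B' 0 - 1) (at 0)"
    by (intro DERIV_diff DERIV_add DERIV_cmult DERIV_ident dB)
  then have "((\<lambda>t. l * t + B t - t) has_real_derivative l) (at 0)" by (simp add: B'0)
  from DERIV_pos_inc_right[OF this l(1)] obtain e where e: "e > 0"
    "\<And>h. h > 0 \<Longrightarrow> h < e \<Longrightarrow> 0 < l * h + B h - h" by (auto simp: B00)
  define a where "a = min (e / 2) (1 / 2)"
  have a: "0 < a" "a < 1" "a < e" using e(1) by (auto simp: a_def)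
  show thesis
  proof (rule that[OF dB cB per odd Bb B'l B'u flat a(1,2)])
    show "a < l * a + B a" using e(2)[OF a(1,3)] by simp
  qed
qed

section \<open>Lifts of maps that are close to each other\<close>

text \<open>
  The displacement \<open>v x\<close> is the shortest correction of \<open>F0 x\<close> to a point above \<open>f (torus_proj x)\<close>.
  As \<open>\<epsilon> \<le> 1/4\<close>, corrections of norm less than \<open>\<epsilon>\<close> are unique, which makes \<open>v\<close> continuous and periodic;
  its derivative is the difference of the differentials of \<open>f\<close> and \<open>f0\<close>.
\<close>

lemma C1_close_map_lift:
  assumes f: "torus_local_diffeo f" and f0: "torus_local_diffeo f0"
    and F0: "\<And>x. torus_proj (F0 x) = f0 (torus_proj x)" "continuous_on UNIV F0"
    and per: "\<And>x m. m \<in> int_lattice \<Longrightarrow> F0 (x + m) - F0 x \<in> int_lattice"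
    and close: "\<And>p. dist (f0 p) (f p) < \<epsilon>" "\<And>p. norm (torus_deriv f0 p - torus_deriv f p) < \<epsilon>"
    and \<epsilon>: "\<epsilon> \<le> 1/4"
  obtains v where "\<And>x. torus_proj (F0 x + v x) = f (torus_proj x)" "\<And>x. norm (v x) \<le> \<epsilon>"
    "\<And>x y. norm (v x - v y) \<le> \<epsilon> * norm (x - y)" "\<And>x m. m \<in> int_lattice \<Longrightarrow> v (x + m) = v x"
proof -
  have ex: "\<exists>w. norm w < \<epsilon> \<and> torus_proj (F0 x + w) = f (torus_proj x)" for x
  proof -
    have "dist (torus_proj (F0 x)) (f (torus_proj x)) < \<epsilon>" unfolding F0(1) by (rule close(1))
    then obtain y where "torus_proj y = f (torus_proj x)" "dist (F0 x) y < \<epsilon>" by (rule torus_lift_near)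
    then show ?thesis by (intro exI[of _ "y - F0 x"]) (simp add: dist_norm norm_minus_commute)
  qed
  define v where "v x = (SOME w. norm w < \<epsilon> \<and> torus_proj (F0 x + w) = f (torus_proj x))" for x
  have vx: "norm (v x) < \<epsilon> \<and> torus_proj (F0 x + v x) = f (torus_proj x)" for x
    unfolding v_def by (rule someI_ex[OF ex])
  have v1: "norm (v x) < \<epsilon>" and v2: "torus_proj (F0 x + v x) = f (torus_proj x)" for x
    using vx[of x] by simp_all
  define F where "F x = F0 x + v x" for x
  have F: "torus_proj (F x) = f (torus_proj x)" for x unfolding F_def by (rule v2)
  have cfp: "continuous_on UNIV (\<lambda>x. f (torus_proj x))"
    by (rule continuous_on_compose2[OF local_diffeo_continuous[OF f] continuous_on_torus_proj]) simp
  have cF: "isCont F x" for x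
    unfolding continuous_at_eps_delta
  proof (intro allI impI)
    fix e :: real assume e: "0 < e"
    define \<eta> where "\<eta> = min e (1/8)"
    have \<eta>: "\<eta> > 0" "\<eta> \<le> e" "\<eta> \<le> 1/8" using e by (simp_all add: \<eta>_def)
    obtain d1 where d1: "d1 > 0" "\<forall>y\<in>UNIV. dist y x < d1 \<longrightarrow> dist (F0 y) (F0 x) < \<eta>"
      using F0(2) \<eta>(1) unfolding continuous_on_iff by blast
    obtain d2 where d2: "d2 > 0" "\<forall>y\<in>UNIV. dist y x < d2 \<longrightarrow> dist (f (torus_proj y)) (f (torus_proj x)) < \<eta>"
      using cfp \<eta>(1) unfolding continuous_on_iff by blast
    show "\<exists>d>0. \<forall>y. dist y x < d \<longrightarrow> dist (F y) (F x) < e"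
    proof (intro exI[of _ "min d1 d2"] conjI allI impI)
      show "0 < min d1 d2" using d1(1) d2(1) by simp
      fix y assume y: "dist y x < min d1 d2"
      have a: "norm (F0 y - F0 x) < \<eta>" using d1(2) y by (simp add: dist_norm)
      have "dist (f (torus_proj y)) (f (torus_proj x)) < \<eta>" using d2(2) y by simp
      then have "dist (torus_proj (F x)) (f (torus_proj y)) < \<eta>" unfolding F by (subst dist_commute)
      then obtain z where z: "torus_proj z = f (torus_proj y)" "dist (F x) z < \<eta>" by (rule torus_lift_near)
      have "z - F y = (z - F x) + v x - v y - (F0 y - F0 x)" by (simp add: F_def)
      then have "norm (z - F y) \<le> norm ((z - F x) + v x - v y) + norm (F0 y - F0 x)"
        by (simp only: norm_triangle_ineq4)
      also have "\<dots> \<le> norm (z - F x) + norm (v x) + norm (v y) + norm (F0 y - F0 x)"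
        using norm_triangle_ineq4[of "(z - F x) + v x" "v y"] norm_triangle_ineq[of "z - F x" "v x"] by simp
      also have "\<dots> < 1/8 + 1/4 + 1/4 + 1/8"
        using z(2) a v1[of x] v1[of y] \<epsilon> \<eta>(3) by (simp add: dist_norm norm_minus_commute)
      finally have "dist z (F y) < 1" by (simp add: dist_norm)
      moreover have "torus_proj z = torus_proj (F y)" by (simp only: z(1) F)
      ultimately have "z = F y" by (intro torus_proj_inj_near)
      then show "dist (F y) (F x) < e" using z(2) \<eta>(2) by (simp add: dist_commute)
    qed
  qed
  have dF: "(F has_derivative blinfun_apply (torus_deriv f (torus_proj x))) (at x)" for x
    by (rule lift_has_derivative[where f = f and F = F, OF F cF local_diffeo_has_derivative[OF f]])
  have cF0: "isCont F0 x" for x using F0(2) by (simp add: continuous_on_eq_continuous_at)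
  have dF0: "(F0 has_derivative blinfun_apply (torus_deriv f0 (torus_proj x))) (at x)" for x
    by (rule lift_has_derivative[where f = f0 and F = F0, OF F0(1) cF0 local_diffeo_has_derivative[OF f0]])
  define D where "D x = torus_deriv f (torus_proj x) - torus_deriv f0 (torus_proj x)" for x
  have dv: "(v has_derivative blinfun_apply (D x)) (at x)" for x
  proof -
    have "((\<lambda>x. F x - F0 x) has_derivative (\<lambda>h. torus_deriv f (torus_proj x) h - torus_deriv f0 (torus_proj x) h)) (at x)"
      by (rule has_derivative_diff[OF dF dF0])
    moreover have "(\<lambda>x. F x - F0 x) = v" by (rule ext) (simp add: F_def)
    moreover have "(\<lambda>h. torus_deriv f (torus_proj x) h - torus_deriv f0 (torus_proj x) h) = blinfun_apply (D x)"
      by (rule ext) (simp add: D_def blinfun.diff_left)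
    ultimately show ?thesis by simp
  qed
  have Dn: "onorm (blinfun_apply (D x)) \<le> \<epsilon>" for x
    using close(2)[of "torus_proj x"] by (simp add: D_def norm_minus_commute flip: norm_blinfun.rep_eq)
  show thesis
  proof (rule that[OF v2 less_imp_le[OF v1]])
    show "norm (v x - v y) \<le> \<epsilon> * norm (x - y)" for x y
      by (rule differentiable_bound[OF convex_UNIV has_derivative_at_withinI[OF dv] Dn UNIV_I UNIV_I])
    fix x m :: "real^2" assume m: "m \<in> int_lattice"
    have "torus_proj (F0 (x + m) + v (x + m)) = torus_proj (F0 x + v x)"
      unfolding v2 torus_proj_add_lattice[OF m] ..
    then have "(F0 (x + m) + v (x + m)) - (F0 x + v x) \<in> int_lattice" by (simp only: torus_proj_eq_iff_lattice)
    from lattice_diff[OF this per[OF m, of x]] have "v (x + m) - v x \<in> int_lattice" by (simp add: algebra_simps)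
    moreover have "norm (v (x + m) - v x) < 1"
      using norm_triangle_ineq4[of "v (x + m)" "v x"] v1[of x] v1[of "x + m"] \<epsilon> by linarith
    ultimately have "v (x + m) - v x = 0" by (rule lattice_norm_less_1)
    then show "v (x + m) = v x" by simp
  qed
qed

text \<open>
  Integer translations act on both lifts through the same map \<open>L\<close>, so that the straight-line homotopy
  between the lifts descends to the torus.
\<close>

lemma torus_homotopic_of_lifts:
  assumes F: "\<And>x. torus_proj (F x) = f (torus_proj x)" "continuous_on UNIV F"
    and G: "\<And>x. torus_proj (G x) = g (torus_proj x)" "continuous_on UNIV G"
    and per: "\<And>x m. m \<in> int_lattice \<Longrightarrow> F (x + m) = F x + L m" "\<And>x m. m \<in> int_lattice \<Longrightarrow> G (x + m) = G x + L m"
      "\<And>m. m \<in> int_lattice \<Longrightarrow> L m \<in> int_lattice"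
  shows "torus_homotopic f g"
proof -
  define K where "K t x = (1 - t) *\<^sub>R F x + t *\<^sub>R G x" for t x
  define k where "k z = torus_proj (K (fst z) (rep_torus (snd z)))" for z
  have kp: "k (t, torus_proj x) = torus_proj (K t x)" for t x
  proof -
    define m where "m = rep_torus (torus_proj x) - x"
    have m: "m \<in> int_lattice"
      unfolding m_def using torus_proj_rep[of "torus_proj x"] by (simp only: torus_proj_eq_iff_lattice)
    have "rep_torus (torus_proj x) = x + m" by (simp add: m_def)
    moreover have "K t (x + m) = K t x + L m"
      unfolding K_def per(1)[OF m] per(2)[OF m] by (simp add: algebra_simps)
    ultimately show ?thesis by (simp add: k_def torus_proj_add_lattice[OF per(3)[OF m]])
  qed
  have "continuous_on ({0..1::real} \<times> UNIV) (\<lambda>z. K (fst z) (snd z))"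
    unfolding K_def
    by (intro continuous_on_add continuous_on_scaleR continuous_on_diff continuous_on_const continuous_on_fst
        continuous_on_id continuous_on_compose2[OF F(2)] continuous_on_compose2[OF G(2)] continuous_on_snd subset_UNIV)
  then have "continuous_on ({0..1::real} \<times> UNIV) (\<lambda>z. torus_proj (K (fst z) (snd z)))"
    by (rule continuous_on_compose2[OF continuous_on_torus_proj[of UNIV]]) simp
  then have "continuous_on ({0..1::real} \<times> UNIV) (\<lambda>(t, x). k (t, torus_proj x))"
    by (simp add: kp split_beta)
  then have ck: "continuous_on ({0..1::real} \<times> UNIV) k" by (rule continuous_on_torus_descend)
  have k0: "k (0, p) = f p" and k1: "k (1, p) = g p" for p
  proof -
    obtain x where x: "p = torus_proj x" using torus_proj_surj by metis
    show "k (0, p) = f p" "k (1, p) = g p" unfolding x kp by (simp_all add: K_def F(1) G(1))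
  qed
  show ?thesis
    unfolding homotopic_with_def
    using ck k0 k1
    by (intro exI[of _ k]) (simp add: prod_topology_subtopology euclidean_product_topology)
qed

section \<open>Linear Anosov maps of the torus\<close>

abbreviation real_matrix :: "int^2^2 \<Rightarrow> real^2^2" where
  "real_matrix A \<equiv> map_matrix of_int A"

lemma real_matrix_apply:
  "(real_matrix A *v x) $ i = of_int (A $ i $ 1) * x $ 1 + of_int (A $ i $ 2) * x $ 2"
  by (simp add: matrix_vector_mult_def sum_2 map_matrix_def)

lemma torus_linear_proj: "torus_linear A (torus_proj x) = torus_proj (real_matrix A *v x)"
  by (rule torus_linear.abs_eq)

lemma real_matrix_lattice: "m \<in> int_lattice \<Longrightarrow> real_matrix A *v m \<in> int_lattice"
  by (simp add: int_lattice_def real_matrix_apply)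

lemma linear_real_matrix_funpow: "linear (((*v) (real_matrix A)) ^^ n)"
proof (induction n)
  case (Suc n)
  show ?case unfolding funpow.simps by (rule linear_compose[OF Suc matrix_vector_mul_linear])
qed (simp add: linear_id[unfolded id_def] id_def)

lemma torus_linear_deriv:
  "blinfun_apply (torus_deriv (torus_linear A ^^ n) p) v = ((*v) (real_matrix A) ^^ n) v"
proof -
  let ?a = "(*v) (real_matrix A)"
  have bl: "bounded_linear (?a ^^ n)" using linear_real_matrix_funpow by (simp add: linear_conv_bounded_linear)
  obtain x where x: "torus_proj x = p" using torus_proj_surj by blast
  have "torus_has_derivative (torus_linear A ^^ n) (Blinfun (?a ^^ n)) (torus_proj x)"
  proof (rule torus_has_derivativeI)
    show "torus_proj ((?a ^^ n) y) = (torus_linear A ^^ n) (torus_proj y)" for y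
      by (rule funpow_lift) (simp only: torus_linear_proj)
    show "((?a ^^ n) has_derivative blinfun_apply (Blinfun (?a ^^ n))) (at x)"
      unfolding bounded_linear_Blinfun_apply[OF bl] by (rule bounded_linear_imp_has_derivative[OF bl])
  qed
  then have "torus_deriv (torus_linear A ^^ n) p = Blinfun (?a ^^ n)" unfolding x by (rule torus_deriv_eqI)
  then show ?thesis by (simp only: bounded_linear_Blinfun_apply[OF bl])
qed

lemma torus_linear_local_diffeo_inj:
  assumes "torus_local_diffeo (torus_linear A)" "real_matrix A *v x = 0"
  shows "x = 0"
proof (rule ccontr)
  assume x: "x \<noteq> 0"
  obtain U where U: "open U" "torus_proj 0 \<in> U" "inj_on (torus_linear A) U"
    by (rule local_diffeo_locally_inj[OF assms(1)]) (rule that)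
  have "open (torus_proj -` U)" using U(1) by (simp only: open_torus_iff_quotient)
  moreover have "0 \<in> torus_proj -` U" using U(2) by simp
  ultimately obtain e where e: "e > 0" "ball 0 e \<subseteq> torus_proj -` U" by (rule openE)
  define c where "c = min (e / 2) (1 / 2) / norm x"
  have c: "c > 0" "norm (c *\<^sub>R x) < e" "norm (c *\<^sub>R x) < 1"
    using e(1) x by (auto simp: c_def)
  have "torus_linear A (torus_proj (c *\<^sub>R x)) = torus_linear A (torus_proj 0)"
    using assms(2) by (simp add: torus_linear_proj matrix_vector_mult_scaleR)
  moreover have "c *\<^sub>R x \<in> torus_proj -` U" using e(2) c(2) by (auto simp: subset_iff)
  ultimately have "torus_proj (c *\<^sub>R x) = torus_proj 0"
    using inj_onD[OF U(3)] U(2) by simp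
  then have "c *\<^sub>R x = 0" by (rule torus_proj_inj_near) (use c(3) in simp)
  then show False using c(1) x by simp
qed

text \<open>
  The fibre \<open>S\<close> of the stable bundle over the fixed point \<open>0\<close> is an invariant subspace of the plane.
  It is not zero, since the map would then be expanding. It is not the plane, since a nonzero
  integer vector keeps norm at least 1 under iteration. Hence it is a line, spanned by an eigenvector.
\<close>

lemma linear_anosov_stable_eigenvalue:
  assumes A: "linear_anosov A"
  obtains ls e where "0 < \<bar>ls\<bar>" "\<bar>ls\<bar> < 1" "e \<noteq> 0" "real_matrix A *v e = ls *\<^sub>R e"
proof -
  let ?a = "(*v) (real_matrix A)"
  let ?f = "torus_linear A"
  have am: "anosov_map ?f" using A by (simp only: linear_anosov_def)
  then have ld: "torus_local_diffeo ?f" and nex: "\<not> expanding_map ?f"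
    by (simp_all add: anosov_map_def anosov_local_diffeo_def)
  obtain E C \<mu> where E: "continuous_subbundle E" and inv: "\<And>p. torus_deriv ?f p ` E p = E (?f p)"
    and C: "C > 0" "0 < \<mu>" "\<mu> < 1"
    and con: "\<And>n p v. v \<in> E p \<Longrightarrow> norm (torus_deriv (?f ^^ n) p v) \<le> C * \<mu> ^ n * norm v"
    and ex: "\<And>n p v. infdist v (E p) \<le> C * \<mu> ^ n * infdist (torus_deriv (?f ^^ n) p v) (E ((?f ^^ n) p))"
    using am unfolding anosov_map_def anosov_local_diffeo_def by metis
  define S where "S = E (torus_proj 0)"
  have S: "subspace S" unfolding S_def by (rule continuous_subbundle_subspace[OF E])
  have f0: "?f (torus_proj 0) = torus_proj 0" by (simp add: torus_linear_proj)
  have fn0: "(?f ^^ n) (torus_proj 0) = torus_proj 0" for n by (induction n) (simp_all add: f0)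
  have d1: "torus_deriv ?f p v = ?a v" for p v using torus_linear_deriv[where n = 1 and A = A and p = p and v = v] by simp
  have Sinv: "?a v \<in> S" if "v \<in> S" for v
  proof -
    have "torus_deriv ?f (torus_proj 0) v \<in> E (?f (torus_proj 0))"
      using that unfolding inv[symmetric] S_def by (rule imageI)
    then show ?thesis by (simp add: d1 f0 S_def)
  qed
  have conS: "norm ((?a ^^ n) v) \<le> C * \<mu> ^ n * norm v" if "v \<in> S" for n v
    using con[of v "torus_proj 0" n] that by (simp add: torus_linear_deriv S_def)
  have "S \<noteq> {0}"
  proof
    assume S0: "S = {0}"
    have "norm v \<le> C * \<mu> ^ n * norm ((?a ^^ n) v)" for n v
      using ex[of v "torus_proj 0" n] S0 by (simp add: torus_linear_deriv fn0 flip: S_def)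
    then have "expanding_map ?f"
      unfolding expanding_map_def torus_linear_deriv using C ld by blast
    then show False using nex by blast
  qed
  then obtain e where e: "e \<in> S" "e \<noteq> 0" using subspace_0[OF S] by blast
  have inj: "x = 0" if "?a x = 0" for x by (rule torus_linear_local_diffeo_inj[OF ld that])
  \<comment> \<open>The determinant of \<open>e\<close> and \<open>A e\<close>. If it did not vanish, these two vectors of \<open>S\<close> would span the plane;
    the coefficients of \<open>x\<close> below are given by the rule of Cramer.\<close>
  define D where "D = e $ 1 * (?a e) $ 2 - e $ 2 * (?a e) $ 1"
  have "D = 0"
  proof (rule ccontr)
    assume D: "D \<noteq> 0"
    define x where "x = (axis 1 1 :: real^2)"
    have x1: "x $ 1 = 1" "x $ 2 = 0" by (simp_all add: x_def axis_def)
    have "x = ((?a e) $ 2 / D) *\<^sub>R e + (- (e $ 2) / D) *\<^sub>R ?a e"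
      using D by (simp add: vec_eq_iff forall_2 x1 field_simps) (simp add: D_def algebra_simps)
    moreover have "((?a e) $ 2 / D) *\<^sub>R e + (- (e $ 2) / D) *\<^sub>R ?a e \<in> S"
      by (intro subspace_add[OF S] subspace_scale[OF S] e(1) Sinv)
    ultimately have xS: "x \<in> S" by simp
    obtain n where n: "C * \<mu> ^ n < 1" by (rule geometric_below[OF C(2,3) zero_less_one]) (rule that)
    have "norm x = 1" by (simp add: x_def norm_axis_1)
    then have "norm ((?a ^^ n) x) < 1" using conS[OF xS, of n] n by simp
    moreover have "(?a ^^ n) x \<in> int_lattice \<and> (?a ^^ n) x \<noteq> 0"
    proof (induction n)
      case 0
      show ?case using x1 by (auto simp: int_lattice_def forall_2)
    next
      case (Suc n)
      then show ?case using real_matrix_lattice[of "(?a ^^ n) x" A] inj[of "(?a ^^ n) x"] by auto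
    qed
    ultimately show False using lattice_norm_less_1 by blast
  qed
  define ls where "ls = ((?a e) $ 1 * e $ 1 + (?a e) $ 2 * e $ 2) / ((e $ 1)^2 + (e $ 2)^2)"
  have e2: "(e $ 1)^2 + (e $ 2)^2 \<noteq> 0"
    using e(2) by (simp add: vec_eq_iff forall_2 sum_power2_eq_zero_iff)
  have ae: "?a e = ls *\<^sub>R e"
  proof -
    have *: "w1 = (w1 * e1 + w2 * e2) / (e1^2 + e2^2) * e1 \<and> w2 = (w1 * e1 + w2 * e2) / (e1^2 + e2^2) * e2"
      if "e1^2 + e2^2 \<noteq> 0" "e1 * w2 - e2 * w1 = 0" for w1 w2 e1 e2 :: real
    proof -
      have "e1 * w2 = e2 * w1" using that(2) by simp
      then have "w1 * (e1^2 + e2^2) = (w1 * e1 + w2 * e2) * e1" "w2 * (e1^2 + e2^2) = (w1 * e1 + w2 * e2) * e2"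
        by algebra+
      then show ?thesis using that(1) by (simp add: eq_divide_eq)
    qed
    show ?thesis using *[OF e2 \<open>D = 0\<close>[unfolded D_def]] by (simp add: vec_eq_iff forall_2 ls_def)
  qed
  have an: "(?a ^^ n) e = ls ^ n *\<^sub>R e" for n
    by (induction n) (simp_all add: matrix_vector_mult_scaleR ae)
  have ls0: "ls \<noteq> 0" using inj[of e] e(2) ae by auto
  have ls1: "\<bar>ls\<bar> < 1"
  proof (rule ccontr)
    assume "\<not> \<bar>ls\<bar> < 1"
    then have p1: "1 \<le> \<bar>ls\<bar> ^ n" for n by (intro one_le_power) simp
    obtain n where n: "C * \<mu> ^ n < 1" by (rule geometric_below[OF C(2,3) zero_less_one]) (rule that)
    have "\<bar>ls\<bar> ^ n * norm e \<le> C * \<mu> ^ n * norm e" using conS[OF e(1), of n] by (simp add: an power_abs)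
    then have "\<bar>ls\<bar> ^ n \<le> C * \<mu> ^ n" using e(2) by simp
    then show False using p1[of n] n by simp
  qed
  show thesis by (rule that[OF _ ls1 e(2) ae]) (use ls0 in simp)
qed

text \<open>
  A non-invertible map has \<open>\<bar>det A\<bar> \<ge> 2\<close>, so that \<open>\<bar>lu\<bar> > 2\<close>, and its matrix maps some vector \<open>w\<close>
  outside the lattice into the lattice. Let \<open>i\<close> be a coordinate in which \<open>w\<close> is not an integer. As \<open>ls\<close>
  is not an integer, neither eigenvector lies on a coordinate axis; so the basis can be scaled to have
  \<open>es $ i = 1\<close> and \<open>eu $ i = \<beta>\<close>, for a positive \<open>\<beta>\<close> as small as desired.
\<close>

lemma linear_anosov_coordinates:
  assumes A: "linear_anosov A"
  obtains ls lu \<beta> :: real and es eu :: "real^2" and \<sigma> \<tau> :: "real^2 \<Rightarrow> real" and i w where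
    "linear \<sigma>" "linear \<tau>" "\<And>x. \<sigma> x *\<^sub>R es + \<tau> x *\<^sub>R eu = x"
    "\<And>s u. \<sigma> (s *\<^sub>R es + u *\<^sub>R eu) = s" "\<And>s u. \<tau> (s *\<^sub>R es + u *\<^sub>R eu) = u"
    "\<And>x. \<sigma> (real_matrix A *v x) = ls * \<sigma> x" "\<And>x. \<tau> (real_matrix A *v x) = lu * \<tau> x"
    "0 < \<bar>ls\<bar>" "\<bar>ls\<bar> < 1" "2 < \<bar>lu\<bar>" "\<bar>\<beta>\<bar> \<le> 1/2" "\<bar>ls\<bar> + 1 + \<bar>\<beta>\<bar> < \<bar>lu\<bar>"
    "\<And>x. x $ i = \<sigma> x + \<beta> * \<tau> x" "real_matrix A *v w \<in> int_lattice" "w $ i \<notin> \<int>"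
proof -
  let ?a = "(*v) (real_matrix A)"
  let ?f = "torus_linear A"
  have ld: "torus_local_diffeo ?f" and nb: "\<not> bij ?f"
    using A by (simp_all add: linear_anosov_def anosov_map_def anosov_local_diffeo_def)
  have inj: "x = 0" if "?a x = 0" for x by (rule torus_linear_local_diffeo_inj[OF ld that])
  obtain ls e where ls: "0 < \<bar>ls\<bar>" "\<bar>ls\<bar> < 1" and e: "e \<noteq> 0" "?a e = ls *\<^sub>R e"
    by (rule linear_anosov_stable_eigenvalue[OF A]) (rule that)
  define p q r s where "p = real_of_int (A $ 1 $ 1)" and "q = real_of_int (A $ 1 $ 2)"
    and "r = real_of_int (A $ 2 $ 1)" and "s = real_of_int (A $ 2 $ 2)"
  have ints: "p \<in> \<int>" "q \<in> \<int>" "r \<in> \<int>" "s \<in> \<int>" by (simp_all add: p_def q_def r_def s_def)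
  have a1: "(?a x) $ 1 = p * x $ 1 + q * x $ 2" and a2: "(?a x) $ 2 = r * x $ 1 + s * x $ 2" for x
    by (simp_all add: real_matrix_apply p_def q_def r_def s_def)
  have lsZ: "ls \<notin> \<int>" using ls Ints_nonzero_abs_less1[of ls] by auto
  have char: "(p - ls) * (s - ls) = q * r"
  proof -
    have h: "p * e $ 1 + q * e $ 2 = ls * e $ 1" "r * e $ 1 + s * e $ 2 = ls * e $ 2"
      using arg_cong[OF e(2), of "\<lambda>x. x $ 1"] arg_cong[OF e(2), of "\<lambda>x. x $ 2"] by (simp_all add: a1 a2)
    have "((p - ls) * (s - ls) - q * r) * e $ 1 = 0" "((p - ls) * (s - ls) - q * r) * e $ 2 = 0"
      using h by algebra+
    moreover have "e $ 1 \<noteq> 0 \<or> e $ 2 \<noteq> 0" using e(1) by (simp add: vec_eq_iff forall_2)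
    ultimately have "(p - ls) * (s - ls) - q * r = 0" by (auto simp only: mult_eq_0_iff)
    then show ?thesis by simp
  qed
  have pls: "p \<noteq> ls" "s \<noteq> ls" using lsZ ints by auto
  then have q0: "q \<noteq> 0" using char by auto
  define lu where "lu = p + s - ls"
  define d where "d = p * s - q * r"
  have lslu: "ls * lu = d" using char unfolding lu_def d_def by algebra
  have char': "(p - lu) * (s - lu) = q * r" using char unfolding lu_def by algebra
  have plu: "p \<noteq> lu" using pls(2) by (simp add: lu_def)
  have surj_a: "\<exists>x. ?a x = y" for y
  proof -
    have "inj ?a"
      using linear_injective_0[OF matrix_vector_mul_linear] inj by blast
    then have "surj ?a" by (rule linear_inj_imp_surj[OF matrix_vector_mul_linear])
    then show ?thesis by (metis surjD)
  qed
  have "\<exists>y\<in>int_lattice. \<forall>x\<in>int_lattice. ?a x \<noteq> y"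
  proof (rule ccontr)
    assume n: "\<not> ?thesis"
    have "inj ?f"
    proof (rule injI)
      fix P Q assume PQ: "?f P = ?f Q"
      obtain x y where xy: "torus_proj x = P" "torus_proj y = Q" using torus_proj_surj by metis
      have "torus_proj (?a x) = torus_proj (?a y)" using PQ by (simp add: torus_linear_proj flip: xy)
      then have "?a x - ?a y \<in> int_lattice" by (simp only: torus_proj_eq_iff_lattice)
      then obtain m where m: "m \<in> int_lattice" "?a m = ?a x - ?a y" using n by blast
      then have "?a (x - y - m) = 0" by (simp add: matrix_vector_mult_diff_distrib)
      then have "x - y - m = 0" by (rule inj)
      then have "x - y = m" by simp
      then show "P = Q" using m(1) by (simp add: torus_proj_eq_iff_lattice flip: xy)
    qed
    moreover have "surj ?f"
    proof -
      have "\<exists>P. ?f P = Q" for Q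
      proof -
        obtain y where y: "torus_proj y = Q" using torus_proj_surj by blast
        obtain x where "?a x = y" using surj_a by blast
        then have "?f (torus_proj x) = Q" by (simp add: torus_linear_proj y)
        then show ?thesis by blast
      qed
      then show ?thesis unfolding surj_def by metis
    qed
    ultimately show False using nb by (simp add: bij_def)
  qed
  then obtain y where y: "y \<in> int_lattice" "\<And>x. x \<in> int_lattice \<Longrightarrow> ?a x \<noteq> y" by blast
  obtain w where w: "?a w = y" using surj_a by blast
  then have "w \<notin> int_lattice" using y(2) by blast
  then obtain i where wi: "w $ i \<notin> \<int>" by (auto simp: int_lattice_def)
  have dZ: "d \<in> \<int>" using ints by (simp add: d_def)
  have d2: "2 \<le> \<bar>d\<bar>"
  proof (rule ccontr)
    assume n: "\<not> 2 \<le> \<bar>d\<bar>"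
    obtain k where k: "d = of_int k" using dZ by (rule Ints_cases)
    have "\<bar>k\<bar> < 2" using n unfolding k by linarith
    then have "k = 0 \<or> k = 1 \<or> k = -1" by linarith
    then have "d = 0 \<or> d * d = 1" by (auto simp: k)
    then show False
    proof
      assume "d = 0"
      then have "?a (vector [q, - p]) = 0" by (simp add: vec_eq_iff forall_2 a1 a2 d_def algebra_simps)
      then have "vector [q, - p] = (0 :: real^2)" by (rule inj)
      from arg_cong[OF this, of "\<lambda>x. x $ 1"] show False using q0 by (simp only: vector_2 zero_index)
    next
      assume dd: "d * d = 1"
      \<comment> \<open>For determinant \<open>\<plusminus>1\<close> the adjugate matrix, multiplied by \<open>d\<close>, is an integral inverse.\<close>
      let ?x = "vector [d * (s * y $ 1 - q * y $ 2), d * (p * y $ 2 - r * y $ 1)] :: real^2"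
      have "?x \<in> int_lattice" using y(1) ints dZ by (simp add: int_lattice_def forall_2)
      moreover have "?a ?x = y"
      proof -
        have "p * (d * (s * y1 - q * y2)) + q * (d * (p * y2 - r * y1)) = y1"
          "r * (d * (s * y1 - q * y2)) + s * (d * (p * y2 - r * y1)) = y2" for y1 y2
          using dd unfolding d_def by algebra+
        then show ?thesis by (simp add: vec_eq_iff forall_2 a1 a2)
      qed
      ultimately show False using y(2) by blast
    qed
  qed
  have lu2: "2 < \<bar>lu\<bar>"
  proof -
    have "2 \<le> \<bar>ls\<bar> * \<bar>lu\<bar>" using d2 lslu by (simp flip: abs_mult)
    moreover from this have "\<bar>lu\<bar> \<noteq> 0" by auto
    then have "\<bar>ls\<bar> * \<bar>lu\<bar> < 1 * \<bar>lu\<bar>" using ls by (intro mult_strict_right_mono) auto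
    ultimately show ?thesis by simp
  qed
  define m1 m2 where "m1 = (ls - p) / q" and "m2 = (lu - p) / q"
  have m: "q * m1 = ls - p" "q * m2 = lu - p" using q0 by (simp_all add: m1_def m2_def)
  have m0: "m1 \<noteq> 0" "m2 \<noteq> 0" using pls plu q0 by (auto simp: m1_def m2_def)
  have "ls \<noteq> lu" using ls lu2 by auto
  then have m12: "m2 - m1 \<noteq> 0" using q0 by (simp add: m1_def m2_def)
  have rm: "r + s * m1 = ls * m1" "r + s * m2 = lu * m2"
  proof -
    have "q * (r + s * m1) = q * (ls * m1)" "q * (r + s * m2) = q * (lu * m2)"
      using m char char' by algebra+
    then show "r + s * m1 = ls * m1" "r + s * m2 = lu * m2" using q0 by simp_all
  qed
  define v1 v2 where "v1 = (vector [1, m1] :: real^2)" and "v2 = (vector [1, m2] :: real^2)"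
  have v: "v1 $ 1 = 1" "v1 $ 2 = m1" "v2 $ 1 = 1" "v2 $ 2 = m2" by (simp_all add: v1_def v2_def)
  have av: "?a v1 = ls *\<^sub>R v1" "?a v2 = lu *\<^sub>R v2"
    using m rm by (simp_all add: vec_eq_iff forall_2 a1 a2 v)
  have vi: "v1 $ i \<noteq> 0" "v2 $ i \<noteq> 0" using exhaust_2[of i] m0 by (auto simp: v)
  define \<beta> where "\<beta> = min (1/2) ((\<bar>lu\<bar> - \<bar>ls\<bar> - 1) / 2)"
  have \<beta>: "0 < \<beta>" "\<beta> \<le> 1/2" "\<bar>ls\<bar> + 1 + \<beta> < \<bar>lu\<bar>" using ls lu2 by (auto simp: \<beta>_def min_def field_simps)
  define c1 c2 where "c1 = 1 / v1 $ i" and "c2 = \<beta> / v2 $ i"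
  have c: "c1 \<noteq> 0" "c2 \<noteq> 0" using vi \<beta> by (simp_all add: c1_def c2_def)
  define es eu where "es = c1 *\<^sub>R v1" and "eu = c2 *\<^sub>R v2"
  define \<sigma> where "\<sigma> x = (m2 * x $ 1 - x $ 2) / ((m2 - m1) * c1)" for x :: "real^2"
  define \<tau> where "\<tau> x = (x $ 2 - m1 * x $ 1) / ((m2 - m1) * c2)" for x :: "real^2"
  have lin: "linear \<sigma>" "linear \<tau>"
    by (rule linearI; simp add: \<sigma>_def \<tau>_def add_divide_distrib diff_divide_distrib algebra_simps)+
  have dec: "\<sigma> x *\<^sub>R es + \<tau> x *\<^sub>R eu = x" for x
  proof -
    have "\<sigma> x * c1 = (m2 * x $ 1 - x $ 2) / (m2 - m1)" "\<tau> x * c2 = (x $ 2 - m1 * x $ 1) / (m2 - m1)"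
      using c by (simp_all add: \<sigma>_def \<tau>_def)
    then have "\<sigma> x *\<^sub>R es + \<tau> x *\<^sub>R eu =
        ((m2 * x $ 1 - x $ 2) / (m2 - m1)) *\<^sub>R v1 + ((x $ 2 - m1 * x $ 1) / (m2 - m1)) *\<^sub>R v2"
      by (simp add: es_def eu_def)
    also have "\<dots> = x"
    proof -
      have "(m2 * x1 - x2) / (m2 - m1) + (x2 - m1 * x1) / (m2 - m1) = x1"
        "(m2 * x1 - x2) / (m2 - m1) * m1 + (x2 - m1 * x1) / (m2 - m1) * m2 = x2" for x1 x2
        using m12 by (simp_all add: divide_simps) (simp_all add: algebra_simps)
      then show ?thesis by (simp add: vec_eq_iff forall_2 v)
    qed
    finally show ?thesis .
  qed
  have \<sigma>e: "\<sigma> es = 1" "\<tau> es = 0" "\<sigma> eu = 0" "\<tau> eu = 1"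
    using m12 c by (simp_all add: \<sigma>_def \<tau>_def es_def eu_def v) (simp_all add: divide_simps algebra_simps)
  have \<sigma>c: "\<sigma> (s *\<^sub>R es + u *\<^sub>R eu) = s" and \<tau>c: "\<tau> (s *\<^sub>R es + u *\<^sub>R eu) = u" for s u
    using lin by (simp_all add: linear_add linear_scale \<sigma>e)
  have ax: "?a x = (ls * \<sigma> x) *\<^sub>R es + (lu * \<tau> x) *\<^sub>R eu" for x
  proof -
    have "?a es = ls *\<^sub>R es" "?a eu = lu *\<^sub>R eu"
      by (simp_all add: es_def eu_def matrix_vector_mult_scaleR av)
    moreover have "?a x = ?a (\<sigma> x *\<^sub>R es + \<tau> x *\<^sub>R eu)" by (simp only: dec)
    ultimately show ?thesis
      by (simp only: matrix_vector_right_distrib matrix_vector_mult_scaleR scaleR_scaleR mult.commute)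
  qed
  show thesis
  proof (rule that[of \<sigma> \<tau> es eu ls lu \<beta> i w])
    show "x $ i = \<sigma> x + \<beta> * \<tau> x" for x
    proof -
      have "es $ i = 1" "eu $ i = \<beta>" using vi by (simp_all add: es_def eu_def c1_def c2_def)
      moreover have "x $ i = (\<sigma> x *\<^sub>R es + \<tau> x *\<^sub>R eu) $ i" by (simp only: dec)
      ultimately show ?thesis by (simp add: mult.commute)
    qed
    show "\<sigma> (?a x) = ls * \<sigma> x" "\<tau> (?a x) = lu * \<tau> x" for x by (simp_all only: ax \<sigma>c \<tau>c)
    show "?a w \<in> int_lattice" using w y(1) by simp
    show "\<bar>\<beta>\<bar> \<le> 1/2" "\<bar>ls\<bar> + 1 + \<bar>\<beta>\<bar> < \<bar>lu\<bar>" using \<beta> by simp_all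
  qed (fact lin dec \<sigma>c \<tau>c ls lu2 wi)+
qed

section \<open>A preimage away from the bump\<close>

context perturbed_saddle
begin

text \<open>
  Without bump and errors the two preimages would differ by \<open>w\<close>. These terms being small, the bump
  coordinates of the preimages differ by nearly \<open>bump_coord w\<close>, which is far from every integer; so they
  cannot both be close to integers.
\<close>

lemma preimage_branch_avoids_bump:
  assumes e: "\<sigma> e = ls * \<sigma> w" "\<tau> e = lu * \<tau> w"
    and B: "\<And>s. \<bar>B s\<bar> \<le> bmax"
    and w: "\<And>k. k \<in> \<int> \<Longrightarrow> \<omega> \<le> \<bar>bump_coord w - k\<bar>" and \<omega>: "0 < \<omega>"
    and small: "2 * (bmax + \<eta>) \<le> \<bar>ls\<bar> * (\<omega> / 8)" "2 * \<eta> \<le> \<omega> / 8" "\<rho> \<le> \<omega> / 4"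
  shows "(\<forall>k\<in>\<int>. \<rho> \<le> \<bar>bump_coord (inv F x) - k\<bar>) \<or> (\<forall>k\<in>\<int>. \<rho> \<le> \<bar>bump_coord (inv F (x + e)) - k\<bar>)"
proof (rule ccontr)
  define z0 z1 where "z0 = inv F x" and "z1 = inv F (x + e)"
  assume "\<not> ?thesis"
  then obtain k0 k1 where k: "k0 \<in> \<int>" "k1 \<in> \<int>" "\<bar>bump_coord z0 - k0\<bar> < \<rho>" "\<bar>bump_coord z1 - k1\<bar> < \<rho>"
    unfolding z0_def z1_def by (auto simp: not_le)
  have F: "F z0 = x" "F z1 = x + e" by (simp_all add: z0_def z1_def)
  have s1: "\<bar>ls * (\<sigma> z1 - \<sigma> z0 - \<sigma> w)\<bar> \<le> 2 * (bmax + \<eta>)"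
  proof -
    have "\<sigma> (F z1) = \<sigma> (F z0) + ls * \<sigma> w" using lin(1) by (simp add: F linear_add e)
    then have eq: "ls * (\<sigma> z1 - \<sigma> z0 - \<sigma> w) = (sgn ls * B (bump_coord z0) + \<alpha> z0) - (sgn ls * B (bump_coord z1) + \<alpha> z1)"
      unfolding F\<sigma> bump_coord_def by (simp add: algebra_simps)
    have *: "\<bar>(s0 + a0) - (s1 + a1)\<bar> \<le> 2 * (bmax + \<eta>)"
      if "\<bar>s0\<bar> \<le> bmax" "\<bar>s1\<bar> \<le> bmax" "\<bar>a0\<bar> \<le> \<eta>" "\<bar>a1\<bar> \<le> \<eta>" for s0 s1 a0 a1 :: real
      using that unfolding abs_le_iff by argo
    show ?thesis unfolding eq by (rule *) (unfold abs_sgn_ls_mult, (rule B \<alpha>(1))+)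
  qed
  have "\<bar>ls\<bar> * \<bar>\<sigma> z1 - \<sigma> z0 - \<sigma> w\<bar> \<le> \<bar>ls\<bar> * (\<omega> / 8)"
    using order_trans[OF s1 small(1)] unfolding abs_mult .
  then have s: "\<bar>\<sigma> z1 - \<sigma> z0 - \<sigma> w\<bar> \<le> \<omega> / 8" using ls(1) by (simp only: mult_le_cancel_left_pos)
  have t1: "\<bar>lu * (\<tau> z1 - \<tau> z0 - \<tau> w)\<bar> \<le> 2 * \<eta>"
  proof -
    have "\<tau> (F z1) = \<tau> (F z0) + lu * \<tau> w" using lin(2) by (simp add: F linear_add e)
    then have eq: "lu * (\<tau> z1 - \<tau> z0 - \<tau> w) = \<gamma> z0 - \<gamma> z1"
      unfolding F\<tau> by (simp add: algebra_simps)
    show ?thesis unfolding eq using \<gamma>(1)[of z0] \<gamma>(1)[of z1] by linarith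
  qed
  have "1 * \<bar>\<tau> z1 - \<tau> z0 - \<tau> w\<bar> \<le> \<bar>lu\<bar> * \<bar>\<tau> z1 - \<tau> z0 - \<tau> w\<bar>"
    using lu by (intro mult_right_mono) auto
  then have t: "\<bar>\<tau> z1 - \<tau> z0 - \<tau> w\<bar> \<le> \<omega> / 8"
    using order_trans[OF t1 small(2)] unfolding abs_mult mult_1 by (rule order_trans)
  have bt: "\<bar>\<beta> * (\<tau> z1 - \<tau> z0 - \<tau> w)\<bar> \<le> 1 * (\<omega> / 8)"
    unfolding abs_mult using \<beta> t by (intro mult_mono) auto
  have cw: "bump_coord w - (k1 - k0) = (bump_coord z1 - k1) - (bump_coord z0 - k0) - (\<sigma> z1 - \<sigma> z0 - \<sigma> w)
      - \<beta> * (\<tau> z1 - \<tau> z0 - \<tau> w)"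
    by (simp add: bump_coord_def algebra_simps)
  have *: "\<bar>p - q - s - t\<bar> < \<omega>" if "\<bar>p\<bar> < \<rho>" "\<bar>q\<bar> < \<rho>" "\<bar>s\<bar> \<le> \<omega> / 8" "\<bar>t\<bar> \<le> 1 * (\<omega> / 8)" for p q s t :: real
    using that small(3) \<omega> unfolding abs_le_iff abs_less_iff by argo
  have "\<bar>bump_coord w - (k1 - k0)\<bar> < \<omega>" unfolding cw by (rule *[OF k(4,3) s bt])
  moreover have "\<omega> \<le> \<bar>bump_coord w - (k1 - k0)\<bar>" by (rule w) (use k in auto)
  ultimately show False by simp
qed

end

section \<open>The perturbed map and its neighbourhood\<close>

lemma derivative_bounds_imp_slopes:
  fixes B B' :: "real \<Rightarrow> real"
  assumes dB: "\<And>x. (B has_real_derivative B' x) (at x)" and l: "\<And>x. - (l / 2) \<le> B' x" and u: "\<And>x. B' x \<le> 1"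
    and "l < 1"
  shows "\<bar>B x - B y\<bar> \<le> \<bar>x - y\<bar>" and "x \<le> y \<Longrightarrow> B y - B x \<ge> - (l / 2) * (y - x)"
proof -
  have "\<bar>B' x\<bar> \<le> 1" for x using l[of x] u[of x] assms(4) unfolding abs_le_iff by argo
  then have "norm (B x - B y) \<le> 1 * norm (x - y)"
    using has_field_derivative_at_within[OF dB]
    by (intro field_differentiable_bound[where S = UNIV and f' = B']) auto
  then show "\<bar>B x - B y\<bar> \<le> \<bar>x - y\<bar>" by simp
  assume "x \<le> y"
  then have "B x + (l / 2) * x \<le> B y + (l / 2) * y"
  proof (rule DERIV_nonneg_imp_nondecreasing)
    fix z
    have "((\<lambda>z. B z + (l / 2) * z) has_real_derivative B' z + (l / 2) * 1) (at z)"
      by (intro DERIV_add dB DERIV_cmult DERIV_ident)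
    moreover have "0 \<le> B' z + (l / 2) * 1" using l[of z] by argo
    ultimately show "\<exists>d. ((\<lambda>z. B z + (l / 2) * z) has_real_derivative d) (at z) \<and> 0 \<le> d" by blast
  qed
  moreover have "(l / 2) * (y - x) = (l / 2) * y - (l / 2) * x" by (rule right_diff_distrib)
  ultimately have "- ((l / 2) * (y - x)) \<le> B y - B x" by linarith
  then show "B y - B x \<ge> - (l / 2) * (y - x)" by (simp only: mult_minus_left)
qed

lemma flat_derivative_imp_contraction:
  fixes B B' :: "real \<Rightarrow> real"
  assumes dB: "\<And>x. (B has_real_derivative B' x) (at x)"
    and flat: "\<And>x. (\<forall>k\<in>\<int>. \<rho> / 2 \<le> \<bar>x - k\<bar>) \<Longrightarrow> \<bar>B' x\<bar> \<le> c"
    and s: "\<forall>k\<in>\<int>. \<rho> \<le> \<bar>s - k\<bar>" and t: "\<bar>s - t\<bar> \<le> \<rho> / 2"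
  shows "\<bar>B s - B t\<bar> \<le> c * \<bar>s - t\<bar>"
proof -
  have "norm (B s - B t) \<le> c * norm (s - t)"
  proof (rule field_differentiable_bound[where S = "cball s (\<rho> / 2)" and f' = B'])
    show "(B has_field_derivative B' z) (at z within cball s (\<rho> / 2))" for z
      by (rule has_field_derivative_at_within[OF dB])
    fix z assume z: "z \<in> cball s (\<rho> / 2)"
    have "\<rho> / 2 \<le> \<bar>z - k\<bar>" if k: "k \<in> \<int>" for k
    proof -
      have "\<rho> \<le> \<bar>s - k\<bar>" using s k by blast
      moreover have "\<bar>s - k\<bar> \<le> \<bar>s - z\<bar> + \<bar>z - k\<bar>" by linarith
      moreover have "\<bar>s - z\<bar> \<le> \<rho> / 2" using z by (simp add: dist_real_def)
      ultimately show ?thesis by argo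
    qed
    then show "norm (B' z) \<le> c" using flat by simp
  next
    show "s \<in> cball s (\<rho> / 2)" using order_trans[OF abs_ge_zero t] by simp
    show "t \<in> cball s (\<rho> / 2)" using t by (simp add: dist_real_def)
  qed simp
  then show ?thesis by simp
qed

text \<open>
  In the coordinates \<open>\<sigma>\<close> and \<open>\<tau>\<close> the differential is triangular, with diagonal entries
  \<open>ls + \<phi>' (x $ i)\<close> and \<open>lu\<close>; its inverse \<open>Ef\<close> is obtained by back substitution.
\<close>

lemma shear_perturbation_local_diffeo:
  fixes es eu :: "real^2" and \<sigma> \<tau> :: "real^2 \<Rightarrow> real" and a :: "real^2 \<Rightarrow> real^2" and \<phi> \<phi>' :: "real \<Rightarrow> real"
  assumes lin: "linear \<sigma>" "linear \<tau>" "linear a"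
    and dec: "\<And>x. \<sigma> x *\<^sub>R es + \<tau> x *\<^sub>R eu = x"
    and co: "\<And>s u. \<sigma> (s *\<^sub>R es + u *\<^sub>R eu) = s" "\<And>s u. \<tau> (s *\<^sub>R es + u *\<^sub>R eu) = u"
    and a: "\<And>x. \<sigma> (a x) = ls * \<sigma> x" "\<And>x. \<tau> (a x) = lu * \<tau> x" and lu: "lu \<noteq> 0"
    and xi: "\<And>x. x $ i = \<sigma> x + \<beta> * \<tau> x"
    and \<phi>: "\<And>t. (\<phi> has_real_derivative \<phi>' t) (at t)" "continuous_on UNIV \<phi>'" "\<And>t. ls + \<phi>' t \<noteq> 0"
    and f: "\<And>x. torus_proj (a x + \<phi> (x $ i) *\<^sub>R es) = f (torus_proj x)"
  shows "torus_local_diffeo f"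
proof -
  have bl: "bounded_linear \<sigma>" "bounded_linear \<tau>" "bounded_linear a"
    using lin by (simp_all add: linear_conv_bounded_linear)
  have bi: "bounded_linear (\<lambda>v::real^2. v $ i *\<^sub>R es)"
    by (intro bounded_linear_scaleR_const bounded_linear_vec_nth)
  define D where "D x = Blinfun a + \<phi>' (x $ i) *\<^sub>R Blinfun (\<lambda>v. v $ i *\<^sub>R es)" for x :: "real^2"
  define Ef where "Ef x v = ((\<sigma> v - (\<phi>' (x $ i) * \<beta> / lu) * \<tau> v) * (1 / (ls + \<phi>' (x $ i)))) *\<^sub>R es
      + (\<tau> v * (1 / lu)) *\<^sub>R eu" for x v :: "real^2"
  have bE: "bounded_linear (Ef x)" for x
    unfolding Ef_def
    by (intro bounded_linear_add bounded_linear_scaleR_const bounded_linear_mult_const bounded_linear_sub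
        bounded_linear_const_mult bl)
  have D: "blinfun_apply (D x) v = a v + (\<phi>' (x $ i) * v $ i) *\<^sub>R es" for x v
    unfolding D_def blinfun.add_left blinfun.scaleR_left bounded_linear_Blinfun_apply[OF bl(3)]
      bounded_linear_Blinfun_apply[OF bi] by simp
  have E: "blinfun_apply (Blinfun (Ef x)) v = Ef x v" for x v
    by (simp only: bounded_linear_Blinfun_apply[OF bE])
  have es1: "\<sigma> (c *\<^sub>R es) = c" "\<tau> (c *\<^sub>R es) = 0" for c using co[of c 0] by simp_all
  have \<sigma>D: "\<sigma> (blinfun_apply (D x) v) = ls * \<sigma> v + \<phi>' (x $ i) * (\<sigma> v + \<beta> * \<tau> v)"
    and \<tau>D: "\<tau> (blinfun_apply (D x) v) = lu * \<tau> v" for x v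
    unfolding D using lin by (simp_all add: linear_add a es1 xi)
  have \<sigma>E: "\<sigma> (Ef x v) = (\<sigma> v - (\<phi>' (x $ i) * \<beta> / lu) * \<tau> v) * (1 / (ls + \<phi>' (x $ i)))"
    and \<tau>E: "\<tau> (Ef x v) = \<tau> v * (1 / lu)" for x v
    by (simp_all only: Ef_def co)
  have eqI: "x = y" if "\<sigma> x = \<sigma> y" "\<tau> x = \<tau> y" for x y
    by (rule trans[OF dec[of x, symmetric] dec[of y, unfolded that[symmetric]]])
  show ?thesis
  proof (rule torus_local_diffeoI[where F = "\<lambda>x. a x + \<phi> (x $ i) *\<^sub>R es" and D = D and E = "\<lambda>x. Blinfun (Ef x)"])
    show "torus_proj (a x + \<phi> (x $ i) *\<^sub>R es) = f (torus_proj x)" for x by (rule f)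
    show "((\<lambda>x. a x + \<phi> (x $ i) *\<^sub>R es) has_derivative blinfun_apply (D x)) (at x)" for x
    proof -
      have "((\<lambda>x. x $ i) has_derivative (\<lambda>v. v $ i)) (at x)"
        by (intro bounded_linear_imp_has_derivative bounded_linear_vec_nth)
      from has_derivative_compose[OF this \<phi>(1)[of "x $ i", unfolded has_field_derivative_def]]
      have "((\<lambda>x. \<phi> (x $ i)) has_derivative (\<lambda>v. \<phi>' (x $ i) * v $ i)) (at x)" .
      from has_derivative_add[OF bounded_linear_imp_has_derivative[OF bl(3)] has_derivative_scaleR_left[OF this]]
      show ?thesis by (simp only: D[abs_def])
    qed
    show "continuous_on UNIV D"
      unfolding D_def
      by (intro continuous_on_add continuous_on_const continuous_on_scaleR
          continuous_on_compose2[OF \<phi>(2)] linear_continuous_on bounded_linear_vec_nth subset_UNIV)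
    show "Blinfun (Ef x) o\<^sub>L D x = id_blinfun" for x
    proof (rule blinfun_eqI)
      fix v
      have "Ef x (blinfun_apply (D x) v) = v"
      proof (rule eqI)
        show "\<sigma> (Ef x (blinfun_apply (D x) v)) = \<sigma> v"
          unfolding \<sigma>E \<sigma>D \<tau>D using lu \<phi>(3)[of "x $ i"] by (simp add: divide_simps) (simp add: algebra_simps)
        show "\<tau> (Ef x (blinfun_apply (D x) v)) = \<tau> v" unfolding \<tau>E \<tau>D using lu by simp
      qed
      then show "blinfun_apply (Blinfun (Ef x) o\<^sub>L D x) v = blinfun_apply id_blinfun v"
        by (simp add: E)
    qed
    show "D x o\<^sub>L Blinfun (Ef x) = id_blinfun" for x
    proof (rule blinfun_eqI)
      fix v
      have "blinfun_apply (D x) (Ef x v) = v"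
      proof (rule eqI)
        have *: "ls * ((S - (c * \<beta> / lu) * T) * (1 / (ls + c))) + c * ((S - (c * \<beta> / lu) * T) * (1 / (ls + c)) + \<beta> * (T * (1 / lu))) = S"
          if "ls + c \<noteq> 0" for c S T
        proof -
          have gen: "ls * W + c * (W + R) = (ls + c) * W + c * R" for W R by (simp add: algebra_simps)
          have "(ls + c) * ((S - (c * \<beta> / lu) * T) * (1 / (ls + c))) = S - (c * \<beta> / lu) * T" using that by simp
          then show ?thesis unfolding gen by simp
        qed
        show "\<sigma> (blinfun_apply (D x) (Ef x v)) = \<sigma> v"
          unfolding \<sigma>D \<sigma>E \<tau>E by (rule *[OF \<phi>(3)])
        show "\<tau> (blinfun_apply (D x) (Ef x v)) = \<tau> v" unfolding \<tau>D \<tau>E using lu by simp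
      qed
      then show "blinfun_apply (D x o\<^sub>L Blinfun (Ef x)) v = blinfun_apply id_blinfun v"
        by (simp add: E)
    qed
  qed
qed

lemma positive_lower_bound:
  fixes S :: "real set"
  assumes "finite S" "\<forall>x\<in>S. 0 < x"
  shows "\<exists>\<eta>>0. \<forall>x\<in>S. \<eta> \<le> x"
proof (cases "S = {}")
  case False
  then show ?thesis using assms by (intro exI[of _ "Min S"]) simp
qed (auto intro: exI[of _ 1])

text \<open>
  The map \<open>f0\<close> is \<open>A\<close> plus the bump in direction \<open>es\<close> with argument \<open>x $ i\<close>. The constants are
  chosen in the order \<open>\<omega>\<close> (the distance of \<open>w $ i\<close> to the integers), \<open>\<rho>\<close> (the radius of the bump),
  \<open>bmax\<close> (its height), then the bump itself, then the size \<open>\<eta>\<close> of the errors in the coordinates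
  \<open>\<sigma>\<close> and \<open>\<tau>\<close>, and at last the \<open>C\<^sup>1\<close>-radius \<open>\<epsilon>\<close>.
\<close>

lemma robustly_not_semiconjugate:
  assumes A: "linear_anosov A"
  obtains f0 \<epsilon> where "torus_local_diffeo f0" "\<epsilon> > 0"
    "\<And>f. torus_local_diffeo f \<Longrightarrow>
       (\<And>p. dist (f0 p) (f p) < \<epsilon> \<and> norm (torus_deriv f0 p - torus_deriv f p) < \<epsilon>) \<Longrightarrow>
       torus_homotopic f (torus_linear A) \<and> (\<forall>g. anosov_map g \<longrightarrow> \<not> semi_conjugate f g)"
proof -
  let ?a = "(*v) (real_matrix A)"
  obtain ls lu \<beta> :: real and es eu :: "real^2" and \<sigma> \<tau> :: "real^2 \<Rightarrow> real" and i w where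
    lin: "linear \<sigma>" "linear \<tau>" and dec: "\<And>x. \<sigma> x *\<^sub>R es + \<tau> x *\<^sub>R eu = x"
    and co: "\<And>s u. \<sigma> (s *\<^sub>R es + u *\<^sub>R eu) = s" "\<And>s u. \<tau> (s *\<^sub>R es + u *\<^sub>R eu) = u"
    and a\<sigma>: "\<And>x. \<sigma> (real_matrix A *v x) = ls * \<sigma> x" and a\<tau>: "\<And>x. \<tau> (real_matrix A *v x) = lu * \<tau> x"
    and ls: "0 < \<bar>ls\<bar>" "\<bar>ls\<bar> < 1" and lu: "2 < \<bar>lu\<bar>" and \<beta>: "\<bar>\<beta>\<bar> \<le> 1/2"
    and gap: "\<bar>ls\<bar> + 1 + \<bar>\<beta>\<bar> < \<bar>lu\<bar>"
    and xi: "\<And>x. x $ i = \<sigma> x + \<beta> * \<tau> x" and w: "real_matrix A *v w \<in> int_lattice" "w $ i \<notin> \<int>"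
    by (rule linear_anosov_coordinates[OF A]) (rule that)
  define l where "l = \<bar>ls\<bar>"
  have l: "0 < l" "l < 1" using ls by (simp_all add: l_def)
  define \<omega> where "\<omega> = \<bar>w $ i - of_int (round (w $ i))\<bar>"
  have \<omega>1: "\<omega> \<le> 1/2" unfolding \<omega>_def using of_int_round_abs_le[of "w $ i"] by (simp add: abs_minus_commute)
  have \<omega>0: "0 < \<omega>"
  proof -
    have "w $ i \<noteq> of_int (round (w $ i))" using w(2) by (metis Ints_of_int)
    then show ?thesis by (simp add: \<omega>_def)
  qed
  have \<omega>: "\<omega> \<le> \<bar>w $ i - k\<bar>" if "k \<in> \<int>" for k
  proof -
    obtain n where "k = of_int n" using \<open>k \<in> \<int>\<close> by (rule Ints_cases)
    then show ?thesis unfolding \<omega>_def using round_diff_minimal[of "w $ i" n] by simp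
  qed
  define \<rho> where "\<rho> = \<omega> / 4"
  have \<rho>: "0 < \<rho>" "\<rho> < 1" using \<omega>0 \<omega>1 by (simp_all add: \<rho>_def)
  define bmax where "bmax = min ((1 - l) * (\<rho> / 16)) (l * (\<omega> / 32))"
  have bmax: "0 < bmax" "bmax \<le> (1 - l) * (\<rho> / 16)" "bmax \<le> l * (\<omega> / 32)"
    using l \<rho> \<omega>0 by (simp_all add: bmax_def)
  obtain B B' :: "real \<Rightarrow> real" and a where
    dB: "\<And>x. (B has_real_derivative B' x) (at x)" "continuous_on UNIV B'"
    and Bper: "\<And>x k. k \<in> \<int> \<Longrightarrow> B (x + k) = B x" and Bodd: "\<And>x. B (- x) = - B x"
    and Bb: "\<And>x. \<bar>B x\<bar> \<le> bmax"
    and Bl: "\<And>x. - (l / 2) \<le> B' x" and Bu: "\<And>x. B' x \<le> 1"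
    and Bflat: "\<And>x. (\<forall>k\<in>\<int>. \<rho> / 2 \<le> \<bar>x - k\<bar>) \<Longrightarrow> \<bar>B' x\<bar> \<le> (1 - l) / 2"
    and a: "0 < a" "a < 1" "a < l * a + B a"
    by (rule sawtooth_exists[OF l \<rho> bmax(1)]) (rule that)
  \<comment> \<open>So \<open>1\<close> moves towards \<open>0\<close> by contraction alone and can play the role of \<open>b\<close>.\<close>
  have B1: "B 1 = 0"
  proof -
    have "B 0 = 0" using Bodd[of 0] by simp
    moreover have "B (0 + 1) = B 0" by (rule Bper) simp
    ultimately show ?thesis by simp
  qed
  have "0 < l / 16" "0 < (\<bar>lu\<bar> - l - 1 - \<bar>\<beta>\<bar>) / 4" "0 < (l * a + B a - a) / 4" "0 < (1 - l) / 16"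
    "0 < (1 - l) * (\<rho> / 16)" "0 < l * (\<omega> / 32)" "0 < \<rho> / 16"
    using l \<rho>(1) \<omega>0 a(3) gap[folded l_def] by simp_all
  then have "\<forall>x\<in>{l / 16, (\<bar>lu\<bar> - l - 1 - \<bar>\<beta>\<bar>) / 4, (l * a + B a - a) / 4, (1 - l) / 16,
      (1 - l) * (\<rho> / 16), l * (\<omega> / 32), \<rho> / 16}. 0 < x" by blast
  from positive_lower_bound[OF _ this] obtain \<eta> where \<eta>0: "0 < \<eta>"
    and b: "\<forall>x\<in>{l / 16, (\<bar>lu\<bar> - l - 1 - \<bar>\<beta>\<bar>) / 4, (l * a + B a - a) / 4, (1 - l) / 16,
      (1 - l) * (\<rho> / 16), l * (\<omega> / 32), \<rho> / 16}. \<eta> \<le> x" by blast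
  have \<eta>le: "\<eta> \<le> l / 16" "\<eta> \<le> (\<bar>lu\<bar> - l - 1 - \<bar>\<beta>\<bar>) / 4" "\<eta> \<le> (l * a + B a - a) / 4"
    "\<eta> \<le> (1 - l) / 16" "\<eta> \<le> (1 - l) * (\<rho> / 16)" "\<eta> \<le> l * (\<omega> / 32)" "\<eta> \<le> \<rho> / 16"
    by (rule bspec[OF b]; (rule insertI1 | rule insertI2)+)+
  obtain K1 where K1: "K1 > 0" "\<And>x. norm (\<sigma> x) \<le> norm x * K1"
    using bounded_linear.pos_bounded[of \<sigma>] lin(1) by (auto simp: linear_conv_bounded_linear)
  obtain K2 where K2: "K2 > 0" "\<And>x. norm (\<tau> x) \<le> norm x * K2"
    using bounded_linear.pos_bounded[of \<tau>] lin(2) by (auto simp: linear_conv_bounded_linear)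
  define K where "K = K1 + K2"
  define Kc where "Kc = norm es + norm eu + 1"
  have K: "K > 0" "\<bar>\<sigma> x\<bar> \<le> K * norm x" "\<bar>\<tau> x\<bar> \<le> K * norm x" for x
  proof -
    show "K > 0" using K1(1) K2(1) by (simp add: K_def)
    have "norm x * K1 \<le> norm x * K" "norm x * K2 \<le> norm x * K"
      using K1(1) K2(1) by (auto simp: K_def intro!: mult_left_mono)
    then show "\<bar>\<sigma> x\<bar> \<le> K * norm x" "\<bar>\<tau> x\<bar> \<le> K * norm x"
      using K1(2)[of x] K2(2)[of x] by (simp_all add: mult.commute)
  qed
  have Kc: "Kc > 0" "Kc \<ge> 1" "norm x \<le> Kc * (\<bar>\<sigma> x\<bar> + \<bar>\<tau> x\<bar>)" for x
  proof -
    show "Kc > 0" "Kc \<ge> 1" unfolding Kc_def by (simp_all add: add_nonneg_pos)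
    have "norm x \<le> \<bar>\<sigma> x\<bar> * norm es + \<bar>\<tau> x\<bar> * norm eu"
      using norm_triangle_ineq[of "\<sigma> x *\<^sub>R es" "\<tau> x *\<^sub>R eu"] by (simp add: dec)
    also have "\<dots> \<le> \<bar>\<sigma> x\<bar> * Kc + \<bar>\<tau> x\<bar> * Kc"
      unfolding Kc_def by (intro add_mono mult_left_mono) auto
    finally show "norm x \<le> Kc * (\<bar>\<sigma> x\<bar> + \<bar>\<tau> x\<bar>)" by (simp add: algebra_simps)
  qed
  define \<epsilon> where "\<epsilon> = min (1/4) (\<eta> / (K * Kc))"
  have \<epsilon>: "0 < \<epsilon>" "\<epsilon> \<le> 1/4" "K * \<epsilon> * Kc \<le> \<eta>" "K * \<epsilon> \<le> \<eta>"
  proof -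
    show "0 < \<epsilon>" using \<eta>0 K(1) Kc(1) by (simp add: \<epsilon>_def)
    show "\<epsilon> \<le> 1/4" unfolding \<epsilon>_def by (rule min.cobounded1)
    have "\<epsilon> \<le> \<eta> / (K * Kc)" unfolding \<epsilon>_def by (rule min.cobounded2)
    then have "\<epsilon> * (K * Kc) \<le> \<eta> / (K * Kc) * (K * Kc)"
      using K(1) Kc(1) by (intro mult_right_mono) simp_all
    then show k: "K * \<epsilon> * Kc \<le> \<eta>" using K(1) Kc(1) by (simp add: mult_ac)
    have "K * \<epsilon> * 1 \<le> K * \<epsilon> * Kc" using K(1) Kc(2) \<open>0 < \<epsilon>\<close> by (intro mult_left_mono) auto
    then show "K * \<epsilon> \<le> \<eta>" using k by simp
  qed
  define \<phi> where "\<phi> t = sgn ls * B t" for t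
  define \<phi>' where "\<phi>' t = sgn ls * B' t" for t
  define F0 where "F0 x = ?a x + \<phi> (x $ i) *\<^sub>R es" for x
  define f0 where "f0 p = torus_proj (F0 (rep_torus p))" for p
  have d\<phi>: "(\<phi> has_real_derivative \<phi>' t) (at t)" for t
    unfolding \<phi>_def[abs_def] \<phi>'_def by (rule DERIV_cmult[OF dB(1)])
  have c\<phi>': "continuous_on UNIV \<phi>'" unfolding \<phi>'_def[abs_def] by (intro continuous_on_mult continuous_on_const dB(2))
  have sgnl: "ls = sgn ls * l" "sgn ls \<noteq> 0" using ls by (auto simp: l_def sgn_mult_abs sgn_zero_iff)
  have nz: "ls + \<phi>' t \<noteq> 0" for t
  proof -
    have "ls + \<phi>' t = sgn ls * (l + B' t)" unfolding \<phi>'_def using sgnl(1) by (simp add: distrib_left)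
    moreover have "l + B' t > 0" using Bl[of t] l(1) by argo
    ultimately show ?thesis using sgnl(2) by simp
  qed
  have F0per: "F0 (x + m) = F0 x + ?a m" if m: "m \<in> int_lattice" for x m
  proof -
    have "m $ i \<in> \<int>" using m by (simp add: int_lattice_def)
    then have "\<phi> ((x + m) $ i) = \<phi> (x $ i)" by (simp add: \<phi>_def Bper)
    then show ?thesis by (simp add: F0_def matrix_vector_right_distrib)
  qed
  have F0f0: "torus_proj (F0 x) = f0 (torus_proj x)" for x
  proof -
    define m where "m = rep_torus (torus_proj x) - x"
    have m: "m \<in> int_lattice"
      unfolding m_def using torus_proj_rep[of "torus_proj x"] by (simp only: torus_proj_eq_iff_lattice)
    have "rep_torus (torus_proj x) = x + m" by (simp add: m_def)
    then show ?thesis by (simp add: f0_def F0per[OF m] torus_proj_add_lattice[OF real_matrix_lattice[OF m]])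
  qed
  have lu0: "lu \<noteq> 0" using lu by auto
  have ld0: "torus_local_diffeo f0"
    by (rule shear_perturbation_local_diffeo[OF lin matrix_vector_mul_linear dec co a\<sigma> a\<tau> lu0 xi d\<phi> c\<phi>' nz
          F0f0[unfolded F0_def]])
  have c\<phi>: "continuous_on UNIV \<phi>"
    by (intro continuous_at_imp_continuous_on ballI DERIV_isCont[OF d\<phi>])
  have cF0: "continuous_on UNIV F0"
    unfolding F0_def[abs_def]
    by (intro continuous_on_add linear_continuous_on continuous_on_scaleR continuous_on_const
        continuous_on_compose2[OF c\<phi>] matrix_vector_mul_bounded_linear bounded_linear_vec_nth subset_UNIV)
  note slopes = derivative_bounds_imp_slopes[OF dB(1) Bl Bu l(2)]
  show thesis
  proof (rule that[OF ld0 \<epsilon>(1)])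
    fix f assume f: "torus_local_diffeo f"
      and near: "\<And>p. dist (f0 p) (f p) < \<epsilon> \<and> norm (torus_deriv f0 p - torus_deriv f p) < \<epsilon>"
    obtain v where v: "\<And>x. torus_proj (F0 x + v x) = f (torus_proj x)" "\<And>x. norm (v x) \<le> \<epsilon>"
      "\<And>x y. norm (v x - v y) \<le> \<epsilon> * norm (x - y)" "\<And>x m. m \<in> int_lattice \<Longrightarrow> v (x + m) = v x"
    proof (rule C1_close_map_lift[OF f ld0 F0f0 cF0 _ _ _ \<epsilon>(2)])
      show "F0 (x + m) - F0 x \<in> int_lattice" if "m \<in> int_lattice" for x m
        using that by (simp add: F0per real_matrix_lattice)
      show "dist (f0 p) (f p) < \<epsilon>" "norm (torus_deriv f0 p - torus_deriv f p) < \<epsilon>" for p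
        using near[of p] by simp_all
    qed (rule that)
    define F where "F x = F0 x + v x" for x
    have Ff: "torus_proj (F x) = f (torus_proj x)" for x unfolding F_def by (rule v(1))
    define \<alpha> \<gamma> where "\<alpha> x = \<sigma> (v x)" and "\<gamma> x = \<tau> (v x)" for x
    have es1: "\<sigma> (c *\<^sub>R es) = c" "\<tau> (c *\<^sub>R es) = 0" for c using co[of c 0] by simp_all
    have vb: "K * norm (v x) \<le> \<eta>" for x
      using order_trans[OF mult_left_mono[OF v(2)] \<epsilon>(4)] K(1) by (simp add: less_imp_le)
    have vl: "K * norm (v x - v y) \<le> \<eta> * (\<bar>\<sigma> x - \<sigma> y\<bar> + \<bar>\<tau> x - \<tau> y\<bar>)" for x y
    proof -
      let ?N = "\<bar>\<sigma> x - \<sigma> y\<bar> + \<bar>\<tau> x - \<tau> y\<bar>"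
      have "norm (x - y) \<le> Kc * ?N" using Kc(3)[of "x - y"] lin by (simp add: linear_diff)
      then have "\<epsilon> * norm (x - y) \<le> \<epsilon> * (Kc * ?N)" using \<epsilon>(1) by (intro mult_left_mono) auto
      with v(3)[of x y] have "norm (v x - v y) \<le> \<epsilon> * (Kc * ?N)" by (rule order_trans)
      then have "K * norm (v x - v y) \<le> K * (\<epsilon> * (Kc * ?N))" using K(1) by (intro mult_left_mono) auto
      also have "\<dots> = (K * \<epsilon> * Kc) * ?N" by (simp only: mult.assoc)
      also have "\<dots> \<le> \<eta> * ?N" by (intro mult_right_mono \<epsilon>(3)) auto
      finally show ?thesis .
    qed
    interpret perturbed_saddle F es eu \<sigma> \<tau> \<alpha> \<gamma> B ls lu \<beta> \<eta> a 1
    proof (rule perturbed_saddle.intro)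
      show "\<sigma> (F x) = ls * \<sigma> x + sgn ls * B (\<sigma> x + \<beta> * \<tau> x) + \<alpha> x" for x
        using lin(1) by (simp add: F_def F0_def linear_add a\<sigma> es1 \<phi>_def \<alpha>_def xi)
      show "\<tau> (F x) = lu * \<tau> x + \<gamma> x" for x
        using lin(2) by (simp add: F_def F0_def linear_add a\<tau> es1 \<gamma>_def)
      show "\<eta> < \<bar>ls\<bar> / 8" using \<eta>le(1) l(1) unfolding l_def by argo
      show "\<bar>ls\<bar> + 1 + \<bar>\<beta>\<bar> + 4 * \<eta> \<le> \<bar>lu\<bar>" using \<eta>le(2) unfolding l_def by argo
      show "\<bar>\<alpha> x\<bar> \<le> \<eta>" for x unfolding \<alpha>_def by (rule order_trans[OF K(2) vb])
      show "\<bar>\<gamma> x\<bar> \<le> \<eta>" for x unfolding \<gamma>_def by (rule order_trans[OF K(3) vb])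
      show "\<bar>\<alpha> x - \<alpha> y\<bar> \<le> \<eta> * (\<bar>\<sigma> x - \<sigma> y\<bar> + \<bar>\<tau> x - \<tau> y\<bar>)" for x y
        unfolding \<alpha>_def linear_diff[OF lin(1), symmetric]
        using order_trans[OF K(2)[of "v x - v y"] vl[of x y]] by (simp only: linear_diff[OF lin(1)])
      show "\<bar>\<gamma> x - \<gamma> y\<bar> \<le> \<eta> * (\<bar>\<sigma> x - \<sigma> y\<bar> + \<bar>\<tau> x - \<tau> y\<bar>)" for x y
        using order_trans[OF K(3)[of "v x - v y"] vl[of x y]] by (simp only: linear_diff[OF lin(2)] \<gamma>_def)
      show "\<bar>B x - B y\<bar> \<le> \<bar>x - y\<bar>" for x y by (rule slopes(1))
      show "- (\<bar>ls\<bar> / 2) * (y - x) \<le> B y - B x" if "x \<le> y" for x y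
        using slopes(2)[OF that] by (simp only: l_def)
      show "a + 2 * \<eta> < \<bar>ls\<bar> * a + B a" using \<eta>le(3) \<eta>0 a(3) unfolding l_def[symmetric] by argo
      show "\<bar>ls\<bar> * 1 + B 1 + 2 * \<eta> < 1" using \<eta>le(4) l(2) unfolding l_def[symmetric] B1 by argo
    qed (fact lin dec co ls lu \<beta> \<eta>0 Bodd a)+
    have ci: "bump_coord x = x $ i" for x by (simp only: bump_coord_def xi)
    have "torus_homotopic f (torus_linear A)"
    proof (rule torus_homotopic_of_lifts[where F = F and G = ?a and L = ?a])
      show "torus_proj (F x) = f (torus_proj x)" for x by (rule Ff)
      show "continuous_on UNIV F" by (rule continuous_F)
      show "torus_proj (?a x) = torus_linear A (torus_proj x)" for x by (simp only: torus_linear_proj)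
      show "continuous_on UNIV ?a" by (intro linear_continuous_on matrix_vector_mul_bounded_linear)
      show "F (x + m) = F x + ?a m" if "m \<in> int_lattice" for x m
        by (simp add: F_def F0per[OF that] v(4)[OF that])
      show "?a (x + m) = ?a x + ?a m" for x m by (rule matrix_vector_right_distrib)
      show "?a m \<in> int_lattice" if "m \<in> int_lattice" for m by (rule real_matrix_lattice[OF that])
    qed
    moreover have "\<not> semi_conjugate f g" if g: "anosov_map g" for g
    proof
      assume "semi_conjugate f g"
      then obtain h where h: "continuous_on UNIV h" "torus_homotopic h id" "h \<circ> f = g \<circ> h"
        unfolding semi_conjugate_def by blast
      show False
      proof (rule no_semiconjugacy[where f = f and g = g and h = h and \<rho> = \<rho> and bmax = bmax])
        show "torus_proj (F x) = f (torus_proj x)" for x by (rule Ff)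
        show "anosov_local_diffeo g" using g by (simp add: anosov_map_def)
        show "continuous_on UNIV h" by (rule h(1))
        show "h (f p) = g (h p)" for p using fun_cong[OF h(3), of p] by simp
        show "torus_homotopic id h" by (rule homotopic_with_symD[OF h(2)])
        show "\<bar>B s\<bar> \<le> bmax" for s by (rule Bb)
        show "\<bar>B s - B t\<bar> \<le> (1 - \<bar>ls\<bar>) / 2 * \<bar>s - t\<bar>"
          if "\<forall>k\<in>\<int>. \<rho> \<le> \<bar>s - k\<bar>" "\<bar>s - t\<bar> \<le> \<rho> / 2" for s t
          using flat_derivative_imp_contraction[OF dB(1) Bflat that] by (simp only: l_def)
        show "2 * (bmax + \<eta>) \<le> (1 - \<bar>ls\<bar>) * (\<rho> / 4)"
        proof -
          have "(1 - l) * (\<rho> / 4) = 4 * ((1 - l) * (\<rho> / 16))" by simp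
          then show ?thesis using bmax(2) \<eta>le(5) unfolding l_def[symmetric] by argo
        qed
        show "2 * \<eta> \<le> \<rho> / 4" using \<eta>le(7) \<rho>(1) by argo
        show "\<eta> < (1 - \<bar>ls\<bar>) / 8" using \<eta>le(4) l(2) unfolding l_def[symmetric] by argo
        fix x
        have "(\<forall>k\<in>\<int>. \<rho> \<le> \<bar>bump_coord (inv F x) - k\<bar>) \<or> (\<forall>k\<in>\<int>. \<rho> \<le> \<bar>bump_coord (inv F (x + ?a w)) - k\<bar>)"
        proof (rule preimage_branch_avoids_bump[where w = w and \<omega> = \<omega>, OF a\<sigma> a\<tau> Bb _ \<omega>0])
          show "\<omega> \<le> \<bar>bump_coord w - k\<bar>" if "k \<in> \<int>" for k unfolding ci by (rule \<omega>[OF that])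
          have "l * (\<omega> / 8) = 4 * (l * (\<omega> / 32))" by simp
          then show "2 * (bmax + \<eta>) \<le> \<bar>ls\<bar> * (\<omega> / 8)" using bmax(3) \<eta>le(6) unfolding l_def[symmetric] by argo
          show "2 * \<eta> \<le> \<omega> / 8" using \<eta>le(7) \<omega>0 unfolding \<rho>_def by argo
          show "\<rho> \<le> \<omega> / 4" by (simp add: \<rho>_def)
        qed
        then show "\<exists>m\<in>int_lattice. \<forall>k\<in>\<int>. \<rho> \<le> \<bar>bump_coord (inv F (x + m)) - k\<bar>"
        proof
          assume "\<forall>k\<in>\<int>. \<rho> \<le> \<bar>bump_coord (inv F x) - k\<bar>"
          then show ?thesis by (intro bexI[of _ 0]) simp_all
        qed (rule bexI[OF _ w(1)])
      qed
    qed
    ultimately show "torus_homotopic f (torus_linear A) \<and> (\<forall>g. anosov_map g \<longrightarrow> \<not> semi_conjugate f g)" by blast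
  qed
qed

text \<open>
  Each map of the ball around \<open>f0\<close> is required to satisfy the estimates with a radius \<open>d < \<epsilon>\<close> common to
  all points, which leaves room \<open>\<epsilon> - d\<close> for a further perturbation.
\<close>

lemma linear_anosov_class_contains_open_set:
  assumes A: "linear_anosov A"
  shows "\<exists>\<U>. \<U> \<noteq> {} \<and> openin C1_local_diffeo_topology \<U> \<and>
         (\<forall>f\<in>\<U>. derived_from_anosov f \<and> (\<forall>g. anosov_map g \<longrightarrow> \<not> semi_conjugate f g)) \<and>
         (\<forall>f\<in>\<U>. torus_homotopic f (torus_linear A))"
proof -
  obtain f0 \<epsilon> where f0: "torus_local_diffeo f0" and \<epsilon>: "\<epsilon> > 0"
    and near: "\<And>f. torus_local_diffeo f \<Longrightarrow>
       (\<And>p. dist (f0 p) (f p) < \<epsilon> \<and> norm (torus_deriv f0 p - torus_deriv f p) < \<epsilon>) \<Longrightarrow>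
       torus_homotopic f (torus_linear A) \<and> (\<forall>g. anosov_map g \<longrightarrow> \<not> semi_conjugate f g)"
    by (rule robustly_not_semiconjugate[OF A]) metis
  define \<U> where "\<U> = {f. torus_local_diffeo f \<and> (\<exists>d<\<epsilon>. \<forall>p. dist (f0 p) (f p) < d \<and>
      norm (torus_deriv f0 p - torus_deriv f p) < d)}"
  have good: "torus_local_diffeo f \<and> torus_homotopic f (torus_linear A) \<and>
      (\<forall>g. anosov_map g \<longrightarrow> \<not> semi_conjugate f g)" if "f \<in> \<U>" for f
  proof -
    obtain d where f: "torus_local_diffeo f" and d: "d < \<epsilon>"
      "\<forall>p. dist (f0 p) (f p) < d \<and> norm (torus_deriv f0 p - torus_deriv f p) < d"
      using \<open>f \<in> \<U>\<close> unfolding \<U>_def by blast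
    have "dist (f0 p) (f p) < \<epsilon> \<and> norm (torus_deriv f0 p - torus_deriv f p) < \<epsilon>" for p
      using d(1) spec[OF d(2), of p] by linarith
    from near[OF f this] f show ?thesis by blast
  qed
  have "f0 \<in> \<U>"
    unfolding \<U>_def using f0 \<epsilon> by (auto intro!: exI[of _ "\<epsilon> / 2"])
  moreover have "openin C1_local_diffeo_topology \<U>"
    unfolding openin_C1_local_diffeo_topology
  proof (intro conjI ballI)
    show "\<U> \<subseteq> Collect torus_local_diffeo" unfolding \<U>_def by blast
    fix f assume "f \<in> \<U>"
    then obtain d where d: "d < \<epsilon>"
      "\<forall>p. dist (f0 p) (f p) < d \<and> norm (torus_deriv f0 p - torus_deriv f p) < d"
      unfolding \<U>_def by blast
    define e where "e = (\<epsilon> - d) / 2"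
    have e: "e > 0" "d + e < \<epsilon>" using d(1) by (simp_all add: e_def field_simps)
    show "\<exists>e>0. \<forall>g. torus_local_diffeo g \<and>
        (\<forall>p. dist (f p) (g p) < e \<and> norm (torus_deriv f p - torus_deriv g p) < e) \<longrightarrow> g \<in> \<U>"
    proof (intro exI[of _ e] conjI e(1) allI impI, elim conjE)
      fix g assume g: "torus_local_diffeo g"
        and ge: "\<forall>p. dist (f p) (g p) < e \<and> norm (torus_deriv f p - torus_deriv g p) < e"
      have "dist (f0 p) (g p) < d + e \<and> norm (torus_deriv f0 p - torus_deriv g p) < d + e" for p
        using spec[OF d(2), of p] spec[OF ge, of p] dist_triangle[of "f0 p" "g p" "f p"]
          dist_triangle[of "torus_deriv f0 p" "torus_deriv g p" "torus_deriv f p"]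
        unfolding dist_norm[of "torus_deriv _ p"] by linarith
      then show "g \<in> \<U>" unfolding \<U>_def using g e(2) by blast
    qed
  qed
  moreover have "derived_from_anosov f" if "f \<in> \<U>" for f
    using good[OF that] A unfolding derived_from_anosov_def by blast
  ultimately show ?thesis using good by (intro exI[of _ \<U>]) blast
qed

text \<open>
  The eigenvalues are \<open>2 - sqrt 2\<close> and \<open>2 + sqrt 2\<close>. Their product is 2, so that the inverse of the
  larger one is below the smaller one and both Anosov estimates hold with \<open>\<mu> = 2 - sqrt 2\<close>.
\<close>

lemma linear_anosov_example: "linear_anosov (vector [vector [3, 1], vector [1, 1]])"
proof -
  define A :: "int^2^2" where "A = vector [vector [3, 1], vector [1, 1]]"
  let ?a = "(*v) (real_matrix A)" and ?f = "torus_linear A"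
  have a: "(?a x) $ 1 = 3 * x $ 1 + x $ 2" "(?a x) $ 2 = x $ 1 + x $ 2" for x
    by (simp_all add: real_matrix_apply A_def)
  have bla: "bounded_linear ?a" by (rule matrix_vector_mul_bounded_linear)
  define c where "c x = (vector [(x $ 1 - x $ 2) / 2, (3 * x $ 2 - x $ 1) / 2] :: real^2)" for x :: "real^2"
  have c: "(c x) $ 1 = (x $ 1 - x $ 2) / 2" "(c x) $ 2 = (3 * x $ 2 - x $ 1) / 2" for x
    by (simp_all add: c_def)
  have blc: "bounded_linear c"
    unfolding linear_conv_bounded_linear[symmetric]
    by (rule linearI) (simp_all add: vec_eq_iff forall_2 c field_simps)
  have ac: "?a (c x) = x" and ca: "c (?a x) = x" for x
    by (simp_all add: vec_eq_iff forall_2 a c field_simps)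
  have ld: "torus_local_diffeo ?f"
  proof (rule torus_local_diffeoI[where F = ?a and D = "\<lambda>_. Blinfun ?a" and E = "\<lambda>_. Blinfun c"])
    show "torus_proj (?a x) = ?f (torus_proj x)" for x by (simp only: torus_linear_proj)
    show "(?a has_derivative blinfun_apply (Blinfun ?a)) (at x)" for x
      unfolding bounded_linear_Blinfun_apply[OF bla] by (rule bounded_linear_imp_has_derivative[OF bla])
    show "Blinfun c o\<^sub>L Blinfun ?a = id_blinfun" "Blinfun ?a o\<^sub>L Blinfun c = id_blinfun"
      by (rule blinfun_eqI; simp add: bounded_linear_Blinfun_apply[OF bla] bounded_linear_Blinfun_apply[OF blc] ac ca)+
  qed (rule continuous_on_const)
  define \<mu> \<nu> :: real where "\<mu> = 2 - sqrt 2" and "\<nu> = 2 + sqrt 2"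
  have s2: "sqrt 2 * sqrt 2 = (2::real)" "1 < sqrt (2::real)" "sqrt 2 < (2::real)"
    by (simp_all add: real_less_lsqrt)
  have \<mu>: "0 < \<mu>" "\<mu> < 1" "1 \<le> \<mu> * \<nu>" "\<mu> * \<mu> = 4 * \<mu> - 2" "\<nu> * \<nu> = 4 * \<nu> - 2" "0 < \<nu>" "\<mu> \<noteq> \<nu>"
  proof -
    show "0 < \<mu>" "\<mu> < 1" "0 < \<nu>" "\<mu> \<noteq> \<nu>" using s2 unfolding \<mu>_def \<nu>_def by linarith+
    have gen: "(2 - r) * (2 + r) = 4 - r * r" "(2 - r) * (2 - r) = 4 * (2 - r) - 4 + r * r"
      "(2 + r) * (2 + r) = 4 * (2 + r) - 4 + r * r" for r :: real by (simp_all add: algebra_simps)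
    show "1 \<le> \<mu> * \<nu>" "\<mu> * \<mu> = 4 * \<mu> - 2" "\<nu> * \<nu> = 4 * \<nu> - 2"
      unfolding \<mu>_def \<nu>_def gen s2(1) by simp_all
  qed
  define e1 e2 where "e1 = (vector [1, \<mu> - 3] :: real^2)" and "e2 = (vector [1, \<nu> - 3] :: real^2)"
  have e: "e1 $ 1 = 1" "e1 $ 2 = \<mu> - 3" "e2 $ 1 = 1" "e2 $ 2 = \<nu> - 3" by (simp_all add: e1_def e2_def)
  have ae: "?a e1 = \<mu> *\<^sub>R e1" "?a e2 = \<nu> *\<^sub>R e2"
    using \<mu>(4,5) by (simp_all add: vec_eq_iff forall_2 a e algebra_simps)
  have e10: "e1 \<noteq> 0"
  proof
    assume "e1 = 0"
    from arg_cong[OF this, of "\<lambda>x. x $ 1"] show False by (simp add: e)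
  qed
  have an: "(?a ^^ n) e1 = \<mu> ^ n *\<^sub>R e1" "(?a ^^ n) e2 = \<nu> ^ n *\<^sub>R e2" for n
    by (induction n) (simp_all add: matrix_vector_mult_scaleR ae)
  have lan: "linear (?a ^^ n)" for n by (rule linear_real_matrix_funpow)
  define E :: "torus \<Rightarrow> (real^2) set" where "E p = span {e1}" for p
  have sub: "continuous_subbundle E"
    unfolding continuous_subbundle_def
  proof (rule exI[of _ "1::nat"], rule allI, rule exI[of _ UNIV], rule exI[of _ "\<lambda>_ _. e1"], intro conjI ballI allI impI)
    show "independent ((\<lambda>i. e1) ` {..<1::nat})" using e10 by (simp add: lessThan_Suc)
  qed (simp_all add: E_def lessThan_Suc inj_on_def)
  have inE: "k *\<^sub>R e1 \<in> E p" for k p unfolding E_def by (intro span_scale span_base) simp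
  have Eobt: "\<exists>k. v = k *\<^sub>R e1" if "v \<in> E p" for v p using that by (auto simp: E_def span_singleton)
  have dec: "\<exists>s u. v = s *\<^sub>R e1 + u *\<^sub>R e2" for v :: "real^2"
  proof -
    have "v = (v $ 1 - (v $ 2 - (\<mu> - 3) * v $ 1) / (\<nu> - \<mu>)) *\<^sub>R e1 + ((v $ 2 - (\<mu> - 3) * v $ 1) / (\<nu> - \<mu>)) *\<^sub>R e2"
    proof -
      have *: "x2 = (x1 - (x2 - (\<mu> - 3) * x1) / (\<nu> - \<mu>)) * (\<mu> - 3) + (x2 - (\<mu> - 3) * x1) / (\<nu> - \<mu>) * (\<nu> - 3)" for x1 x2
        using \<mu>(7) by (simp add: divide_simps) (simp add: algebra_simps)
      show ?thesis using *[of "v $ 2" "v $ 1"] by (simp add: vec_eq_iff forall_2 e)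
    qed
    then show ?thesis by blast
  qed
  have con: "norm (torus_deriv (?f ^^ n) p v) \<le> 1 * \<mu> ^ n * norm v" if vE: "v \<in> E p" for n p v
  proof -
    obtain k where k: "v = k *\<^sub>R e1" using Eobt[OF vE] by blast
    show ?thesis unfolding torus_linear_deriv k linear_scale[OF lan] an using \<mu>(1) by (simp add: abs_mult)
  qed
  have expd: "infdist v (E p) \<le> 1 * \<mu> ^ n * infdist (torus_deriv (?f ^^ n) p v) (E ((?f ^^ n) p))" for n p v
  proof -
    obtain s u where v: "v = s *\<^sub>R e1 + u *\<^sub>R e2" using dec by blast
    let ?w = "(?a ^^ n) v"
    have w: "?w = (s * \<mu> ^ n) *\<^sub>R e1 + (u * \<nu> ^ n) *\<^sub>R e2"
      unfolding v linear_add[OF lan] linear_scale[OF lan] an by simp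
    have clE: "closed (E q)" "E q \<noteq> {}" for q unfolding E_def using span_0 by (auto intro!: closed_subspace subspace_span)
    obtain e' where e': "e' \<in> E ((?f ^^ n) p)" "infdist ?w (E ((?f ^^ n) p)) = dist ?w e'"
      by (rule infdist_attains_inf[OF clE]) (rule that)
    obtain k where k: "e' = k *\<^sub>R e1" using Eobt[OF e'(1)] by blast
    have \<nu>n: "\<nu> ^ n > 0" using \<mu>(6) by simp
    define r where "r = (s * \<mu> ^ n - k) / \<nu> ^ n"
    have r: "\<nu> ^ n * r = s * \<mu> ^ n - k" using \<mu>(6) by (simp add: r_def)
    have "?w - e' = (\<nu> ^ n * r) *\<^sub>R e1 + (u * \<nu> ^ n) *\<^sub>R e2"
      unfolding w k r by (simp add: scaleR_diff_left)
    also have "\<dots> = \<nu> ^ n *\<^sub>R (v - (s - r) *\<^sub>R e1)" by (simp add: v algebra_simps)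
    finally have "dist ?w e' = \<nu> ^ n * dist v ((s - r) *\<^sub>R e1)"
      using \<nu>n by (simp add: dist_norm)
    moreover have "infdist v (E p) \<le> dist v ((s - r) *\<^sub>R e1)" by (rule infdist_le[OF inE])
    ultimately have "\<nu> ^ n * infdist v (E p) \<le> dist ?w e'" using \<nu>n by simp
    then have 1: "\<mu> ^ n * (\<nu> ^ n * infdist v (E p)) \<le> \<mu> ^ n * dist ?w e'" using \<mu>(1) by (intro mult_left_mono) auto
    have "1 * infdist v (E p) \<le> (\<mu> * \<nu>) ^ n * infdist v (E p)"
      using one_le_power[OF \<mu>(3), of n] by (intro mult_right_mono infdist_nonneg)
    also have "\<dots> = \<mu> ^ n * (\<nu> ^ n * infdist v (E p))" by (simp only: power_mult_distrib mult.assoc)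
    also note 1
    finally show ?thesis unfolding torus_linear_deriv e'(2) by simp
  qed
  have d1: "torus_deriv ?f p v = ?a v" for p v using torus_linear_deriv[where n = 1 and A = A and p = p and v = v] by simp
  have invE: "torus_deriv ?f p ` E p = E (?f p)" for p
  proof (intro equalityI subsetI)
    fix x assume "x \<in> torus_deriv ?f p ` E p"
    then obtain v where v: "v \<in> E p" "x = ?a v" by (auto simp: d1)
    obtain k where "v = k *\<^sub>R e1" using Eobt[OF v(1)] by blast
    then have "x = (k * \<mu>) *\<^sub>R e1" by (simp add: v(2) matrix_vector_mult_scaleR ae)
    then show "x \<in> E (?f p)" using inE by simp
  next
    fix x assume "x \<in> E (?f p)"
    then obtain k where k: "x = k *\<^sub>R e1" using Eobt by blast
    have "x = torus_deriv ?f p ((k / \<mu>) *\<^sub>R e1)" using \<mu>(1) by (simp add: k d1 matrix_vector_mult_scaleR ae)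
    then show "x \<in> torus_deriv ?f p ` E p" using inE by blast
  qed
  have "anosov_local_diffeo ?f"
    unfolding anosov_local_diffeo_def
    by (intro conjI ld exI[of _ E] sub allI invE exI[of _ "1::real"] zero_less_one exI[of _ \<mu>] \<mu>(1,2) ballI con expd)
  moreover have "\<not> bij ?f"
  proof
    assume "bij ?f"
    define x where "x = (vector [1/2, 1/2] :: real^2)"
    have x: "x $ 1 = 1/2" "x $ 2 = 1/2" by (simp_all add: x_def)
    have "?a x - ?a 0 \<in> int_lattice" by (simp add: int_lattice_def forall_2 a x)
    then have "?f (torus_proj x) = ?f (torus_proj 0)" by (simp only: torus_linear_proj torus_proj_eq_iff_lattice)
    then have "torus_proj x = torus_proj 0" using \<open>bij ?f\<close> by (simp add: bij_def inj_eq)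
    then have "x $ 1 \<in> \<int>" by (simp add: torus_proj_eq_iff)
    then show False unfolding x using Ints_nonzero_abs_less1[of "1/2::real"] by simp
  qed
  moreover have "\<not> expanding_map ?f"
  proof
    assume "expanding_map ?f"
    then obtain C r where C: "C > 0" "0 < r" "r < 1"
      "\<And>n p v. norm v \<le> C * r ^ n * norm (torus_deriv (?f ^^ n) p v)"
      unfolding expanding_map_def by metis
    obtain n where n: "C * r ^ n < 1" by (rule geometric_below[OF C(2,3) zero_less_one]) (rule that)
    have "norm e1 \<le> C * r ^ n * (\<mu> ^ n * norm e1)"
      using C(4)[of e1 n "torus_proj 0"] \<mu>(1) by (simp add: torus_linear_deriv an)
    also have "\<dots> \<le> C * r ^ n * (1 * norm e1)"
      using C(1,2) \<mu>(1,2) by (intro mult_left_mono mult_right_mono power_le_one) auto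
    also have "\<dots> < 1 * norm e1" unfolding mult_1 using n e10 by simp
    finally show False by simp
  qed
  ultimately show ?thesis by (simp add: linear_anosov_def anosov_map_def A_def)
qed

theorem theorem1:
  "(\<exists>\<U>. \<U> \<noteq> {} \<and> openin C1_local_diffeo_topology \<U> \<and>
      (\<forall>f\<in>\<U>. derived_from_anosov f \<and> (\<forall>g. anosov_map g \<longrightarrow> \<not> semi_conjugate f g))) \<and>
   (\<forall>A. linear_anosov A \<longrightarrow>
      (\<exists>\<U>. \<U> \<noteq> {} \<and> openin C1_local_diffeo_topology \<U> \<and>
         (\<forall>f\<in>\<U>. derived_from_anosov f \<and> (\<forall>g. anosov_map g \<longrightarrow> \<not> semi_conjugate f g)) \<and>
         (\<forall>f\<in>\<U>. torus_homotopic f (torus_linear A))))"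
proof (intro conjI allI impI)
  show "\<exists>\<U>. \<U> \<noteq> {} \<and> openin C1_local_diffeo_topology \<U> \<and>
      (\<forall>f\<in>\<U>. derived_from_anosov f \<and> (\<forall>g. anosov_map g \<longrightarrow> \<not> semi_conjugate f g))"
    using linear_anosov_class_contains_open_set[OF linear_anosov_example] by (elim exE conjE) (intro exI conjI)
  fix A assume "linear_anosov A"
  then show "\<exists>\<U>. \<U> \<noteq> {} \<and> openin C1_local_diffeo_topology \<U> \<and>
         (\<forall>f\<in>\<U>. derived_from_anosov f \<and> (\<forall>g. anosov_map g \<longrightarrow> \<not> semi_conjugate f g)) \<and>
         (\<forall>f\<in>\<U>. torus_homotopic f (torus_linear A))"
    by (rule linear_anosov_class_contains_open_set)
qed

end
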